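(* Fix $w_1,\dots,w_6>0$ and $n\in\mathbb{N}$. Let $\rho(k)$, $k\in\mathbb{N}$, be probability measures on $\mathsf{GT}^{n+}$ satisfying the six-vertex Gibbs property with weights $(w_1,w_2,w_3,w_4,w_5,w_6)$. Let $a(k)$ and $b(k)$ be real sequences with $b(k)\to\infty$ as $k\to\infty$, and let $g_k:\mathbb{R}^{n(n+1)/2}\to\mathbb{R}^{n(n+1)/2}$ be $$g_k(x)=\frac1{b(k)}\left(x-a(k)\cdot\mathbf 1_{\frac{n(n+1)}2}\right),$$ where $\mathbf 1_K$ is the vector in $\mathbb{R}^K$ with all entries $1$. Suppose that $\rho(k)\circ g_k^{-1}$ converges weakly to a probability distribution $\mu$ on the Gelfand–Tsetlin cone $GT^n$ such that $$\mathbb{P}^\mu\left(y_i^n=y_{i+1}^n=y_{i+2}^n\ \text{for some } i=1,\dots,n-2\right)=0.$$ Then $\mu$ satisfies the continuous Gibbs property.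
   Context: Paths: let $D_n=\mathbb{Z}_{\ge0}\times\{1,\dots,n\}$. $\mathcal{P}_n$ is the set of collections $\omega$ of $n$ up-right lattice paths in $D_n$ such that a path enters each point $(0,m)$, $1\le m\le n$, through the horizontal arrow from $(-1,m)$, all paths exit through the top boundary, and no two paths share a horizontal or vertical edge. $\omega(i,j)=(i_1,j_1;i_2,j_2)$ records the numbers of arrows at $(i,j)$ entering from below, entering from the left, leaving upwards, leaving to the right. $\lambda^k(\omega)=(\lambda_1^k\ge\dots\ge\lambda_k^k)$ lists the $x$-coordinates of the intersections of $\omega$ with $y=k+1/2$. Patterns: $\mathsf{GT}_n=\{\lambda\in\mathbb{Z}^n:\lambda_1<\dots<\lambda_n\}$, $\mathsf{GT}_n^+$ is the subset with $\lambda_1\ge0$. For $\lambda\in\mathsf{GT}_n,\mu\in\mathsf{GT}_{n-1}$ write $\mu\preceq\lambda$ if $\lambda_1\le\mu_1\le\lambda_2\le\dots\le\mu_{n-1}\le\lambda_n$. $\mathsf{GT}^{n}$ is the set of sequences $\mu^1\preceq\dots\preceq\mu^n$ with $\mu^i\in\mathsf{GT}_i$, and $\mathsf{GT}^{n+}$ the subset with $\mu^n\in\mathsf{GT}_n^+$ (viewed inside $\mathbb{R}^{n(n+1)/2}$). The map $h:\mathcal{P}_n\to\mathsf{GT}^{n+}$, $h(\omega)=(\mu^1\preceq\dots\preceq\mu^n)$ with $\mu_i^k=\lambda^k_{k-i+1}(\omega)$, is a bijection. For $\lambda\in\mathsf{GT}_n^+$, $\mathcal{P}_n^\lambda=\{\omega\in\mathcal{P}_n:\lambda_i^n(\omega)=\lambda_{n-i+1},\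 1\le i\le n\}$. Six-vertex Gibbs property: a probability measure $\nu$ on $\mathcal{P}_n^\lambda$ satisfies the Gibbs property (for the six-vertex model on $D_n$ with weights $(w_1,\dots,w_6)$) if for every finite $\Lambda\subset D_n$ the conditional probability of $\omega$ given $\omega|_{D_n\setminus\Lambda}$ is proportional to $w_1^{N_1}\cdots w_6^{N_6}$, where $N_1,\dots,N_6$ are the numbers of vertices in $\Lambda$ with configurations $(0,0;0,0)$, $(1,1;1,1)$, $(1,0;1,0)$, $(0,1;0,1)$, $(1,0;0,1)$, $(0,1;1,0)$ respectively. A probability measure $\rho$ on $\mathsf{GT}^{n+}$ satisfies the six-vertex Gibbs property with weights $(w_1,\dots,w_6)$ if for every $\lambda\in\mathsf{GT}_n^+$ with $\rho(\mu^n=\lambda)>0$, the push-forward under $h^{-1}$ of $\rho(\,\cdot\mid\mu^n=\lambda)$, a measure on $\mathcal{P}_n^\lambda$, satisfies the Gibbs property with weights $(w_1,\dots,w_6)$. Continuous Gibbs property: for $x\in\mathbb{R}^n$, $y\in\mathbb{R}^{n-1}$ write $x\succeq y$ if $x_1\le y_1\le x_2\le\dots\le y_{n-1}\le x_n$. For $x_1\le\dots\le x_n$, $GT_n(x)=\{(x^1,\dots,x^n):x^n=x,\ x^k\in\mathbb{R}^k,\ x^k\succeq x^{k-1}\}$, with uniform measure the normalized Lebesgue measure on the affine subspace it spans. $GT^n=\{y\in\mathbb{R}^{n(n+1)/2}:y_i^{j+1}\le y_i^j\le y_{i+1}^{j+1},\ 1\le i\le j\le n-1\}$. A probability measure on $GT^n$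 satisfies the continuous Gibbs property if conditioned on the top row $y^n$ the distribution of $(y^1,\dots,y^{n-1})$ is uniform on $GT_n(y^n)$. *)

theory Defs
  imports "HOL-Probability.Probability"
begin

section \<open>Collections of up-right paths\<close>

type_synonym vertex = "int \<times> nat"
type_synonym arrow = "vertex \<times> vertex"

definition lattice :: "nat \<Rightarrow> vertex set" where
  "lattice n = {(x, y). 0 \<le> x \<and> 1 \<le> y \<and> y \<le> n}"

definition up_right_step :: "vertex \<Rightarrow> vertex \<Rightarrow> bool" where
  "up_right_step u v \<longleftrightarrow>
     v = (fst u + 1, snd u) \<or> v = (fst u, Suc (snd u))"

text \<open>The vertex list of a path includes the two endpoints outside the lattice: the
  source of the incoming horizontal arrow and the target of the outgoing vertical arrow.\<close>

definition lattice_path :: "nat \<Rightarrow> nat \<Rightarrow> vertex list \<Rightarrow> bool" where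
  "lattice_path n m p \<longleftrightarrow>
     successively up_right_step p \<and>
     (\<exists>x vs. p = (- 1, m) # vs @ [(x, Suc n)] \<and> vs \<noteq> [] \<and> set vs \<subseteq> lattice n \<and>
        hd vs = (0, m) \<and> last vs = (x, n))"

definition path_arrows :: "vertex list \<Rightarrow> arrow set" where
  "path_arrows p = set (zip p (tl p))"

text \<open>A collection is recorded by the set of arrows it uses: when two paths meet at a vertex,
  which of them continues upwards and which to the right is not part of the configuration
  (otherwise the correspondence with interlacing patterns below would not be injective).\<close>

definition path_collections :: "nat \<Rightarrow> arrow set set" where
  "path_collections n =
     {\<omega>. \<exists>p. (\<forall>m\<in>{1..n}. lattice_path n m (p m)) \<and>
          disjoint_family_on (\<lambda>m. path_arrows (p m)) {1..n} \<and>
          \<omega> = (\<Union>m\<in>{1..n}. path_arrows (p m))}"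

text \<open>Arrows entering from below, entering from the left, leaving upwards, leaving to the right.\<close>

definition local_config :: "arrow set \<Rightarrow> vertex \<Rightarrow> nat \<times> nat \<times> nat \<times> nat" where
  "local_config \<omega> = (\<lambda>(x, y).
     (of_bool (((x, y - 1), (x, y)) \<in> \<omega>), of_bool (((x - 1, y), (x, y)) \<in> \<omega>),
      of_bool (((x, y), (x, Suc y)) \<in> \<omega>), of_bool (((x, y), (x + 1, y)) \<in> \<omega>)))"

text \<open>The coordinate \<open>\<lambda>\<^sub>i\<^sup>k(\<omega>)\<close>, i.e. the \<open>i\<close>-th largest (counting from 1) abscissa of an
  intersection of the configuration with the line \<open>y = k + 1/2\<close>.\<close>

definition crossing :: "arrow set \<Rightarrow> nat \<Rightarrow> nat \<Rightarrow> int" where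
  "crossing \<omega> k i = rev (sorted_list_of_set {x. ((x, k), (x, Suc k)) \<in> \<omega>}) ! (i - 1)"


section \<open>Interlacing patterns\<close>

text \<open>A triangular array is an extensional function on \<open>tri n\<close>; its value at \<open>(k, i)\<close> is the
  \<open>i\<close>-th entry of the \<open>k\<close>-th row, written with upper index \<open>k\<close> and lower index \<open>i\<close>.\<close>

definition tri :: "nat \<Rightarrow> (nat \<times> nat) set" where
  "tri n = {(k, i). 1 \<le> i \<and> i \<le> k \<and> k \<le> n}"

definition pat_row :: "nat \<Rightarrow> (nat \<times> nat \<Rightarrow> 'a) \<Rightarrow> nat \<Rightarrow> 'a" where
  "pat_row k y = (\<lambda>i\<in>{1..k}. y (k, i))"

definition interlaces :: "nat \<Rightarrow> (nat \<Rightarrow> 'a::linorder) \<Rightarrow> (nat \<Rightarrow> 'a) \<Rightarrow> bool" where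
  "interlaces k y x \<longleftrightarrow> (\<forall>i\<in>{1..<k}. x i \<le> y i \<and> y i \<le> x (i + 1))"

definition signatures :: "nat \<Rightarrow> (nat \<Rightarrow> int) set" where
  "signatures n = {l \<in> {1..n} \<rightarrow>\<^sub>E UNIV. strict_mono_on {1..n} l}"

definition nonneg_signatures :: "nat \<Rightarrow> (nat \<Rightarrow> int) set" where
  "nonneg_signatures n = {l \<in> signatures n. 0 \<le> l 1}"

definition patterns :: "nat \<Rightarrow> (nat \<times> nat \<Rightarrow> int) set" where
  "patterns n = {m \<in> tri n \<rightarrow>\<^sub>E UNIV.
     (\<forall>k\<in>{1..n}. pat_row k m \<in> signatures k) \<and>
     (\<forall>k\<in>{1..<n}. interlaces (k + 1) (pat_row k m) (pat_row (k + 1) m))}"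

definition nonneg_patterns :: "nat \<Rightarrow> (nat \<times> nat \<Rightarrow> int) set" where
  "nonneg_patterns n = {m \<in> patterns n. pat_row n m \<in> nonneg_signatures n}"

definition pattern_of_paths :: "nat \<Rightarrow> arrow set \<Rightarrow> nat \<times> nat \<Rightarrow> int" where
  "pattern_of_paths n \<omega> = (\<lambda>(k, i)\<in>tri n. crossing \<omega> k (k - i + 1))"

definition paths_with_top :: "nat \<Rightarrow> (nat \<Rightarrow> int) \<Rightarrow> arrow set set" where
  "paths_with_top n l =
     {\<omega> \<in> path_collections n. \<forall>i\<in>{1..n}. crossing \<omega> n i = l (n - i + 1)}"


section \<open>The six-vertex Gibbs property\<close>

definition config_count :: "vertex set \<Rightarrow> arrow set \<Rightarrow> nat \<times> nat \<times> nat \<times> nat \<Rightarrow> nat" where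
  "config_count \<Lambda> \<omega> t = card {v \<in> \<Lambda>. local_config \<omega> v = t}"

definition six_vertex_weight :: "(nat \<Rightarrow> real) \<Rightarrow> vertex set \<Rightarrow> arrow set \<Rightarrow> real" where
  "six_vertex_weight w \<Lambda> \<omega> =
     w 1 ^ config_count \<Lambda> \<omega> (0, 0, 0, 0) * w 2 ^ config_count \<Lambda> \<omega> (1, 1, 1, 1) *
     w 3 ^ config_count \<Lambda> \<omega> (1, 0, 1, 0) * w 4 ^ config_count \<Lambda> \<omega> (0, 1, 0, 1) *
     w 5 ^ config_count \<Lambda> \<omega> (1, 0, 0, 1) * w 6 ^ config_count \<Lambda> \<omega> (0, 1, 1, 0)"

definition same_outside ::
    "nat \<Rightarrow> (nat \<Rightarrow> int) \<Rightarrow> vertex set \<Rightarrow> arrow set \<Rightarrow> arrow set set" where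
  "same_outside n l \<Lambda> \<omega>\<^sub>0 = {\<omega> \<in> paths_with_top n l.
     \<forall>v \<in> lattice n - \<Lambda>. local_config \<omega> v = local_config \<omega>\<^sub>0 v}"

text \<open>The constant \<open>c\<close> is the inverse partition function; it depends on the region and on the
  configuration outside it.\<close>

definition path_gibbs ::
    "nat \<Rightarrow> (nat \<Rightarrow> int) \<Rightarrow> (nat \<Rightarrow> real) \<Rightarrow> arrow set pmf \<Rightarrow> bool" where
  "path_gibbs n l w \<nu> \<longleftrightarrow>
     set_pmf \<nu> \<subseteq> paths_with_top n l \<and>
     (\<forall>\<Lambda> \<omega>\<^sub>0. finite \<Lambda> \<and> \<Lambda> \<subseteq> lattice n \<and> \<omega>\<^sub>0 \<in> paths_with_top n l \<and>
        measure_pmf.prob \<nu> (same_outside n l \<Lambda> \<omega>\<^sub>0) > 0 \<longrightarrow>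
        (\<exists>c. \<forall>\<omega> \<in> same_outside n l \<Lambda> \<omega>\<^sub>0.
           pmf (cond_pmf \<nu> (same_outside n l \<Lambda> \<omega>\<^sub>0)) \<omega> = c * six_vertex_weight w \<Lambda> \<omega>))"

definition six_vertex_gibbs ::
    "nat \<Rightarrow> (nat \<Rightarrow> real) \<Rightarrow> (nat \<times> nat \<Rightarrow> int) pmf \<Rightarrow> bool" where
  "six_vertex_gibbs n w \<rho> \<longleftrightarrow>
     (\<forall>l \<in> nonneg_signatures n. measure_pmf.prob \<rho> {m. pat_row n m = l} > 0 \<longrightarrow>
        path_gibbs n l w
          (map_pmf (inv_into (path_collections n) (pattern_of_paths n))
             (cond_pmf \<rho> {m. pat_row n m = l})))"


section \<open>Measures on finite-dimensional coordinate spaces\<close>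

abbreviation coord_space :: "'i set \<Rightarrow> ('i \<Rightarrow> real) measure" where
  "coord_space I \<equiv> PiM I (\<lambda>_. borel)"

definition weakly_converges ::
    "'i set \<Rightarrow> (nat \<Rightarrow> ('i \<Rightarrow> real) measure) \<Rightarrow> ('i \<Rightarrow> real) measure \<Rightarrow> bool" where
  "weakly_converges I M N \<longleftrightarrow>
     (\<forall>f. continuous_map (powertop_real I) euclideanreal f \<and> bounded (f ` (I \<rightarrow>\<^sub>E UNIV)) \<longrightarrow>
        (\<lambda>k. \<integral>y. f y \<partial>M k) \<longlonglongrightarrow> (\<integral>y. f y \<partial>N))"

definition affine_span :: "'i set \<Rightarrow> ('i \<Rightarrow> real) set \<Rightarrow> ('i \<Rightarrow> real) set" where
  "affine_span I K = {(\<lambda>i\<in>I. \<Sum>x\<in>F. u x * x i) | F u.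
     finite F \<and> F \<subseteq> K \<and> (\<Sum>x\<in>F. u x) = (1::real)}"

text \<open>Lebesgue measure on an affine subspace of dimension \<open>d\<close> is the image of Lebesgue measure
  on \<open>\<real>\<^sup>d\<close> under an isometric affine parametrization, given by a base point \<open>c\<close> and an
  orthonormal basis \<open>v\<close> of the direction space. It does not depend on the parametrization.
  For \<open>d = 0\<close> it is the point mass at \<open>c\<close>.\<close>

definition affine_lebesgue :: "'i set \<Rightarrow> ('i \<Rightarrow> real) set \<Rightarrow> ('i \<Rightarrow> real) measure \<Rightarrow> bool" where
  "affine_lebesgue I V L \<longleftrightarrow>
     (\<exists>(d::nat) c v \<phi>.
        (\<forall>j<d. \<forall>j'<d. (\<Sum>i\<in>I. v j i * v j' i) = of_bool (j = j')) \<and>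
        \<phi> = (\<lambda>t. \<lambda>i\<in>I. c i + (\<Sum>j<d. t j * v j i)) \<and>
        \<phi> ` ({..<d} \<rightarrow>\<^sub>E UNIV) = V \<and>
        L = distr (PiM {..<d} (\<lambda>_. lborel)) (coord_space I) \<phi>)"

definition is_uniform_on :: "'i set \<Rightarrow> ('i \<Rightarrow> real) set \<Rightarrow> ('i \<Rightarrow> real) measure \<Rightarrow> bool" where
  "is_uniform_on I K U \<longleftrightarrow>
     (\<exists>L. affine_lebesgue I (affine_span I K) L \<and> U = uniform_measure L K)"


section \<open>The continuous Gibbs property\<close>

definition GT_cone :: "nat \<Rightarrow> (nat \<times> nat \<Rightarrow> real) set" where
  "GT_cone n = {y \<in> tri n \<rightarrow>\<^sub>E UNIV.
     \<forall>k\<in>{1..<n}. interlaces (k + 1) (pat_row k y) (pat_row (k + 1) y)}"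

definition GT_polytope :: "nat \<Rightarrow> (nat \<Rightarrow> real) \<Rightarrow> (nat \<times> nat \<Rightarrow> real) set" where
  "GT_polytope n x = {y \<in> GT_cone n. pat_row n y = x}"

definition top_row_algebra ::
    "nat \<Rightarrow> (nat \<times> nat \<Rightarrow> real) measure \<Rightarrow> (nat \<times> nat \<Rightarrow> real) measure" where
  "top_row_algebra n M = vimage_algebra (space M) (pat_row n) (coord_space {1..n})"

text \<open>The kernel \<open>\<kappa>\<close> is a regular conditional distribution of the array given its top row; since
  such a kernel is only determined almost surely, so is the requirement that it be uniform.\<close>

definition continuous_gibbs :: "nat \<Rightarrow> (nat \<times> nat \<Rightarrow> real) measure \<Rightarrow> bool" where
  "continuous_gibbs n M \<longleftrightarrow>
     (\<exists>\<kappa>. (\<forall>A \<in> sets (coord_space (tri n)). AE y in M.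
             real_cond_exp M (top_row_algebra n M) (indicator A) y = measure (\<kappa> (pat_row n y)) A) \<and>
          (AE y in M. is_uniform_on (tri n) (GT_polytope n (pat_row n y)) (\<kappa> (pat_row n y))))"


section \<open>Rescaling\<close>

definition pattern_law :: "nat \<Rightarrow> (nat \<times> nat \<Rightarrow> int) pmf \<Rightarrow> (nat \<times> nat \<Rightarrow> real) measure" where
  "pattern_law n \<rho> =
     distr (measure_pmf \<rho>) (coord_space (tri n)) (\<lambda>m. \<lambda>q\<in>tri n. real_of_int (m q))"

definition rescale ::
    "nat \<Rightarrow> real \<Rightarrow> real \<Rightarrow> (nat \<times> nat \<Rightarrow> real) \<Rightarrow> nat \<times> nat \<Rightarrow> real" where
  "rescale n a b y = (\<lambda>q\<in>tri n. 1 / b * (y q - a))"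

end

theory Submission
  imports Defs
begin

text \<open>
  Why the limit is uniform. A collection of paths is determined by its interlacing pattern, and the
  six-vertex weight can be read off the pattern. Conservation of arrows at the vertices gives linear
  relations between the numbers of vertices of the six types, and the total number of horizontal
  arrows is a function of the top row because row sums telescope. Two counts remain free: those of
  the entries that coincide with their left, respectively right, neighbour in the row above. Hence,
  given the top row, the probability of a pattern is a constant times a product of two fixed ratios
  \<open>r = w 1 w 2 / (w 5 w 6)\<close> and \<open>s = w 3 w 4 / (w 5 w 6)\<close>, one for each coincidence
  (\<open>six_vertex_gibbs_pmf\<close>). At a large scale coincidences are rare, so the law given the top row
  approaches the uniform law.

  The comparison is made through nested averages. A pattern is filled in row by row from the top, and
  the choice of an entry between its two upper neighbours is parametrized by a number \<open>t\<close> in the unit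
  interval: in the discrete case by the quantile function of the weights \<open>r, 1, ..., 1, s\<close>, in the
  continuous case by linear interpolation. The quantile function differs from the interpolation by
  a bounded amount, so after rescaling the integrands converge for every \<open>t\<close>, and dominated
  convergence gives convergence of the averages (\<open>nest_tendsto\<close>). The masses of the choices in the row
  below the top one depend on the top row only. Leaving them out makes the argument insensitive to
  ties: if two entries of the limiting top row coincide, the entry between them is forced and its
  parameter is simply integrated out. As long as no three consecutive top entries coincide, all
  further intervals have positive length and the limiting average of the constant one is positive
  (\<open>nest_pos\<close>), so that ratios of averages, which are the conditional expectations given the top row,
  converge too.

  To pass to the limit in the mixture over top rows, the discrete conditional expectations are
  functions of arrays that converge along every convergent sequence of rescaled arrays. Lipschitz
  envelopes give an upper bound for the limit of their integrals under weak convergence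
  (\<open>extended_mapping_upper\<close>), and applying it to \<open>f\<close> and \<open>1 - f\<close> shows that the limit law is the mixture
  of the normalized nested averages over its own top row (\<open>limit_is_mixture\<close>). Finally, undoing the
  parametrization one coordinate at a time identifies the normalized nested average with the uniform
  measure on the polytope of arrays with the given top row, on the subspace of its free coordinates
  if there are ties (\<open>gap_nest_eq_iter\<close>, \<open>affine_span_polytope\<close>), and a mixture of laws that sit over
  different top rows is its own disintegration (\<open>continuous_gibbs_if_mixture\<close>).
\<close>


section \<open>Conservation of arrows along paths\<close>


definition inflow :: "arrow set \<Rightarrow> vertex \<Rightarrow> nat" where
  "inflow A v = of_bool (((fst v, snd v - 1), v) \<in> A) + of_bool (((fst v - 1, snd v), v) \<in> A)"

definition outflow :: "arrow set \<Rightarrow> vertex \<Rightarrow> nat" where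
  "outflow A v = of_bool ((v, (fst v, Suc (snd v))) \<in> A) + of_bool ((v, (fst v + 1, snd v)) \<in> A)"

lemma path_arrows_Cons: "path_arrows (u # v # p) = insert (u, v) (path_arrows (v # p))"
  by (simp add: path_arrows_def)

lemma path_arrows_single [simp]: "path_arrows [u] = {}" "path_arrows [] = {}"
  by (simp_all add: path_arrows_def)

lemma path_arrows_append:
  assumes "p \<noteq> []" "q \<noteq> []"
  shows "path_arrows (p @ q) = path_arrows p \<union> path_arrows q \<union> {(last p, hd q)}"
  using assms(1)
proof (induction p rule: induct_list012)
  case (2 x)
  then show ?case using assms(2) by (cases q) (auto simp: path_arrows_Cons)
next
  case (3 x y zs)
  then show ?case by (auto simp: path_arrows_Cons)
qed simp

lemma path_arrows_rank:
  assumes "successively up_right_step (u # p)" "(a, b) \<in> path_arrows (u # p)"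
  shows "fst u + int (snd u) \<le> fst a + int (snd a)"
  using assms
proof (induction p arbitrary: u)
  case (Cons v p)
  then show ?case
    by (fastforce simp: path_arrows_Cons up_right_step_def)
qed simp

text \<open>The coordinate sum increases strictly along an up-right path, so no arrow is used twice and
  flow can be counted by induction on the vertex list; the two endpoints carry the defects.\<close>

lemma path_flow:
  assumes "successively up_right_step p" "p \<noteq> []"
  shows "inflow (path_arrows p) v + of_bool (v = hd p) = outflow (path_arrows p) v + of_bool (v = last p)"
  using assms
proof (induction p rule: induct_list012)
  case (3 a b p)
  let ?A = "path_arrows (b # p)"
  have st: "up_right_step a b" and suc: "successively up_right_step (b # p)"
    using 3 by auto
  have new: "(a, b) \<notin> ?A"
  proof
    assume "(a, b) \<in> ?A"
    with path_arrows_rank[OF suc] have "fst b + int (snd b) \<le> fst a + int (snd a)" by blast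
    with st show False by (auto simp: up_right_step_def)
  qed
  have i: "inflow (insert (a, b) ?A) v = inflow ?A v + of_bool (v = b)"
  proof -
    obtain x y where a: "a = (x, y)" by force
    from st consider "b = (x + 1, y)" | "b = (x, Suc y)" by (auto simp: up_right_step_def a)
    then show ?thesis using new unfolding a inflow_def by cases auto
  qed
  have o: "outflow (insert (a, b) ?A) v = outflow ?A v + of_bool (v = a)"
  proof -
    obtain x y where a: "a = (x, y)" by force
    from st consider "b = (x + 1, y)" | "b = (x, Suc y)" by (auto simp: up_right_step_def a)
    then show ?thesis using new unfolding a outflow_def by cases (cases v, auto)+
  qed
  show ?case
    using 3(2)[OF suc] i o by (simp add: path_arrows_Cons)
qed (auto simp: inflow_def outflow_def)

lemma of_bool_UN:
  assumes "finite I" "disjoint_family_on A I"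
  shows "of_bool (x \<in> (\<Union>i\<in>I. A i)) = (\<Sum>i\<in>I. of_bool (x \<in> A i) :: nat)"
  using assms
proof (induction I)
  case (insert i I)
  have "disjoint_family_on A I" using insert.prems by (auto simp: disjoint_family_on_def)
  moreover have "A i \<inter> (\<Union>j\<in>I. A j) = {}"
    using insert.prems insert.hyps by (auto simp: disjoint_family_on_def)
  ultimately have "of_bool (x \<in> (\<Union>j\<in>insert i I. A j)) = (of_bool (x \<in> A i) + of_bool (x \<in> (\<Union>j\<in>I. A j)) :: nat)"
    by (cases "x \<in> A i") auto
  then show ?case using insert.IH[OF \<open>disjoint_family_on A I\<close>] insert.hyps by simp
qed simp

lemma path_arrows_mem:
  assumes "lattice_path n m p" "(u, v) \<in> path_arrows p"
  shows "up_right_step u v" "u \<in> lattice n \<or> u = (-1, m) \<and> v = (0, m)"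
    "v \<in> lattice n \<or> snd v = Suc n \<and> u \<in> lattice n"
proof -
  obtain x vs where p: "p = (- 1, m) # vs @ [(x, Suc n)]" "vs \<noteq> []" "set vs \<subseteq> lattice n"
     "hd vs = (0, m)" "last vs = (x, n)" and s: "successively up_right_step p"
    using assms by (auto simp: lattice_path_def)
  have "successively up_right_step p \<Longrightarrow> (u, v) \<in> path_arrows p \<Longrightarrow> up_right_step u v" for p
    by (induction p rule: induct_list012) (auto simp: path_arrows_Cons)
  then show "up_right_step u v" using s assms by blast
  have "path_arrows p = insert ((-1,m), hd vs) (path_arrows vs \<union> {(last vs, (x, Suc n))})"
    unfolding p(1) using p(2)
    by (cases vs) (auto simp: path_arrows_Cons path_arrows_append[of "_ # _" "[_]", simplified])
  moreover have "path_arrows vs \<subseteq> set vs \<times> set vs"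
    by (auto simp: path_arrows_def dest: set_zip_leftD set_zip_rightD)
      (metis list.set_sel(2) set_zip_rightD tl_Nil empty_set empty_iff list.sel(2))
  moreover have "hd vs \<in> set vs" "last vs \<in> set vs" using p(2) by auto
  ultimately show "u \<in> lattice n \<or> u = (-1, m) \<and> v = (0, m)"
    "v \<in> lattice n \<or> snd v = Suc n \<and> u \<in> lattice n"
    using assms(2) p by auto
qed

lemma lattice_path_start:
  assumes "lattice_path n m p"
  shows "((-1, m), (0, m)) \<in> path_arrows p"
proof -
  obtain x vs where p: "p = (- 1, m) # vs @ [(x, Suc n)]" "vs \<noteq> []" "hd vs = (0, m)"
    using assms by (auto simp: lattice_path_def)
  then show ?thesis by (cases vs) (auto simp: path_arrows_Cons)
qed

text \<open>Since the arrow sets are disjoint, membership of an arrow in their union is a sum over the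
  paths, and conservation for every single path adds up.\<close>

lemma collection_flow:
  assumes "\<omega> \<in> path_collections n" "v \<in> lattice n"
  shows "inflow \<omega> v = outflow \<omega> v"
proof -
  obtain p where p: "\<And>m. m\<in>{1..n} \<Longrightarrow> lattice_path n m (p m)"
      and dj: "disjoint_family_on (\<lambda>m. path_arrows (p m)) {1..n}"
      and \<omega>: "\<omega> = (\<Union>m\<in>{1..n}. path_arrows (p m))"
    using assms(1) unfolding path_collections_def by blast
  have eq: "inflow (path_arrows (p m)) v = outflow (path_arrows (p m)) v" if "m \<in> {1..n}" for m
  proof -
    have "successively up_right_step (p m)" "p m \<noteq> []" "hd (p m) = (-1, m)" "snd (last (p m)) = Suc n"
      using p[OF that] by (auto simp: lattice_path_def)
    moreover from this have "v \<noteq> hd (p m)" "v \<noteq> last (p m)"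
      using assms(2) by (fastforce simp: lattice_def)+
    ultimately show ?thesis using path_flow[of "p m" v] by simp
  qed
  have "inflow \<omega> v = (\<Sum>m\<in>{1..n}. inflow (path_arrows (p m)) v)"
    unfolding inflow_def \<omega> by (subst (1 2) of_bool_UN[OF _ dj]) (auto simp: sum.distrib)
  moreover have "outflow \<omega> v = (\<Sum>m\<in>{1..n}. outflow (path_arrows (p m)) v)"
    unfolding outflow_def \<omega> by (subst (1 2) of_bool_UN[OF _ dj]) (auto simp: sum.distrib)
  ultimately show ?thesis using eq by simp
qed

definition verts :: "arrow set \<Rightarrow> nat \<Rightarrow> int set" where
  "verts \<omega> k = {x. ((x, k), (x, Suc k)) \<in> \<omega>}"

definition hor_in :: "arrow set \<Rightarrow> nat \<Rightarrow> int \<Rightarrow> bool" where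
  "hor_in \<omega> k x \<longleftrightarrow> ((x - 1, k), (x, k)) \<in> \<omega>"

lemma collection_arrows:
  assumes "\<omega> \<in> path_collections n"
  shows "finite \<omega>" "x \<in> verts \<omega> k \<Longrightarrow> 0 \<le> x \<and> 1 \<le> k \<and> k \<le> n"
    "k \<in> {1..n} \<Longrightarrow> hor_in \<omega> k 0"
proof -
  obtain p where p: "\<And>m. m\<in>{1..n} \<Longrightarrow> lattice_path n m (p m)"
      and dj: "disjoint_family_on (\<lambda>m. path_arrows (p m)) {1..n}"
      and \<omega>: "\<omega> = (\<Union>m\<in>{1..n}. path_arrows (p m))"
    using assms unfolding path_collections_def by blast
  show "finite \<omega>" unfolding \<omega> by (auto simp: path_arrows_def)
  show "k \<in> {1..n} \<Longrightarrow> hor_in \<omega> k 0"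
    using lattice_path_start[OF p, of k] by (fastforce simp: hor_in_def \<omega>)
  assume "x \<in> verts \<omega> k"
  then obtain m where m: "m \<in> {1..n}" "((x, k), (x, Suc k)) \<in> path_arrows (p m)"
    by (auto simp: verts_def \<omega>)
  with path_arrows_mem(2)[OF p m(2)] show "0 \<le> x \<and> 1 \<le> k \<and> k \<le> n"
    by (auto simp: lattice_def)
qed

lemma collection_step:
  assumes "\<omega> \<in> path_collections n" "k \<in> {1..n}" "0 \<le> x"
  shows "of_bool (x \<in> verts \<omega> (k - 1)) + of_bool (hor_in \<omega> k x)
       = (of_bool (x \<in> verts \<omega> k) + of_bool (hor_in \<omega> k (x + 1)) :: nat)"
  using collection_flow[OF assms(1), of "(x, k)"] assms
  by (simp add: inflow_def outflow_def verts_def hor_in_def lattice_def)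

lemma finite_verts: assumes "\<omega> \<in> path_collections n" shows "finite (verts \<omega> k)"
proof -
  have "verts \<omega> k \<subseteq> (\<lambda>a. fst (fst a)) ` \<omega>"
    by (force simp: verts_def)
  then show ?thesis using collection_arrows(1)[OF assms] finite_surj by blast
qed

text \<open>Conservation summed over the vertices of row \<open>k\<close> to the left of \<open>x\<close>: the paths that have entered
  this stretch are the ones from below and the one that starts in the row, and each of them has
  either left upwards or is about to enter \<open>x\<close>.\<close>

lemma hor_in_count:
  assumes "\<omega> \<in> path_collections n" "k \<in> {1..n}" "0 \<le> x"
  shows "of_bool (hor_in \<omega> k x) + card {z \<in> verts \<omega> k. z < x} = Suc (card {z \<in> verts \<omega> (k - 1). z < x})"
  using assms(3)
proof (induction x rule: int_ge_induct)
  case base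
  have e: "{z \<in> verts \<omega> j. z < 0} = {}" for j using collection_arrows(2)[OF assms(1)] by force
  show ?case using collection_arrows(3)[OF assms(1,2)] by (simp add: e)
next
  case (step x)
  have c: "card {z \<in> verts \<omega> j. z < x + 1} = card {z \<in> verts \<omega> j. z < x} + of_bool (x \<in> verts \<omega> j)" for j
  proof -
    have "{z \<in> verts \<omega> j. z < x + 1} = (if x \<in> verts \<omega> j then insert x {z \<in> verts \<omega> j. z < x} else {z \<in> verts \<omega> j. z < x})"
      by (auto simp: zless_add1_eq le_less)
    then show ?thesis using finite_verts[OF assms(1)] by auto
  qed
  show ?case using step collection_step[OF assms(1,2) step(1)] unfolding c by linarith
qed

text \<open>Far to the right no horizontal arrow remains, so by the previous count each level is crossed
  by one path more than the level below it.\<close>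

lemma card_verts:
  assumes "\<omega> \<in> path_collections n" "k \<le> n"
  shows "card (verts \<omega> k) = k"
  using assms(2)
proof (induction k)
  case 0
  have "verts \<omega> 0 = {}" using collection_arrows(2)[OF assms(1)] by force
  then show ?case by simp
next
  case (Suc k)
  let ?E = "(\<lambda>a. fst (fst a)) ` \<omega> \<union> (\<lambda>a. fst (snd a)) ` \<omega>"
  have fin: "finite ?E" using collection_arrows(1)[OF assms(1)] by blast
  define M where "M = Max (insert 0 ?E) + 1"
  have M: "fst (fst a) < M \<and> fst (snd a) < M" if "a \<in> \<omega>" for a
    unfolding M_def using fin that by (auto simp: zless_add1_eq le_less[symmetric] intro!: Max_ge)
  have v: "{z \<in> verts \<omega> j. z < max 0 M} = verts \<omega> j" for j using M by (force simp: verts_def)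
  have h: "\<not> hor_in \<omega> (Suc k) (max 0 M)" using M by (force simp: hor_in_def)
  show ?case using hor_in_count[OF assms(1), of "Suc k" "max 0 M"] Suc h by (simp add: v)
qed


section \<open>Interlacing patterns and vertex counts\<close>


definition lpar :: "nat \<times> nat \<Rightarrow> nat \<times> nat" where "lpar q = (Suc (fst q), snd q)"
definition rpar :: "nat \<times> nat \<Rightarrow> nat \<times> nat" where "rpar q = (Suc (fst q), Suc (snd q))"

lemma patterns_strict:
  assumes "m \<in> patterns n" "k \<le> n" "1 \<le> i" "i < j" "j \<le> k"
  shows "m (k, i) < m (k, j)"
proof -
  have "pat_row k m \<in> signatures k" using assms by (auto simp: patterns_def)
  then have "strict_mono_on {1..k} (pat_row k m)" by (simp add: signatures_def)
  from strict_mono_onD[OF this, of i j] show ?thesis using assms by (simp add: pat_row_def)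
qed

lemma patterns_le_iff:
  assumes "m \<in> patterns n" "k \<le> n" "i \<in> {1..k}" "j \<in> {1..k}"
  shows "m (k, i) < m (k, j) \<longleftrightarrow> i < j"
  using patterns_strict[OF assms(1,2)] assms(3,4)
  by (metis atLeastAtMost_iff less_asym' linorder_neqE_nat order_less_irrefl)

lemma patterns_inj: "m \<in> patterns n \<Longrightarrow> k \<le> n \<Longrightarrow> inj_on (\<lambda>i. m (k, i)) {1..k}"
  by (rule inj_onI) (metis linorder_neqE_nat order_less_irrefl patterns_le_iff)

lemma patterns_interlace:
  assumes "m \<in> patterns n" "1 \<le> i" "i \<le> k" "k < n"
  shows "m (Suc k, i) \<le> m (k, i)" "m (k, i) \<le> m (Suc k, Suc i)"
proof -
  have "interlaces (k + 1) (pat_row k m) (pat_row (k + 1) m)" using assms by (auto simp: patterns_def)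
  then show "m (Suc k, i) \<le> m (k, i)" "m (k, i) \<le> m (Suc k, Suc i)"
    using assms by (auto simp: interlaces_def pat_row_def)
qed

lemma patterns_le_top:
  assumes "m \<in> patterns n" "1 \<le> i" "i \<le> k" "k \<le> n"
  shows "m (k, i) \<le> m (n, n)" "m (n, 1) \<le> m (k, i)"
proof -
  have "\<forall>i. 1 \<le> i \<and> i \<le> n - d \<longrightarrow> m (n, 1) \<le> m (n - d, i) \<and> m (n - d, i) \<le> m (n, n)" if "d < n" for d
    using that
  proof (induction d)
    case 0
    have "m (n, a) \<le> m (n, b)" if "1 \<le> a" "a \<le> b" "b \<le> n" for a b
      using patterns_strict[OF assms(1), of n a b] that by (cases "a = b") auto
    then show ?case by simp
  next
    case (Suc d)
    have e: "n - d = Suc (n - Suc d)" using Suc by simp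
    show ?case
    proof safe
      fix i assume i: "1 \<le> i" "i \<le> n - Suc d"
      have "m (n, 1) \<le> m (n - d, i)" using Suc i by auto
      with patterns_interlace(1)[OF assms(1) i] show "m (n, 1) \<le> m (n - Suc d, i)" using Suc(2) e by simp
      have "m (n - d, Suc i) \<le> m (n, n)" using Suc i by auto
      with patterns_interlace(2)[OF assms(1) i] show "m (n - Suc d, i) \<le> m (n, n)" using Suc(2) e by simp
    qed
  qed
  from this[of "n - k"] show "m (k, i) \<le> m (n, n)" "m (n, 1) \<le> m (k, i)" using assms by auto
qed

lemma nonneg_patterns_nonneg:
  assumes "m \<in> nonneg_patterns n" "1 \<le> i" "i \<le> k" "k \<le> n"
  shows "0 \<le> m (k, i)"
proof -
  have "m \<in> patterns n" "0 \<le> m (n, 1)"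
    using assms by (auto simp: nonneg_patterns_def nonneg_signatures_def pat_row_def)
  then show ?thesis using patterns_le_top(2)[of m n i k] assms by auto
qed

lemma verts_pattern:
  assumes "\<omega> \<in> path_collections n" "pattern_of_paths n \<omega> = m" "k \<le> n"
  shows "verts \<omega> k = (\<lambda>i. m (k, i)) ` {1..k}"
proof -
  let ?L = "sorted_list_of_set (verts \<omega> k)"
  have len: "length ?L = k" and set: "set ?L = verts \<omega> k"
    using card_verts[OF assms(1,3)] finite_verts[OF assms(1), of k] by auto
  have "m (k, i) = ?L ! (i - 1)" if "i \<in> {1..k}" for i
    using that assms(3) len
    by (auto simp: assms(2)[symmetric] pattern_of_paths_def tri_def crossing_def rev_nth verts_def[symmetric])
  then have "(\<lambda>i. m (k, i)) ` {1..k} = (\<lambda>i. ?L ! (i - 1)) ` {1..k}" by auto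
  also have "\<dots> = (\<lambda>i. ?L ! i) ` {..<k}"
  proof -
    have "(\<lambda>i. i - 1) ` {1..k} = {..<k}" by (auto simp: image_iff intro!: bexI[of _ "Suc _"])
    then show ?thesis by (metis (no_types, lifting) image_cong image_image)
  qed
  also have "\<dots> = set ?L" using len by (auto simp: set_conv_nth)
  finally show ?thesis using set by simp
qed

text \<open>The six vertex types are the local configurations with as many incoming as outgoing arrows.
  The types with a given arrow switched on are listed in the last three equations.\<close>

lemma ice_rule_counts:
  fixes f :: "'a \<Rightarrow> nat \<times> nat \<times> nat \<times> nat"
  assumes "finite A" and "\<And>v. v \<in> A \<Longrightarrow> \<exists>b l t r. f v = (of_bool b, of_bool l, of_bool t, of_bool r)
      \<and> of_bool b + of_bool l = (of_bool t + of_bool r :: nat)"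
  defines "N \<equiv> \<lambda>t. card {v \<in> A. f v = t}"
  shows "N (0,0,0,0) + N (1,1,1,1) + N (1,0,1,0) + N (0,1,0,1) + N (1,0,0,1) + N (0,1,1,0) = card A" (is ?All)
    "N (1,1,1,1) + N (1,0,1,0) + N (1,0,0,1) = (\<Sum>v\<in>A. fst (f v))" (is ?A)
    "N (1,1,1,1) + N (1,0,1,0) + N (0,1,1,0) = (\<Sum>v\<in>A. fst (snd (snd (f v))))" (is ?B)
    "N (1,1,1,1) + N (0,1,0,1) + N (0,1,1,0) = (\<Sum>v\<in>A. fst (snd (f v)))" (is ?C)
proof -
  have N: "N t = (\<Sum>v\<in>A. of_bool (f v = t))" for t
    unfolding N_def using assms(1) by (simp add: sum_of_bool_eq Int_def)
  have "(\<Sum>v\<in>A. (1::nat)) = (\<Sum>v\<in>A. of_bool (f v = (0,0,0,0)) + of_bool (f v = (1,1,1,1)) + of_bool (f v = (1,0,1,0)) + of_bool (f v = (0,1,0,1)) + of_bool (f v = (1,0,0,1)) + of_bool (f v = (0,1,1,0)))"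
  proof (rule sum.cong[OF refl])
    fix v assume "v \<in> A"
    then obtain b l t r where c: "f v = (of_bool b, of_bool l, of_bool t, of_bool r)"
      and e: "of_bool b + of_bool l = (of_bool t + of_bool r :: nat)" using assms(2) by blast
    show "(1::nat) = of_bool (f v = (0,0,0,0)) + of_bool (f v = (1,1,1,1)) + of_bool (f v = (1,0,1,0)) + of_bool (f v = (0,1,0,1)) + of_bool (f v = (1,0,0,1)) + of_bool (f v = (0,1,1,0))"
      unfolding c using e by (cases b; cases l; cases t; cases r) simp_all
  qed
  then show ?All unfolding N by (simp add: sum.distrib del: sum_of_bool_eq)
  have "(\<Sum>v\<in>A. fst (f v)) = (\<Sum>v\<in>A. of_bool (f v = (1,1,1,1)) + of_bool (f v = (1,0,1,0)) + of_bool (f v = (1,0,0,1)))"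
  proof (rule sum.cong[OF refl])
    fix v assume "v \<in> A"
    then obtain b l t r where c: "f v = (of_bool b, of_bool l, of_bool t, of_bool r)"
      and e: "of_bool b + of_bool l = (of_bool t + of_bool r :: nat)" using assms(2) by blast
    show "fst (f v) = of_bool (f v = (1,1,1,1)) + of_bool (f v = (1,0,1,0)) + of_bool (f v = (1,0,0,1))"
      unfolding c using e by (cases b; cases l; cases t; cases r) simp_all
  qed
  then show ?A unfolding N by (simp add: sum.distrib del: sum_of_bool_eq)
  have "(\<Sum>v\<in>A. fst (snd (snd (f v)))) = (\<Sum>v\<in>A. of_bool (f v = (1,1,1,1)) + of_bool (f v = (1,0,1,0)) + of_bool (f v = (0,1,1,0)))"
  proof (rule sum.cong[OF refl])
    fix v assume "v \<in> A"
    then obtain b l t r where c: "f v = (of_bool b, of_bool l, of_bool t, of_bool r)"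
      and e: "of_bool b + of_bool l = (of_bool t + of_bool r :: nat)" using assms(2) by blast
    show "fst (snd (snd (f v))) = of_bool (f v = (1,1,1,1)) + of_bool (f v = (1,0,1,0)) + of_bool (f v = (0,1,1,0))"
      unfolding c using e by (cases b; cases l; cases t; cases r) simp_all
  qed
  then show ?B unfolding N by (simp add: sum.distrib del: sum_of_bool_eq)
  have "(\<Sum>v\<in>A. fst (snd (f v))) = (\<Sum>v\<in>A. of_bool (f v = (1,1,1,1)) + of_bool (f v = (0,1,0,1)) + of_bool (f v = (0,1,1,0)))"
  proof (rule sum.cong[OF refl])
    fix v assume "v \<in> A"
    then obtain b l t r where c: "f v = (of_bool b, of_bool l, of_bool t, of_bool r)"
      and e: "of_bool b + of_bool l = (of_bool t + of_bool r :: nat)" using assms(2) by blast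
    show "fst (snd (f v)) = of_bool (f v = (1,1,1,1)) + of_bool (f v = (0,1,0,1)) + of_bool (f v = (0,1,1,0))"
      unfolding c using e by (cases b; cases l; cases t; cases r) simp_all
  qed
  then show ?C unfolding N by (simp add: sum.distrib del: sum_of_bool_eq)
qed

declare sum_of_bool_eq [simp del]

text \<open>A configuration of paths together with the pattern that records it.\<close>

locale pattern_paths =
  fixes n \<omega> m
  assumes pos: "1 \<le> n" and coll: "\<omega> \<in> path_collections n" and pat: "pattern_of_paths n \<omega> = m"
    and nonneg: "m \<in> nonneg_patterns n"
begin

lemma pats: "m \<in> patterns n" using nonneg by (simp add: nonneg_patterns_def)

lemma verts: "k \<le> n \<Longrightarrow> verts \<omega> k = (\<lambda>i. m (k, i)) ` {1..k}"
  using verts_pattern[OF coll pat] .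

lemma card_below: assumes "k \<le> n"
  shows "card {z \<in> verts \<omega> k. z < x} = (\<Sum>i=1..k. of_bool (m (k, i) < x))"
proof -
  have "{z \<in> verts \<omega> k. z < x} = (\<lambda>i. m (k, i)) ` {i \<in> {1..k}. m (k, i) < x}"
    using verts[OF assms] by auto
  moreover have "card \<dots> = card {i \<in> {1..k}. m (k, i) < x}"
    by (rule card_image) (rule inj_on_subset[OF patterns_inj[OF pats assms]], auto)
  ultimately show ?thesis by (simp add: sum_of_bool_eq Int_def)
qed

lemma below_entry: assumes "k \<le> n" "i \<in> {1..k}"
  shows "(\<Sum>j=1..k. of_bool (m (k, j) < m (k, i))) = i - 1"
proof -
  have "(\<Sum>j=1..k. of_bool (m (k, j) < m (k, i)) :: nat) = (\<Sum>j=1..k. of_bool (j < i))"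
    using patterns_le_iff[OF pats assms(1) _ assms(2)] by (intro sum.cong) auto
  also have "\<dots> = card ({1..k} \<inter> {j. j < i})" by (subst sum_of_bool_eq) auto
  also have "{1..k} \<inter> {j. j < i} = {1..<i}" using assms by auto
  finally show ?thesis by simp
qed

lemma hor: assumes "k \<in> {1..n}" "0 \<le> x"
  shows "of_bool (hor_in \<omega> k x) + (\<Sum>i=1..k. of_bool (m (k, i) < x))
     = Suc (\<Sum>i=1..k-1. of_bool (m (k - 1, i) < x))"
proof -
  have "k \<le> n" "k - 1 \<le> n" using assms by auto
  from hor_in_count[OF coll assms, unfolded card_below[OF this(1)] card_below[OF this(2)]]
  show ?thesis by simp
qed

text \<open>At a vertex crossed vertically from below and upwards, the indices of the two crossings differ
  by one exactly when no horizontal arrow enters.\<close>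

lemma hor_vertical: assumes "k < n" "i \<in> {1..k}" "j \<in> {1..Suc k}" "m (k, i) = m (Suc k, j)"
  shows "of_bool (hor_in \<omega> (Suc k) (m (k, i))) + j = Suc i"
proof -
  have 0: "0 \<le> m (k, i)" using nonneg_patterns_nonneg[OF nonneg] assms by auto
  have "(\<Sum>i'=1..Suc k. of_bool (m (Suc k, i') < m (k, i)) :: nat) = j - 1"
    using below_entry[of "Suc k" j] assms by simp
  moreover have "(\<Sum>i'=1..k. of_bool (m (k, i') < m (k, i)) :: nat) = i - 1"
    using below_entry[of k i] assms by simp
  moreover have "Suc k - 1 = k" by simp
  ultimately show ?thesis using hor[OF _ 0, of "Suc k"] assms by auto
qed

lemma config: assumes "1 \<le> k"
  shows "local_config \<omega> (x, k) = (of_bool (x \<in> verts \<omega> (k - 1)), of_bool (hor_in \<omega> k x),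
     of_bool (x \<in> verts \<omega> k), of_bool (hor_in \<omega> k (x + 1)))"
  using assms by (simp add: local_config_def verts_def hor_in_def)

lemma verts_range: "k \<le> n \<Longrightarrow> x \<in> verts \<omega> k \<Longrightarrow> x \<in> {0..m (n, n)} \<and> 1 \<le> k"
  using patterns_le_top(1)[OF pats] nonneg_patterns_nonneg[OF nonneg] by (auto simp: verts)

abbreviation "\<Lambda> \<equiv> {0..m (n, n)} \<times> {1..n}"

lemma config_outside:
  assumes "v \<in> lattice n - \<Lambda>" shows "local_config \<omega> v = (0, 0, 0, 0)"
proof -
  obtain x k where v: "v = (x, k)" by force
  have xk: "m (n, n) < x" "1 \<le> k" "k \<le> n" "0 \<le> x" using assms by (auto simp: v lattice_def)
  have nh: "\<not> hor_in \<omega> k z" if "m (n, n) < z" "0 \<le> z" for z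
  proof -
    have "of_bool (m (k', i) < z) = (1::nat)" if "k' \<le> n" "i \<in> {1..k'}" for k' i
      using patterns_le_top(1)[OF pats, of i k'] that \<open>m (n, n) < z\<close> by auto
    then have "(\<Sum>i=1..k'. of_bool (m (k', i) < z)) = (k' :: nat)" if "k' \<le> n" for k'
      using that by simp
    from this[of k] this[of "k - 1"] hor[of k z] that xk show ?thesis by auto
  qed
  have "x \<notin> verts \<omega> k" "x \<notin> verts \<omega> (k - 1)"
    using verts_range[of k x] verts_range[of "k - 1" x] xk by fastforce+
  then show ?thesis using nh xk unfolding v config[OF xk(2)] by auto
qed

lemma flow: assumes "v \<in> \<Lambda>"
  shows "of_bool (fst v \<in> verts \<omega> (snd v - 1)) + of_bool (hor_in \<omega> (snd v) (fst v))
       = (of_bool (fst v \<in> verts \<omega> (snd v)) + of_bool (hor_in \<omega> (snd v) (fst v + 1)) :: nat)"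
proof -
  have "snd v \<in> {1..n}" "0 \<le> fst v" using assms by auto
  then show ?thesis by (rule collection_step[OF coll])
qed

abbreviation "N \<equiv> config_count \<Lambda> \<omega>"

lemma count_ice: 
  "N (0,0,0,0) + N (1,1,1,1) + N (1,0,1,0) + N (0,1,0,1) + N (1,0,0,1) + N (0,1,1,0) = card \<Lambda>"
  "N (1,1,1,1) + N (1,0,1,0) + N (1,0,0,1) = (\<Sum>v\<in>\<Lambda>. fst (local_config \<omega> v))"
  "N (1,1,1,1) + N (1,0,1,0) + N (0,1,1,0) = (\<Sum>v\<in>\<Lambda>. fst (snd (snd (local_config \<omega> v))))"
  "N (1,1,1,1) + N (0,1,0,1) + N (0,1,1,0) = (\<Sum>v\<in>\<Lambda>. fst (snd (local_config \<omega> v)))"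
proof -
  have 1: "\<exists>b l t r. local_config \<omega> v = (of_bool b, of_bool l, of_bool t, of_bool r)
      \<and> of_bool b + of_bool l = (of_bool t + of_bool r :: nat)" if "v \<in> \<Lambda>" for v
    using config[of "snd v" "fst v"] flow[OF that] that by (metis atLeastAtMost_iff mem_Times_iff prod.collapse)
  have 2: "finite \<Lambda>" by simp
  note c = ice_rule_counts[of "\<Lambda>" "local_config \<omega>", OF 2 1, folded config_count_def]
  show "N (0,0,0,0) + N (1,1,1,1) + N (1,0,1,0) + N (0,1,0,1) + N (1,0,0,1) + N (0,1,1,0) = card \<Lambda>"
    by (rule c(1))
  show "N (1,1,1,1) + N (1,0,1,0) + N (1,0,0,1) = (\<Sum>v\<in>\<Lambda>. fst (local_config \<omega> v))"
    by (rule c(2))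
  show "N (1,1,1,1) + N (1,0,1,0) + N (0,1,1,0) = (\<Sum>v\<in>\<Lambda>. fst (snd (snd (local_config \<omega> v))))"
    by (rule c(3))
  show "N (1,1,1,1) + N (0,1,0,1) + N (0,1,1,0) = (\<Sum>v\<in>\<Lambda>. fst (snd (local_config \<omega> v)))"
    by (rule c(4))
qed

lemma sum_rows: "(\<Sum>v\<in>\<Lambda>. f v) = (\<Sum>k=1..n. \<Sum>x\<in>{0..m (n, n)}. f (x, k))"
proof -
  have "(\<Sum>v\<in>\<Lambda>. f v) = (\<Sum>x\<in>{0..m (n, n)}. \<Sum>k=1..n. f (x, k))"
    by (simp add: sum.cartesian_product)
  also have "\<dots> = (\<Sum>k=1..n. \<Sum>x\<in>{0..m (n, n)}. f (x, k))" by (rule sum.swap)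
  finally show ?thesis .
qed

lemma sum_config:
  assumes "\<And>x k. 1 \<le> k \<Longrightarrow> f (x, k) = g x k"
  shows "(\<Sum>v\<in>\<Lambda>. f v) = (\<Sum>k=1..n. \<Sum>x\<in>{0..m (n, n)}. g x k)"
  unfolding sum_rows by (intro sum.cong refl) (simp add: assms)

lemma total_verts:
  "(\<Sum>v\<in>\<Lambda>. fst (local_config \<omega> v)) = (\<Sum>k=1..n. k - 1)" (is ?A)
  "(\<Sum>v\<in>\<Lambda>. fst (snd (snd (local_config \<omega> v)))) = (\<Sum>k=1..n. k)" (is ?B)
proof -
  have r: "(\<Sum>x\<in>{0..m (n, n)}. of_bool (x \<in> verts \<omega> k) :: nat) = k" if "k \<le> n" for k
  proof -
    have "{0..m (n, n)} \<inter> verts \<omega> k = verts \<omega> k" using verts_range[OF that] by auto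
    then show ?thesis using card_verts[OF coll that] by (simp add: sum_of_bool_eq)
  qed
  show ?A by (subst sum_config[where g="\<lambda>x k. of_bool (x \<in> verts \<omega> (k - 1))"])
      (auto simp: config r simp del: sum_of_bool_eq intro!: sum.cong)
  show ?B by (subst sum_config[where g="\<lambda>x k. of_bool (x \<in> verts \<omega> k)"])
      (auto simp: config r simp del: sum_of_bool_eq intro!: sum.cong)
qed

lemma telescope: "(\<Sum>k=1..j. 1 + A k - A (k - 1)) = int j + A j - (A 0 :: int)"
  by (induction j) auto

text \<open>Summation by parts turns the number of horizontal arrows of a row into the increase of the row
  sum of the pattern plus one for the starting arrow; over all rows this telescopes to a function of
  the top row.\<close>

lemma total_hor:
  "(\<Sum>v\<in>\<Lambda>. fst (snd (local_config \<omega> v))) = nat (int n + (\<Sum>i=1..n. m (n, i)))"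
proof -
  define X where "X = m (n, n)"
  have X: "0 \<le> X" unfolding X_def using nonneg_patterns_nonneg[OF nonneg, of n n] pos by simp
  have ind: "(\<Sum>x\<in>{0..X}. of_bool (m (k, i) < x) :: int) = X - m (k, i)" if "k \<le> n" "i \<in> {1..k}" for k i
  proof -
    have "{0..X} \<inter> {x. m (k, i) < x} = {m (k, i)<..X}" 
      using nonneg_patterns_nonneg[OF nonneg, of i k] that by auto
    moreover have "m (k, i) \<le> X" using patterns_le_top(1)[OF pats, of i k] that by (simp add: X_def)
    ultimately show ?thesis by (simp add: sum_of_bool_eq)
  qed
  have inds: "(\<Sum>x\<in>{0..X}. \<Sum>i=1..k. of_bool (m (k, i) < x) :: int) = int k * X - (\<Sum>i=1..k. m (k, i))" if "k \<le> n" for k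
  proof -
    have "(\<Sum>x\<in>{0..X}. \<Sum>i=1..k. of_bool (m (k, i) < x) :: int) = (\<Sum>i=1..k. \<Sum>x\<in>{0..X}. of_bool (m (k, i) < x))"
      by (rule sum.swap)
    also have "\<dots> = (\<Sum>i=1..k. X - m (k, i))" by (rule sum.cong[OF refl]) (rule ind[OF that])
    finally show ?thesis by (simp add: sum_subtractf)
  qed
  have row: "(\<Sum>x\<in>{0..X}. of_bool (hor_in \<omega> k x) :: int)
      = 1 + (\<Sum>i=1..k. m (k, i)) - (\<Sum>i=1..k-1. m (k - 1, i))" if "k \<in> {1..n}" for k
  proof -
    have "(\<Sum>x\<in>{0..X}. of_bool (hor_in \<omega> k x) :: int)
       = (\<Sum>x\<in>{0..X}. 1 + (\<Sum>i=1..k-1. of_bool (m (k - 1, i) < x)) - (\<Sum>i=1..k. of_bool (m (k, i) < x)))"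
    proof (rule sum.cong[OF refl])
      fix x assume "x \<in> {0..X}"
      then have "int (of_bool (hor_in \<omega> k x) + (\<Sum>i=1..k. of_bool (m (k, i) < x)))
         = int (Suc (\<Sum>i=1..k-1. of_bool (m (k - 1, i) < x)))" using hor[OF that, of x] by auto
      then show "of_bool (hor_in \<omega> k x) = 1 + (\<Sum>i=1..k-1. of_bool (m (k - 1, i) < x)) - (\<Sum>i=1..k. of_bool (m (k, i) < x) :: int)"
        by (simp add: of_nat_sum)
    qed
    also have "\<dots> = (X + 1) + (int (k - 1) * X - (\<Sum>i=1..k-1. m (k - 1, i))) - (int k * X - (\<Sum>i=1..k. m (k, i)))"
    proof -
      have "k \<le> n" "k - 1 \<le> n" using that by auto
      then show ?thesis using X by (simp only: sum.distrib sum_subtractf inds) simp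
    qed
    also have "\<dots> = 1 + (\<Sum>i=1..k. m (k, i)) - (\<Sum>i=1..k-1. m (k - 1, i))"
      using that by (simp add: algebra_simps of_nat_diff)
    finally show ?thesis .
  qed
  have "int (\<Sum>v\<in>\<Lambda>. fst (snd (local_config \<omega> v))) = (\<Sum>k=1..n. \<Sum>x\<in>{0..X}. of_bool (hor_in \<omega> k x))"
    unfolding X_def by (subst sum_config[where g="\<lambda>x k. of_bool (hor_in \<omega> k x)"])
      (simp_all add: config of_nat_sum del: sum_of_bool_eq)
  also have "\<dots> = (\<Sum>k=1..n. 1 + (\<Sum>i=1..k. m (k, i)) - (\<Sum>i=1..k-1. m (k - 1, i)))"
    by (rule sum.cong) (auto simp: row)
  also have "\<dots> = int n + (\<Sum>i=1..n. m (n, i)) - (\<Sum>i=1..0. m (0, i))"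
    by (rule telescope)
  finally have "int (\<Sum>v\<in>\<Lambda>. fst (snd (local_config \<omega> v))) = int n + (\<Sum>i=1..n. m (n, i))"
    by (simp del: of_nat_sum)
  from arg_cong[OF this, of nat] show ?thesis by (simp only: nat_int)
qed

end



context pattern_paths begin

text \<open>Vertices that are crossed vertically from below and upwards are the coincidences of an entry
  with its left upper neighbour (if a horizontal path touches there) or with its right upper
  neighbour (if not).\<close>

lemma count_coincidences:
  "N (1,1,1,1) = card {q \<in> tri (n - 1). m q = m (lpar q)}" (is ?A)
  "N (1,0,1,0) = card {q \<in> tri (n - 1). m q = m (rpar q)}" (is ?B)
proof -
  let ?f = "\<lambda>q. (m q, Suc (fst q))"
  have inj: "inj_on ?f (tri (n - 1))"
  proof (rule inj_onI)
    fix p q assume pq: "p \<in> tri (n - 1)" "q \<in> tri (n - 1)" "(m p, Suc (fst p)) = (m q, Suc (fst q))"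
    then have "fst p = fst q" "m (fst p, snd p) = m (fst p, snd q)" "fst p \<le> n"
      "snd p \<in> {1..fst p}" "snd q \<in> {1..fst p}"
      by (auto simp: tri_def)
    with inj_onD[OF patterns_inj[OF pats]] have "snd p = snd q" by blast
    with \<open>fst p = fst q\<close> show "p = q" by (simp add: prod_eq_iff)
  qed
  have "{v \<in> \<Lambda>. local_config \<omega> v = (1, of_bool h, 1, of_bool h)}
     = ?f ` {q \<in> tri (n - 1). m q = m (if h then lpar q else rpar q)}" (is "?L = ?R") for h
  proof (intro set_eqI iffI)
    fix v assume v: "v \<in> ?L"
    obtain x k where vk: "v = (x, k)" by force
    have "1 \<le> k" using v vk by auto
    then obtain k' where "k = Suc k'" by (cases k) auto
    with v vk have vx: "v = (x, Suc k')" "x \<in> {0..m(n,n)}" "k' < n" by auto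
    have lc: "local_config \<omega> (x, Suc k') = (1, of_bool h, 1, of_bool h)" using v vx by auto
    have "1 \<le> Suc k'" by simp
    note cf = config[OF this, of x, unfolded diff_Suc_1]
    have "(of_bool (x \<in> verts \<omega> k') :: nat) = of_bool True" "(of_bool (hor_in \<omega> (Suc k') x) :: nat) = of_bool h"
      "(of_bool (x \<in> verts \<omega> (Suc k')) :: nat) = of_bool True"
      using lc[unfolded cf] unfolding prod.inject of_bool_eq by blast+
    then have c: "x \<in> verts \<omega> k'" "x \<in> verts \<omega> (Suc k')" "hor_in \<omega> (Suc k') x = h"
      by (simp_all only: of_bool_eq_iff simp_thms)
    have "k' \<le> n" "Suc k' \<le> n" using vx(3) by auto
    from c(1) obtain i where i: "i \<in> {1..k'}" "x = m (k', i)" unfolding verts[OF \<open>k' \<le> n\<close>] by blast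
    from c(2) obtain j where j: "j \<in> {1..Suc k'}" "x = m (Suc k', j)" unfolding verts[OF \<open>Suc k' \<le> n\<close>] by blast
    note ij = i j
    have "m (k', i) = m (Suc k', j)" using ij by simp
    from hor_vertical[OF vx(3) ij(1,3) this] have "of_bool h + j = Suc i" using c(3) ij(2) by simp
    then have jh: "j = (if h then i else Suc i)" by (cases h) simp_all
    have "(k', i) \<in> tri (n - 1)" using ij vx by (auto simp: tri_def)
    moreover have "v = ?f (k', i)" using vx(1) ij(2) by simp
    moreover have "m (k', i) = m (if h then lpar (k', i) else rpar (k', i))"
      using \<open>m (k', i) = m (Suc k', j)\<close> unfolding jh by (cases h) (simp_all add: lpar_def rpar_def)
    ultimately show "v \<in> ?R" by blast
  next
    fix v assume "v \<in> ?R"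
    then obtain k i where q: "(k, i) \<in> tri (n - 1)" "m (k, i) = m (if h then lpar (k, i) else rpar (k, i))"
      "v = (m (k, i), Suc k)" by auto
    have ki: "i \<in> {1..k}" "k < n" using q by (auto simp: tri_def)
    \<comment> \<open>The flag \<open>h\<close> says whether a horizontal arrow enters: it decides between the two upper neighbours.\<close>
    define j where "j = (if h then i else Suc i)"
    have j: "j \<in> {1..Suc k}" "m (k, i) = m (Suc k, j)" using q(2) ki unfolding j_def by (cases h; simp add: lpar_def rpar_def)+
    have x: "m (k, i) \<in> verts \<omega> k" "m (k, i) \<in> verts \<omega> (Suc k)" 
      unfolding verts[OF less_imp_le[OF ki(2)]] verts[OF Suc_leI[OF ki(2)]] using ki(1) j by (blast, metis imageI)
    have h: "hor_in \<omega> (Suc k) (m (k, i)) = h"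
      using hor_vertical[OF ki(2,1) j] by (cases h; cases "hor_in \<omega> (Suc k) (m (k, i))") (simp_all add: j_def)
    have vL: "v \<in> \<Lambda>" using verts_range[OF _ x(1)] ki q(3) by simp
    from flow[OF this] x h have "hor_in \<omega> (Suc k) (m (k, i) + 1) = h"
      by (cases h; cases "hor_in \<omega> (Suc k) (m (k, i) + 1)") (simp_all add: q(3))
    then have "local_config \<omega> v = (1, of_bool h, 1, of_bool h)"
      using x h config[of "Suc k" "m (k, i)"] by (simp add: q(3))
    with vL show "v \<in> ?L" by blast
  qed
  note eq = this
  have "card (?f ` {q \<in> tri (n - 1). P q}) = card {q \<in> tri (n - 1). P q}" for P
    by (rule card_image) (rule inj_on_subset[OF inj], auto)
  note card = this
  show ?A unfolding config_count_def using eq[of True] card[of "\<lambda>q. m q = m (lpar q)"]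
    by (simp only: of_bool_eq if_True)
  show ?B unfolding config_count_def using eq[of False] card[of "\<lambda>q. m q = m (rpar q)"]
    by (simp only: of_bool_eq if_False)
qed

end



definition site_weight :: "real \<Rightarrow> real \<Rightarrow> (nat \<times> nat \<Rightarrow> int) \<Rightarrow> nat \<times> nat \<Rightarrow> real" where
  "site_weight r s m q = (if m q = m (lpar q) then r else if m q = m (rpar q) then s else 1)"

definition left_wt :: "(nat \<Rightarrow> real) \<Rightarrow> real" where "left_wt w = w 1 * w 2 / (w 5 * w 6)"
definition right_wt :: "(nat \<Rightarrow> real) \<Rightarrow> real" where "right_wt w = w 3 * w 4 / (w 5 * w 6)"

definition top_const :: "nat \<Rightarrow> (nat \<Rightarrow> real) \<Rightarrow> (nat \<Rightarrow> int) \<Rightarrow> real" where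
  "top_const n w l = (let S = card ({0..l n} \<times> {1..n}); B = (\<Sum>k=1..n. k - 1); T = (\<Sum>k=1..n. k);
       H = nat (int n + (\<Sum>i=1..n. l i))
     in w 1 ^ S / w 1 ^ (H + B) * (w 4 ^ H / w 4 ^ T) * w 5 ^ B * w 6 ^ T)"

text \<open>The four totals are determined by the top row. They leave two free counts, those of the types
  \<open>(1,1;1,1)\<close> and \<open>(1,0;1,0)\<close>, so up to a constant the weight is a product of powers of two ratios
  of the \<open>w\<close>.\<close>

lemma weight_from_counts:
  fixes w :: "nat \<Rightarrow> real"
  assumes w: "\<And>t. t \<in> {1..6} \<Longrightarrow> w t > 0"
    and S: "N1 + N2 + N3 + N4 + N5 + N6 = S" and B: "N2 + N3 + N5 = B"
    and T: "N2 + N3 + N6 = T" and H: "N2 + N4 + N6 = (H::nat)"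
  shows "w 1 ^ N1 * w 2 ^ N2 * w 3 ^ N3 * w 4 ^ N4 * w 5 ^ N5 * w 6 ^ N6
    = (w 1 ^ S / w 1 ^ (H + B) * (w 4 ^ H / w 4 ^ T) * w 5 ^ B * w 6 ^ T) * (left_wt w ^ N2 * right_wt w ^ N3)"
proof -
  have nz: "w 1 \<noteq> 0" "w 2 \<noteq> 0" "w 3 \<noteq> 0" "w 4 \<noteq> 0" "w 5 \<noteq> 0" "w 6 \<noteq> 0"
    using w[of 1] w[of 2] w[of 3] w[of 4] w[of 5] w[of 6] by auto
  \<comment> \<open>The relations solved for the two remaining counts, written without subtraction.\<close>
  have "N1 + (H + B) = S + N2" "N4 + T = H + N3" using assms by linarith+
  then have e: "w 1 ^ N1 * w 1 ^ (H + B) = w 1 ^ S * w 1 ^ N2" "w 4 ^ N4 * w 4 ^ T = w 4 ^ H * w 4 ^ N3"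
    by (simp_all only: power_add[symmetric])
  have 1: "w 1 ^ N1 = w 1 ^ S / w 1 ^ (H + B) * w 1 ^ N2" "w 4 ^ N4 = w 4 ^ H / w 4 ^ T * w 4 ^ N3"
    using e nz by (simp_all add: divide_simps)
  have 5: "w 5 ^ B = w 5 ^ N2 * w 5 ^ N3 * w 5 ^ N5" "w 6 ^ T = w 6 ^ N2 * w 6 ^ N3 * w 6 ^ N6"
    unfolding B[symmetric] T[symmetric] by (simp_all only: power_add)
  show ?thesis
    unfolding 1 5 left_wt_def right_wt_def power_divide power_mult_distrib
    using nz by (simp add: divide_simps)
qed

lemma prod_if_const: "finite A \<Longrightarrow> (\<Prod>q\<in>A. if P q then c else 1) = (c :: real) ^ card {q \<in> A. P q}"
  by (simp add: prod.If_cases Int_def)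

lemma finite_tri: "finite (tri n)"
  by (rule finite_subset[of _ "{..n} \<times> {..n}"]) (auto simp: tri_def)

lemma patterns_parents_less:
  assumes "m \<in> patterns n" "q \<in> tri (n - 1)" shows "m (lpar q) < m (rpar q)"
  using patterns_strict[OF assms(1), of "Suc (fst q)" "snd q" "Suc (snd q)"] assms(2)
  by (auto simp: lpar_def rpar_def tri_def)

lemma prod_site_weight:
  assumes "m \<in> patterns n"
  shows "(\<Prod>q\<in>tri (n - 1). site_weight r s m q)
    = r ^ card {q \<in> tri (n - 1). m q = m (lpar q)} * s ^ card {q \<in> tri (n - 1). m q = m (rpar q)}"
proof -
  have "(\<Prod>q\<in>tri (n - 1). site_weight r s m q)
     = (\<Prod>q\<in>tri (n - 1). (if m q = m (lpar q) then r else 1) * (if m q = m (rpar q) then s else 1))"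
  proof (rule prod.cong[OF refl])
    fix q assume "q \<in> tri (n - 1)"
    then have "m (lpar q) \<noteq> m (rpar q)" using patterns_parents_less[OF assms, of q] by simp
    then show "site_weight r s m q = (if m q = m (lpar q) then r else 1) * (if m q = m (rpar q) then s else 1)"
      unfolding site_weight_def by simp
  qed
  then show ?thesis by (simp only: prod.distrib prod_if_const[OF finite_tri])
qed

text \<open>All vertices outside the rectangle are empty, so this is the weight of the whole
  configuration. Apart from a factor that the top row determines, it sees only the entries of the
  pattern that coincide with one of their two upper neighbours.\<close>

lemma (in pattern_paths) six_vertex_weight_pattern:
  assumes "\<And>t. t \<in> {1..6} \<Longrightarrow> w t > 0"
  shows "six_vertex_weight w \<Lambda> \<omega>
    = top_const n w (pat_row n m) * (\<Prod>q\<in>tri (n - 1). site_weight (left_wt w) (right_wt w) m q)"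
proof -
  have top: "top_const n w (pat_row n m) = (let S = card \<Lambda>; B = (\<Sum>k=1..n. k - 1); T = (\<Sum>k=1..n. k);
       H = nat (int n + (\<Sum>i=1..n. m (n, i)))
     in w 1 ^ S / w 1 ^ (H + B) * (w 4 ^ H / w 4 ^ T) * w 5 ^ B * w 6 ^ T)"
    using pos by (simp add: top_const_def pat_row_def)
  show ?thesis
    unfolding six_vertex_weight_def top Let_def prod_site_weight[OF pats] count_coincidences[symmetric]
    by (rule weight_from_counts[OF assms]) 
      (use count_ice[unfolded total_verts total_hor] in \<open>simp_all only:\<close>)
qed

text \<open>Of the ways to resolve touching paths, the following construction uses the one where paths
  never cross: in row \<open>k\<close> the path that started in row \<open>j\<close> runs from the \<open>(k - j)\<close>-th crossing of
  level \<open>k - 1\<close> (from abscissa \<open>-1\<close> if it starts there) to the \<open>(k - j + 1)\<close>-st crossing of level \<open>k\<close>.\<close>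

definition run_from :: "(nat \<times> nat \<Rightarrow> int) \<Rightarrow> nat \<Rightarrow> nat \<Rightarrow> int" where
  "run_from m j k = (if k = j then -1 else m (k - 1, k - j))"

definition run_to :: "(nat \<times> nat \<Rightarrow> int) \<Rightarrow> nat \<Rightarrow> nat \<Rightarrow> int" where
  "run_to m j k = m (k, k - j + 1)"

definition row_run :: "(nat \<times> nat \<Rightarrow> int) \<Rightarrow> nat \<Rightarrow> nat \<Rightarrow> vertex list" where
  "row_run m j k = map (\<lambda>x. (x, k)) [run_from m j k..run_to m j k]"

definition partial_path :: "(nat \<times> nat \<Rightarrow> int) \<Rightarrow> nat \<Rightarrow> nat \<Rightarrow> vertex list" where
  "partial_path m j k = concat (map (row_run m j) [j..<Suc k])"

lemma run_le:
  assumes m: "m \<in> nonneg_patterns n" and k: "1 \<le> j" "j \<le> k" "k \<le> n"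
  shows "run_from m j k \<le> run_to m j k" "0 \<le> run_to m j k" "k \<noteq> j \<Longrightarrow> 0 \<le> run_from m j k"
proof -
  have mp: "m \<in> patterns n" using m by (simp add: nonneg_patterns_def)
  show 0: "0 \<le> run_to m j k" unfolding run_to_def using nonneg_patterns_nonneg[OF m, of "k - j + 1" k] k by auto
  show "k \<noteq> j \<Longrightarrow> 0 \<le> run_from m j k" unfolding run_from_def
    using nonneg_patterns_nonneg[OF m, of "k - j" "k - 1"] k by auto
  show "run_from m j k \<le> run_to m j k"
  proof (cases "k = j")
    case False
    then show ?thesis using patterns_interlace(2)[OF mp, of "k - j" "k - 1"] k
      by (simp add: run_from_def run_to_def)
  qed (use 0 in \<open>simp add: run_from_def\<close>)
qed

lemma upto_ends: "a \<le> b \<Longrightarrow> [a..b] \<noteq> [] \<and> hd [a..b] = a \<and> last [a..b] = b"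
  by (intro conjI) (simp, subst upto_rec1, simp_all, subst upto_rec2, simp_all)

lemma run_arrows:
  "a \<le> b \<Longrightarrow> successively up_right_step (map (\<lambda>x. (x, k)) [a..b]) \<and>
     path_arrows (map (\<lambda>x. (x, k)) [a..b]) = {((x, k), (x + 1, k)) | x. a \<le> x \<and> x < b}"
proof (induction b rule: int_ge_induct)
  case base
  then show ?case by simp
next
  case (step b)
  have "[a..b + 1] = [a..b] @ [b + 1]" using step(1) by (simp add: upto_rec2)
  moreover have "[a..b] \<noteq> []" "last [a..b] = b" using step(1) by (simp_all add: upto_rec2)
  ultimately show ?case using step
    by (auto simp: successively_append_iff path_arrows_append last_map up_right_step_def)
qed

lemma partial_path_props:
  assumes m: "m \<in> nonneg_patterns n" and j: "1 \<le> j" and k: "j \<le> k" "k \<le> n"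
  shows "partial_path m j k \<noteq> []" "hd (partial_path m j k) = (-1, j)" 
    "last (partial_path m j k) = (run_to m j k, k)" "successively up_right_step (partial_path m j k)"
    "path_arrows (partial_path m j k) = 
       {((x, i), (x + 1, i)) | x i. j \<le> i \<and> i \<le> k \<and> run_from m j i \<le> x \<and> x < run_to m j i} \<union>
       {((run_to m j i, i), (run_to m j i, Suc i)) | i. j \<le> i \<and> i < k}" (is "?A k")
    "set (tl (partial_path m j k)) \<subseteq> lattice n"
    "\<exists>vs. partial_path m j k = (-1, j) # (0, j) # vs"
proof -
  have run: "row_run m j i \<noteq> []" "hd (row_run m j i) = (run_from m j i, i)" "last (row_run m j i) = (run_to m j i, i)"
     "successively up_right_step (row_run m j i)"
     "path_arrows (row_run m j i) = {((x, i), (x + 1, i)) | x. run_from m j i \<le> x \<and> x < run_to m j i}"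
     "set (row_run m j i) \<subseteq> insert (-1, j) (lattice n)" "i \<noteq> j \<Longrightarrow> set (row_run m j i) \<subseteq> lattice n" if i: "j \<le> i" "i \<le> n" for i
  proof -
    note le = run_le[OF m j i]
    show "row_run m j i \<noteq> []" "hd (row_run m j i) = (run_from m j i, i)" "last (row_run m j i) = (run_to m j i, i)"
      using upto_ends[OF le(1)] by (simp_all add: row_run_def hd_map last_map)
    show "successively up_right_step (row_run m j i)"
     "path_arrows (row_run m j i) = {((x, i), (x + 1, i)) | x. run_from m j i \<le> x \<and> x < run_to m j i}"
      using run_arrows[OF le(1)] by (auto simp: row_run_def)
    show "set (row_run m j i) \<subseteq> insert (-1, j) (lattice n)" "i \<noteq> j \<Longrightarrow> set (row_run m j i) \<subseteq> lattice n"
      using le i j by (auto simp: row_run_def lattice_def run_from_def split: if_splits)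
  qed
  have start: "row_run m j j = (-1, j) # map (\<lambda>x. (x, j)) [0..run_to m j j]"
    unfolding row_run_def run_from_def using run_le(2)[OF m j order_refl] k
    by (simp, subst upto_rec1, simp_all)
  have "partial_path m j k \<noteq> [] \<and> hd (partial_path m j k) = (-1, j) \<and>
    last (partial_path m j k) = (run_to m j k, k) \<and> successively up_right_step (partial_path m j k) \<and>
    ?A k \<and> set (tl (partial_path m j k)) \<subseteq> lattice n \<and> (\<exists>vs. partial_path m j k = (-1, j) # (0, j) # vs)"
    using k
  proof (induction k rule: dec_induct)
    case base
    have p: "partial_path m j j = row_run m j j" by (simp add: partial_path_def)
    have "\<exists>vs. row_run m j j = (-1, j) # (0, j) # vs"
      unfolding start using run_le(2)[OF m j order_refl] base by (subst upto_rec1) simp_all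
    moreover have "j \<le> n" using base by simp
    note r = run[OF order_refl this]
    have "set (tl (row_run m j j)) \<subseteq> lattice n"
      unfolding start using base j by (auto simp: lattice_def)
    ultimately show ?case unfolding p using r by (auto simp: run_from_def)
  next
    case (step k)
    have k: "k \<le> n" "j \<le> Suc k" "Suc k \<le> n" using step by auto
    note IH = step.IH[OF k(1)]
    note r = run[OF k(2,3)]
    have p: "partial_path m j (Suc k) = partial_path m j k @ row_run m j (Suc k)"
      using step(1) by (simp add: partial_path_def)
    have rf: "run_from m j (Suc k) = run_to m j k"
      using step(1) by (simp add: run_from_def run_to_def Suc_diff_le)
    have "up_right_step (last (partial_path m j k)) (hd (row_run m j (Suc k)))"
      using IH r(2) rf by (simp add: up_right_step_def)
    then have "successively up_right_step (partial_path m j (Suc k))"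
      unfolding p using IH r(4) by (simp add: successively_append_iff)
    moreover have "?A (Suc k)"
    proof -
      have e: "path_arrows (partial_path m j (Suc k)) = path_arrows (partial_path m j k) \<union> path_arrows (row_run m j (Suc k))
         \<union> {((run_to m j k, k), (run_to m j k, Suc k))}"
        unfolding p using IH r(1,2) rf by (simp add: path_arrows_append)
      have 1: "{((x, i), (x + 1, i)) | x i. j \<le> i \<and> i \<le> Suc k \<and> run_from m j i \<le> x \<and> x < run_to m j i}
        = {((x, i), (x + 1, i)) | x i. j \<le> i \<and> i \<le> k \<and> run_from m j i \<le> x \<and> x < run_to m j i}
         \<union> {((x, Suc k), (x + 1, Suc k)) | x. run_from m j (Suc k) \<le> x \<and> x < run_to m j (Suc k)}"
        using k(2) by (auto simp: le_Suc_eq)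
      have 2: "{((run_to m j i, i), (run_to m j i, Suc i)) | i. j \<le> i \<and> i < Suc k}
        = {((run_to m j i, i), (run_to m j i, Suc i)) | i. j \<le> i \<and> i < k} \<union> {((run_to m j k, k), (run_to m j k, Suc k))}"
        using step(1) by (auto simp: less_Suc_eq)
      from IH have A: "?A k" by blast
      show ?thesis unfolding e A r(5) 1 2 by (simp only: Un_ac)
    qed
    moreover have "\<exists>vs. partial_path m j (Suc k) = (-1, j) # (0, j) # vs"
      using IH unfolding p by auto
    moreover have "set (tl (partial_path m j (Suc k))) \<subseteq> lattice n"
      using IH r(7) step(1) unfolding p by auto
    ultimately show ?case using IH r(1,3) unfolding p by simp
  qed
  then show "partial_path m j k \<noteq> []" "hd (partial_path m j k) = (-1, j)" 
    "last (partial_path m j k) = (run_to m j k, k)" "successively up_right_step (partial_path m j k)"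
    "?A k" "set (tl (partial_path m j k)) \<subseteq> lattice n"
    "\<exists>vs. partial_path m j k = (-1, j) # (0, j) # vs" by blast+
qed



definition full_path :: "nat \<Rightarrow> (nat \<times> nat \<Rightarrow> int) \<Rightarrow> nat \<Rightarrow> vertex list" where
  "full_path n m j = partial_path m j n @ [(run_to m j n, Suc n)]"

lemma full_path:
  assumes m: "m \<in> nonneg_patterns n" and j: "j \<in> {1..n}"
  shows "lattice_path n j (full_path n m j)"
    "path_arrows (full_path n m j) = 
       {((x, i), (x + 1, i)) | x i. j \<le> i \<and> i \<le> n \<and> run_from m j i \<le> x \<and> x < run_to m j i} \<union>
       {((run_to m j i, i), (run_to m j i, Suc i)) | i. j \<le> i \<and> i \<le> n}" (is ?A)
proof -
  have j': "1 \<le> j" "j \<le> n" using j by auto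
  note pp = partial_path_props[OF m j' order_refl]
  obtain vs where vs: "partial_path m j n = (-1, j) # (0, j) # vs" using pp(7) by blast
  have "successively up_right_step (full_path n m j)"
    unfolding full_path_def using pp by (simp add: successively_append_iff up_right_step_def)
  moreover have "full_path n m j = (-1, j) # ((0, j) # vs) @ [(run_to m j n, Suc n)]"
    unfolding full_path_def vs by simp
  moreover have "set ((0, j) # vs) \<subseteq> lattice n" using pp(6) unfolding vs by simp
  moreover have "last ((0, j) # vs) = (run_to m j n, n)" using pp(3) unfolding vs by simp
  ultimately show "lattice_path n j (full_path n m j)"
    unfolding lattice_path_def by (metis list.distinct(1) list.sel(1))
  have "path_arrows (full_path n m j) = path_arrows (partial_path m j n) \<union> {((run_to m j n, n), (run_to m j n, Suc n))}"
    unfolding full_path_def using pp(1,3) by (simp add: path_arrows_append)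
  moreover have "{((run_to m j i, i), (run_to m j i, Suc i)) | i. j \<le> i \<and> i \<le> n}
    = {((run_to m j i, i), (run_to m j i, Suc i)) | i. j \<le> i \<and> i < n} \<union> {((run_to m j n, n), (run_to m j n, Suc n))}"
    using j'(2) by (auto simp: le_less)
  ultimately show ?A unfolding pp(5) by (simp only: Un_ac)
qed

lemma run_to_inj:
  assumes "m \<in> patterns n" "1 \<le> j" "j \<le> i" "1 \<le> j'" "j' \<le> i" "i \<le> n" "run_to m j i = run_to m j' i"
  shows "j = j'"
proof -
  have "i - j + 1 = i - j' + 1"
    using inj_onD[OF patterns_inj[OF assms(1,6)], of "i - j + 1" "i - j' + 1"] assms
    by (simp add: run_to_def Suc_diff_le)
  then show ?thesis using assms by linarith
qed

lemma run_order:
  assumes "m \<in> patterns n" "1 \<le> j" "j < j'" "j' \<le> i" "i \<le> n"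
  shows "run_to m j' i \<le> run_from m j i"
proof -
  have "run_to m j' i \<le> m (i, i - j)"
  proof (cases "i - j' + 1 = i - j")
    case False
    then have "i - j' + 1 < i - j" using assms by linarith
    then show ?thesis using patterns_strict[OF assms(1), of i "i - j' + 1" "i - j"] assms by (simp add: run_to_def)
  qed (simp add: run_to_def)
  also have "\<dots> \<le> m (i - 1, i - j)" using patterns_interlace(1)[OF assms(1), of "i - j" "i - 1"] assms by simp
  finally show ?thesis using assms by (simp add: run_from_def)
qed

lemma full_path_disjoint:
  assumes m: "m \<in> nonneg_patterns n" and j: "j \<in> {1..n}" "j' \<in> {1..n}" "j < j'"
  shows "path_arrows (full_path n m j) \<inter> path_arrows (full_path n m j') = {}"
proof -
  have mp: "m \<in> patterns n" using m by (simp add: nonneg_patterns_def)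
  have "False" if "e \<in> path_arrows (full_path n m j)" "e \<in> path_arrows (full_path n m j')" for e
  proof -
    have H: False if "j' \<le> i" "i \<le> n" "run_from m j i \<le> x" "x < run_to m j' i" for x i
      using run_order[OF mp, of j j' i] that j by auto
    have V: False if "j' \<le> i" "i \<le> n" "run_to m j i = run_to m j' i" for i
      using run_to_inj[OF mp, of j i j'] that j by auto
    show False using that unfolding full_path(2)[OF m j(1)] full_path(2)[OF m j(2)]
      using H V by auto
  qed
  then show ?thesis by blast
qed

text \<open>Interlacing makes the horizontal runs of different paths disjoint, and strictness of the rows
  separates their vertical arrows.\<close>

lemma paths_of_pattern:
  assumes m: "m \<in> nonneg_patterns n"
  shows "\<exists>\<omega>\<in>path_collections n. pattern_of_paths n \<omega> = m"
proof
  have mp: "m \<in> patterns n" using m by (simp add: nonneg_patterns_def)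
  define \<omega> where "\<omega> = (\<Union>j\<in>{1..n}. path_arrows (full_path n m j))"
  have "disjoint_family_on (\<lambda>j. path_arrows (full_path n m j)) {1..n}"
    unfolding disjoint_family_on_def
    using full_path_disjoint[OF m] by (metis Int_commute linorder_neqE_nat)
  then show "\<omega> \<in> path_collections n"
    unfolding path_collections_def \<omega>_def using full_path(1)[OF m] by blast
  have v: "verts \<omega> k = (\<lambda>i. m (k, i)) ` {1..k}" if k: "k \<le> n" for k
  proof -
    have "verts \<omega> k = {run_to m j k | j. j \<in> {1..n} \<and> j \<le> k}"
      unfolding verts_def \<omega>_def using k by (auto simp: full_path(2)[OF m])
    also have "\<dots> = (\<lambda>i. m (k, i)) ` {1..k}"
    proof (intro set_eqI iffI)
      fix x assume "x \<in> (\<lambda>i. m (k, i)) ` {1..k}"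
      then obtain i where i: "i \<in> {1..k}" "x = m (k, i)" by blast
      then have "x = run_to m (k - i + 1) k" by (simp add: run_to_def)
      then show "x \<in> {run_to m j k | j. j \<in> {1..n} \<and> j \<le> k}" using i k by auto
    next
      fix x assume "x \<in> {run_to m j k | j. j \<in> {1..n} \<and> j \<le> k}"
      then obtain j where j: "1 \<le> j" "j \<le> k" "x = m (k, k - j + 1)" by (auto simp: run_to_def)
      then have "k - j + 1 \<in> {1..k}" by auto
      with j(3) show "x \<in> (\<lambda>i. m (k, i)) ` {1..k}" by blast
    qed
    finally show ?thesis .
  qed
  show "pattern_of_paths n \<omega> = m"
  proof
    fix q :: "nat \<times> nat"
    obtain k i where q: "q = (k, i)" by force
    show "pattern_of_paths n \<omega> q = m q"
    proof (cases "q \<in> tri n")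
      case True
      then have ki: "1 \<le> i" "i \<le> k" "k \<le> n" by (auto simp: q tri_def)
      let ?L = "map (\<lambda>i. m (k, i)) [1..<Suc k]"
      have "sorted_wrt (<) ?L"
        unfolding sorted_wrt_map
      proof (rule sorted_wrt_mono_rel[OF _ sorted_wrt_upt])
        fix a b assume "a \<in> set [1..<Suc k]" "b \<in> set [1..<Suc k]" "a < b"
        then have "1 \<le> a" "b \<le> k" by (simp_all del: upt_Suc)
        from patterns_strict[OF mp ki(3) this(1) \<open>a < b\<close> this(2)] show "m (k, a) < m (k, b)" .
      qed
      then have "sorted ?L" "distinct ?L" unfolding strict_sorted_iff by blast+
      moreover have "set ?L = verts \<omega> k" unfolding v[OF ki(3)] set_map set_upt atLeastLessThanSuc_atLeastAtMost ..
      ultimately have "sorted_list_of_set (verts \<omega> k) = ?L"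
        by (metis sorted_list_of_set.idem_if_sorted_distinct)
      then have "crossing \<omega> k (k - i + 1) = rev ?L ! (k - i)"
        unfolding crossing_def verts_def[symmetric] by simp
      also have "rev ?L ! (k - i) = ?L ! (length ?L - Suc (k - i))"
        using ki by (intro rev_nth) (simp del: upt_Suc)
      also have "length ?L - Suc (k - i) = i - 1" using ki by (simp del: upt_Suc)
      also have "?L ! (i - 1) = m (k, [1..<Suc k] ! (i - 1))" using ki by (intro nth_map) (simp del: upt_Suc)
      also have "[1..<Suc k] ! (i - 1) = i" using ki by (subst nth_upt) auto
      finally have "crossing \<omega> k (k - i + 1) = m (k, i)" .
      moreover have "pattern_of_paths n \<omega> (k, i) = crossing \<omega> k (k - i + 1)"
        using True unfolding q pattern_of_paths_def by simp
      ultimately show ?thesis unfolding q by metis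
    next
      case False
      have "m \<in> tri n \<rightarrow>\<^sub>E UNIV" using mp by (simp add: patterns_def)
      then have "m q = undefined" using False by (rule PiE_arb)
      moreover have "pattern_of_paths n \<omega> q = undefined"
        unfolding pattern_of_paths_def restrict_def using False by (rule if_not_P)
      ultimately show ?thesis by metis
    qed
  qed
qed

lemma site_weight_prod_pos:
  assumes "r > 0" "s > 0" shows "(\<Prod>q\<in>A. site_weight r s m q) > 0"
  using assms by (intro prod_pos) (auto simp: site_weight_def)

text \<open>The Gibbs property is applied to a rectangle that contains every arrow of every configuration
  with the given top row, so that conditioning on the outside is no condition at all.\<close>

theorem six_vertex_gibbs_pmf:
  assumes n: "1 \<le> n" and w: "\<And>t. t \<in> {1..6} \<Longrightarrow> w t > 0"
    and supp: "set_pmf \<rho> \<subseteq> nonneg_patterns n" and gibbs: "six_vertex_gibbs n w \<rho>"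
  obtains c where "c \<ge> 0" "\<And>m. m \<in> nonneg_patterns n \<Longrightarrow> pat_row n m = l \<Longrightarrow>
      pmf \<rho> m = c * (\<Prod>q\<in>tri (n - 1). site_weight (left_wt w) (right_wt w) m q)"
proof -
  let ?W = "\<lambda>m. \<Prod>q\<in>tri (n - 1). site_weight (left_wt w) (right_wt w) m q"
  let ?T = "{m. pat_row n m = l}"
  have Wpos: "?W m > 0" for m
    using w by (intro site_weight_prod_pos) (auto simp: left_wt_def right_wt_def)
  have "\<exists>c. \<forall>m\<in>nonneg_patterns n. pat_row n m = l \<longrightarrow> pmf \<rho> m = c * ?W m"
  proof (cases "set_pmf \<rho> \<inter> ?T = {}")
    case True
    then show ?thesis by (intro exI[of _ 0]) (auto simp: set_pmf_eq)
  next
    case False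
    then obtain m0 where m0: "m0 \<in> set_pmf \<rho>" "pat_row n m0 = l" by blast
    with supp have m0n: "m0 \<in> nonneg_patterns n" by blast
    then have l: "l \<in> nonneg_signatures n" using m0 by (simp add: nonneg_patterns_def)
    let ?h = "pattern_of_paths n" and ?P = "path_collections n"
    define G where "G = inv_into ?P ?h"
    have G: "G m \<in> ?P" "?h (G m) = m" if "m \<in> nonneg_patterns n" for m
      using paths_of_pattern[OF that] unfolding G_def by (blast intro: inv_into_into f_inv_into_f)+
    define \<rho>l where "\<rho>l = cond_pmf \<rho> ?T"
    define \<nu> where "\<nu> = map_pmf G \<rho>l"
    have pos: "measure_pmf.prob \<rho> ?T > 0" using m0 by (intro measure_pmf_posI) auto
    with gibbs l have pg: "path_gibbs n l w \<nu>"
      unfolding six_vertex_gibbs_def \<nu>_def \<rho>l_def G_def by blast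
    have setl: "set_pmf \<rho>l = set_pmf \<rho> \<inter> ?T" unfolding \<rho>l_def by (rule set_cond_pmf[OF False])
    define \<Lambda> where "\<Lambda> = {0..l n} \<times> {1..n}"
    define S where "S = same_outside n l \<Lambda> (G m0)"
    have pp: "pattern_paths n (G m) m" if "m \<in> nonneg_patterns n" for m
      using n G[OF that] that by unfold_locales
    have top: "G m \<in> paths_with_top n l" if m: "m \<in> nonneg_patterns n" "pat_row n m = l" for m
    proof -
      have "crossing (G m) n i = l (n - i + 1)" if "i \<in> {1..n}" for i
      proof -
        have "l (n - i + 1) = ?h (G m) (n, n - i + 1)"
          unfolding G(2)[OF m(1)] using m(2) that by (auto simp: pat_row_def)
        also have "\<dots> = crossing (G m) n i" using that by (auto simp: pattern_of_paths_def tri_def)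
        finally show ?thesis by simp
      qed
      then show ?thesis using G(1)[OF m(1)] by (simp add: paths_with_top_def)
    qed
    have \<Lambda>: "\<Lambda> = {0..m (n, n)} \<times> {1..n}" if "pat_row n m = l" for m
      using that n by (auto simp: \<Lambda>_def pat_row_def)
    have GS: "G m \<in> S" if m: "m \<in> nonneg_patterns n" "pat_row n m = l" for m
      using top[OF m] pattern_paths.config_outside[OF pp[OF m(1)]] pattern_paths.config_outside[OF pp[OF m0n]]
      unfolding S_def same_outside_def \<Lambda>[OF m(2), symmetric] \<Lambda>[OF m0(2), symmetric] by simp
    have in\<nu>: "G m0 \<in> set_pmf \<nu>" using m0 setl by (simp add: \<nu>_def)
    have Spos: "measure_pmf.prob \<nu> S > 0" using in\<nu> GS[OF m0n m0(2)] by (intro measure_pmf_posI)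
    have "finite \<Lambda>" "\<Lambda> \<subseteq> lattice n" by (auto simp: \<Lambda>_def lattice_def)
    with pg[unfolded path_gibbs_def, THEN conjunct2, rule_format, of \<Lambda> "G m0", folded S_def] top[OF m0n m0(2)] Spos
    have "\<exists>c. \<forall>\<omega>\<in>S. pmf (cond_pmf \<nu> S) \<omega> = c * six_vertex_weight w \<Lambda> \<omega>" by blast
    then obtain c where
      c: "\<And>\<omega>. \<omega> \<in> S \<Longrightarrow> pmf (cond_pmf \<nu> S) \<omega> = c * six_vertex_weight w \<Lambda> \<omega>" by blast
    have ne: "set_pmf \<nu> \<inter> S \<noteq> {}" using in\<nu> GS[OF m0n m0(2)] by blast
    have "pmf \<rho> m = measure_pmf.prob \<rho> ?T * measure_pmf.prob \<nu> S * c * top_const n w l * ?W m"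
      if m: "m \<in> nonneg_patterns n" "pat_row n m = l" for m
    proof -
      have inj: "inj_on G (set_pmf \<rho>l)"
      proof (rule inj_on_inverseI)
        fix m assume "m \<in> set_pmf \<rho>l"
        then have "m \<in> nonneg_patterns n" using supp unfolding setl by blast
        then show "?h (G m) = m" by (rule G(2))
      qed
      have "pmf \<nu> (G m) = pmf \<rho>l m"
      proof (cases "m \<in> set_pmf \<rho>l")
        case True
        then show ?thesis unfolding \<nu>_def by (intro pmf_map_inj inj)
      next
        case False
        have "G m \<notin> G ` set_pmf \<rho>l"
        proof
          assume "G m \<in> G ` set_pmf \<rho>l"
          then obtain m' where "m' \<in> set_pmf \<rho>l" "G m = G m'" by blast
          from this(1) have "m' \<in> nonneg_patterns n" using supp unfolding setl by blast
          with \<open>G m = G m'\<close> have "m = m'" using G(2)[OF m(1)] G(2)[of m'] by metis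
          with \<open>m' \<in> set_pmf \<rho>l\<close> False show False by simp
        qed
        then have "pmf \<nu> (G m) = 0" unfolding \<nu>_def pmf_eq_0_set_pmf set_map_pmf .
        moreover have "pmf \<rho>l m = 0" using False unfolding pmf_eq_0_set_pmf .
        ultimately show ?thesis by (rule trans[OF _ sym])
      qed
      moreover have "pmf \<nu> (G m) / measure_pmf.prob \<nu> S = c * six_vertex_weight w \<Lambda> (G m)"
        using c[OF GS[OF m]] GS[OF m] by (simp add: pmf_cond[OF ne])
      moreover have "pmf \<rho>l m = pmf \<rho> m / measure_pmf.prob \<rho> ?T"
        unfolding \<rho>l_def using m by (simp add: pmf_cond[OF False])
      moreover have "six_vertex_weight w \<Lambda> (G m) = top_const n w l * ?W m"
        using pattern_paths.six_vertex_weight_pattern[OF pp[OF m(1)] w] unfolding \<Lambda>[OF m(2)] m(2) .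
      ultimately show ?thesis using pos Spos by (simp add: field_simps)
    qed
    then show ?thesis by blast
  qed
  then obtain c where c: "\<And>m. m \<in> nonneg_patterns n \<Longrightarrow> pat_row n m = l \<Longrightarrow> pmf \<rho> m = c * ?W m" by blast
  show thesis
  proof (rule that[of "max 0 c"])
    fix m assume m: "m \<in> nonneg_patterns n" "pat_row n m = l"
    have "0 \<le> c * ?W m" using c[OF m] pmf_nonneg[of \<rho> m] by simp
    then have "0 \<le> c" using Wpos[of m] by (simp add: zero_le_mult_iff)
    then show "pmf \<rho> m = max 0 c * ?W m" using c[OF m] by simp
  qed simp
qed


section \<open>Nested averages over arrays and their scaling limit\<close>


text \<open>The coordinates in the list are filled in one after the other; \<open>s q y t\<close> is the value placed at \<open>q\<close>
  for the parameter \<open>t\<close>, and \<open>c q y\<close> is the mass of the choice. Parametrizing each choice by the unit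
  interval lets the discrete and the continuous average be compared pointwise in \<open>t\<close>.\<close>

fun nest :: "('p \<Rightarrow> ('p \<Rightarrow> 'a) \<Rightarrow> ennreal) \<Rightarrow> ('p \<Rightarrow> ('p \<Rightarrow> 'a) \<Rightarrow> real \<Rightarrow> 'a) \<Rightarrow> 'p list
    \<Rightarrow> (('p \<Rightarrow> 'a) \<Rightarrow> ennreal) \<Rightarrow> ('p \<Rightarrow> 'a) \<Rightarrow> ennreal" where
  "nest c s [] F y = F y"
| "nest c s (q # qs) F y = c q y * (\<integral>\<^sup>+t\<in>{0..1}. nest c s qs F (y(q := s q y t)) \<partial>lborel)"

text \<open>The length of the interval is left out in the row below the top one. It depends on the top row
  only, hence cancels in conditional laws, and without it the average does not degenerate when two
  top entries coincide: the choice then has one possible value.\<close>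

definition gap_fac :: "nat \<Rightarrow> nat \<times> nat \<Rightarrow> (nat \<times> nat \<Rightarrow> real) \<Rightarrow> ennreal" where
  "gap_fac n q y = (if Suc (fst q) = n then 1 else ennreal (y (rpar q) - y (lpar q)))"

definition gap_step :: "nat \<times> nat \<Rightarrow> (nat \<times> nat \<Rightarrow> real) \<Rightarrow> real \<Rightarrow> real" where
  "gap_step q y t = y (lpar q) + t * (y (rpar q) - y (lpar q))"

text \<open>The total mass of \<open>{lo..hi}\<close>, with \<open>d = hi - lo\<close>, if the left end has weight \<open>r\<close>, the right end
  weight \<open>s\<close> and every inner point weight one. It vanishes if the two ends coincide, because the rows of
  a pattern are strictly increasing.\<close>

definition gap_mass :: "real \<Rightarrow> real \<Rightarrow> int \<Rightarrow> real" where
  "gap_mass r s d = (if d \<le> 0 then 0 else r + s + of_int d - 1)"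

text \<open>The quantile function of the normalized weights on \<open>{lo..hi}\<close> just described. The branch
  \<open>hi \<le> lo\<close> carries no mass; its value is chosen so that the two bounds below hold there as well.\<close>

definition gap_quantile :: "real \<Rightarrow> real \<Rightarrow> int \<Rightarrow> int \<Rightarrow> real \<Rightarrow> int" where
  "gap_quantile r s lo hi t = (if hi \<le> lo then lo + \<lfloor>t * of_int (hi - lo)\<rfloor>
     else lo + max 0 (min (hi - lo) (\<lfloor>t * (r + s + of_int (hi - lo) - 1) - r\<rfloor> + 1)))"

text \<open>The lattice analogues of \<open>gap_fac\<close> and \<open>gap_step\<close>, for arrays that are going to be rescaled by \<open>b\<close>.\<close>

definition lat_fac :: "nat \<Rightarrow> real \<Rightarrow> real \<Rightarrow> real \<Rightarrow> nat \<times> nat \<Rightarrow> (nat \<times> nat \<Rightarrow> int) \<Rightarrow> ennreal" where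
  "lat_fac n r s b q m = (if Suc (fst q) = n then 1 else ennreal (gap_mass r s (m (rpar q) - m (lpar q)) / b))"

definition lat_step :: "real \<Rightarrow> real \<Rightarrow> nat \<times> nat \<Rightarrow> (nat \<times> nat \<Rightarrow> int) \<Rightarrow> real \<Rightarrow> int" where
  "lat_step r s q m t = gap_quantile r s (m (lpar q)) (m (rpar q)) t"

lemma gap_quantile_range:
  assumes "0 \<le> t" "t \<le> 1"
  shows "min lo hi \<le> gap_quantile r s lo hi t" "gap_quantile r s lo hi t \<le> max lo hi"
proof -
  have "hi - lo \<le> \<lfloor>t * of_int (hi - lo)\<rfloor> \<and> \<lfloor>t * of_int (hi - lo)\<rfloor> \<le> 0" if "hi \<le> lo"
  proof
    have "of_int (hi - lo) \<le> t * of_int (hi - lo)"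
      using mult_right_mono_neg[OF assms(2), of "of_int (hi - lo)"] that by simp
    then show "hi - lo \<le> \<lfloor>t * of_int (hi - lo)\<rfloor>" by (simp only: le_floor_iff)
    have "t * of_int (hi - lo) \<le> 0" using assms that by (simp add: mult_le_0_iff)
    then show "\<lfloor>t * of_int (hi - lo)\<rfloor> \<le> 0" by (simp add: floor_le_iff)
  qed
  then show "min lo hi \<le> gap_quantile r s lo hi t" "gap_quantile r s lo hi t \<le> max lo hi"
    unfolding gap_quantile_def by (cases "hi \<le> lo"; simp only: if_True if_False simp_thms; linarith)+
qed

text \<open>The endpoint weights shift the quantile by a bounded amount only, which rescaling removes.\<close>

lemma gap_quantile_close:
  assumes "0 \<le> t" "t \<le> 1" "r > 0" "s > 0"
  shows "\<bar>of_int (gap_quantile r s lo hi t) - (of_int lo + t * (of_int hi - of_int lo))\<bar> \<le> r + s + 2"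
proof (cases "hi \<le> lo")
  case True
  define x where "x = t * (real_of_int hi - real_of_int lo)"
  define z where "z = \<lfloor>x\<rfloor>"
  have z: "real_of_int z \<le> x" "x < real_of_int z + 1" unfolding z_def by (rule of_int_floor_le real_of_int_floor_add_one_gt)+
  have "gap_quantile r s lo hi t = lo + z" using True by (simp only: gap_quantile_def if_True z_def x_def of_int_diff)
  then have "real_of_int (gap_quantile r s lo hi t) = real_of_int lo + real_of_int z" by (simp only: of_int_add)
  then show ?thesis unfolding x_def[symmetric] using z assms(3,4) by linarith
next
  case False
  define d where "d = hi - lo"
  define D where "D = real_of_int hi - real_of_int lo"
  have D: "of_int d = D" "D > 0" "d > 0" using False by (simp_all add: d_def D_def)
  define x where "x = t * (r + s + D - 1) - r"
  define z where "z = \<lfloor>x\<rfloor>"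
  have tr: "0 \<le> t * r" "t * r \<le> r" "0 \<le> t * s" "t * s \<le> s" "0 \<le> t * D" "t * D \<le> D"
    using assms D(2) by (auto intro: mult_left_le_one_le)
  have x: "x = t * r + t * s + t * D - t - r" by (simp add: x_def algebra_simps)
  have z: "real_of_int z \<le> x" "x < real_of_int z + 1" unfolding z_def by (rule of_int_floor_le real_of_int_floor_add_one_gt)+
  have "gap_quantile r s lo hi t = lo + max 0 (min d (z + 1))"
    using False by (simp only: gap_quantile_def if_False d_def[symmetric] D(1) z_def x_def)
  then have "real_of_int (gap_quantile r s lo hi t) = real_of_int lo + max 0 (min D (real_of_int z + 1))"
    by (simp only: of_int_add of_int_max of_int_min D(1) of_int_0 of_int_1)
  moreover have "\<bar>max 0 (min D (real_of_int z + 1)) - t * D\<bar> \<le> r + s + 2"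
    using z tr x assms by linarith
  ultimately show ?thesis unfolding D_def[symmetric] by linarith
qed

lemma gap_mass_close:
  assumes "r > 0" "s > 0" shows "\<bar>gap_mass r s d - max 0 (of_int d)\<bar> \<le> r + s + 1"
proof (cases "d \<le> 0")
  case True
  then have "real_of_int d \<le> 0" by simp
  then show ?thesis using True assms unfolding gap_mass_def by simp
next
  case False
  then have "real_of_int d > 0" by simp
  then show ?thesis using False assms unfolding gap_mass_def if_not_P[OF False] by linarith
qed

lemma gap_mass_nonneg: assumes "r > 0" "s > 0" shows "0 \<le> gap_mass r s d"
proof (cases "d \<le> 0")
  case False
  then have "real_of_int d \<ge> 1" by simp
  then show ?thesis using assms unfolding gap_mass_def by simp
qed (simp add: gap_mass_def)

lemma measurable_gap_quantile: "gap_quantile r s lo hi \<in> borel \<rightarrow>\<^sub>M count_space UNIV"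
proof -
  have fl: "(\<lambda>t. g \<lfloor>h t\<rfloor>) \<in> borel \<rightarrow>\<^sub>M count_space UNIV" if "continuous_on UNIV h" for g :: "int \<Rightarrow> int" and h :: "real \<Rightarrow> real"
  proof -
    have "h \<in> borel_measurable borel" using that by (rule borel_measurable_continuous_onI)
    from measurable_compose[OF this measurable_real_floor]
    have "(\<lambda>t. \<lfloor>h t\<rfloor>) \<in> borel \<rightarrow>\<^sub>M count_space UNIV" .
    from measurable_compose[OF this, of g "count_space UNIV"] show ?thesis by simp
  qed
  show ?thesis
  proof (cases "hi \<le> lo")
    case True
    then have "gap_quantile r s lo hi = (\<lambda>t. (\<lambda>z. lo + z) \<lfloor>(\<lambda>t. t * of_int (hi - lo)) t\<rfloor>)"
      by (intro ext) (simp only: gap_quantile_def if_True)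
    then show ?thesis using fl[of "\<lambda>t. t * of_int (hi - lo)" "\<lambda>z. lo + z"] by (simp only: continuous_intros)
  next
    case False
    then have "gap_quantile r s lo hi = (\<lambda>t. (\<lambda>z. lo + max 0 (min (hi - lo) (z + 1))) \<lfloor>(\<lambda>t. t * (r + s + of_int (hi - lo) - 1) - r) t\<rfloor>)"
      by (intro ext) (simp only: gap_quantile_def if_False)
    then show ?thesis using fl[of "\<lambda>t. t * (r + s + of_int (hi - lo) - 1) - r" "\<lambda>z. lo + max 0 (min (hi - lo) (z + 1))"]
      by (simp only: continuous_intros)
  qed
qed

lemma measurable_int_update:
  "(\<lambda>t. F (m(q := gap_quantile r s lo hi t))) \<in> borel_measurable borel"
  by (rule measurable_compose[OF measurable_gap_quantile, of "\<lambda>z. F (m(q := z))"]) simp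

definition scaled_lim :: "'p set \<Rightarrow> (nat \<Rightarrow> real) \<Rightarrow> (nat \<Rightarrow> real) \<Rightarrow> (nat \<Rightarrow> 'p \<Rightarrow> int) \<Rightarrow> ('p \<Rightarrow> real) \<Rightarrow> bool" where
  "scaled_lim I a b m y \<longleftrightarrow> (\<forall>p\<in>I. (\<lambda>k. (of_int (m k p) - a k) / b k) \<longlonglongrightarrow> y p)"

lemma nn_integral_unit_le:
  assumes "\<And>t. t \<in> {0..1} \<Longrightarrow> f t \<le> C"
  shows "(\<integral>\<^sup>+t\<in>{0..1::real}. f t \<partial>lborel) \<le> C"
proof -
  have "(\<integral>\<^sup>+t\<in>{0..1}. f t \<partial>lborel) \<le> (\<integral>\<^sup>+t. C * indicator {0..1::real} t \<partial>lborel)"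
    using assms by (intro nn_integral_mono) (auto split: split_indicator)
  then show ?thesis by (simp add: nn_integral_cmult_indicator)
qed

text \<open>Filling in a coordinate keeps the rescaled array in \<open>[-R, R]\<close>, so each factor is bounded
  uniformly; this is the dominating bound for the limit below.\<close>

lemma lat_nest_bound:
  assumes rs: "r > 0" "s > 0" and b: "b \<ge> 1" and R: "R \<ge> 0"
    and par: "\<And>q. q \<in> set qs \<Longrightarrow> lpar q \<in> I \<and> rpar q \<in> I"
    and m: "\<And>p. p \<in> I \<Longrightarrow> \<bar>(of_int (m p) - a) / b\<bar> \<le> R" and F: "\<And>m. F m \<le> B"
  shows "nest (lat_fac n r s b) (lat_step r s) qs F m \<le> B * ennreal (2 * R + r + s + 1) ^ length qs"
  using par m
proof (induction qs arbitrary: m)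
  case Nil
  then show ?case by (simp add: F)
next
  case (Cons q qs)
  have l: "lpar q \<in> I" "rpar q \<in> I" using Cons.prems(1) by auto
  let ?C = "ennreal (2 * R + r + s + 1)"
  have "nest (lat_fac n r s b) (lat_step r s) qs F (m(q := lat_step r s q m t)) \<le> B * ?C ^ length qs"
    if t: "t \<in> {0..1}" for t
  proof (rule Cons.IH)
    show "q' \<in> set qs \<Longrightarrow> lpar q' \<in> I \<and> rpar q' \<in> I" for q' using Cons.prems(1) by simp
    fix p assume p: "p \<in> I"
    show "\<bar>(of_int ((m(q := lat_step r s q m t)) p) - a) / b\<bar> \<le> R"
    proof (cases "p = q")
      case True
      define z where "z = lat_step r s q m t"
      have "min (m (lpar q)) (m (rpar q)) \<le> z" "z \<le> max (m (lpar q)) (m (rpar q))"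
        using gap_quantile_range t unfolding z_def lat_step_def by auto
      then have zz: "m (lpar q) \<le> z \<or> m (rpar q) \<le> z" "z \<le> m (lpar q) \<or> z \<le> m (rpar q)" by auto
      have B: "\<bar>of_int (m (lpar q)) - a\<bar> \<le> R * b" "\<bar>of_int (m (rpar q)) - a\<bar> \<le> R * b"
        using Cons.prems(2)[OF l(1)] Cons.prems(2)[OF l(2)] b by (simp_all add: divide_le_eq)
      have "\<bar>of_int z - a\<bar> \<le> R * b"
      proof -
        have "of_int (m (lpar q)) \<le> real_of_int z \<or> of_int (m (rpar q)) \<le> real_of_int z" 
          "real_of_int z \<le> of_int (m (lpar q)) \<or> real_of_int z \<le> of_int (m (rpar q))" using zz by auto
        then show ?thesis using B by (auto simp: abs_le_iff)
      qed
      then show ?thesis using True b by (simp add: z_def divide_le_eq)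
    qed (use Cons.prems(2) p in simp)
  qed
  then have i: "(\<integral>\<^sup>+t\<in>{0..1}. nest (lat_fac n r s b) (lat_step r s) qs F (m(q := lat_step r s q m t)) \<partial>lborel) \<le> B * ?C ^ length qs"
    by (rule nn_integral_unit_le)
  have f: "lat_fac n r s b q m \<le> ?C"
  proof -
    have B: "of_int (m (rpar q) - m (lpar q)) \<le> 2 * R * b"
      using Cons.prems(2)[OF l(1)] Cons.prems(2)[OF l(2)] b by (simp add: divide_le_eq abs_le_iff algebra_simps)
    have "gap_mass r s (m (rpar q) - m (lpar q)) \<le> 2 * R * b + (r + s + 1) * b"
    proof -
      have "r + s + 1 \<le> (r + s + 1) * b" using b rs by (simp add: mult_le_cancel_left1)
      then show ?thesis using B rs b R unfolding gap_mass_def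
        by (smt (verit, best) mult_nonneg_nonneg)
    qed
    then have "gap_mass r s (m (rpar q) - m (lpar q)) / b \<le> 2 * R + r + s + 1"
      using b by (simp add: divide_le_eq algebra_simps)
    moreover have "1 \<le> 2 * R + r + s + 1" using R rs by simp
    ultimately have "ennreal (gap_mass r s (m (rpar q) - m (lpar q)) / b) \<le> ?C" "ennreal 1 \<le> ?C"
      by (blast intro: ennreal_leI)+
    then show ?thesis unfolding lat_fac_def ennreal_1 by (cases "Suc (fst q) = n") (simp_all only: if_True if_False simp_thms)
  qed
  have "nest (lat_fac n r s b) (lat_step r s) (q # qs) F m \<le> ?C * (B * ?C ^ length qs)"
    unfolding nest.simps by (rule mult_mono[OF f i]) simp_all
  also have "\<dots> = B * ?C ^ length (q # qs)" by (simp only: length_Cons power_Suc mult_ac)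
  finally show ?case .
qed

lemma lat_step_tendsto:
  assumes rs: "r > 0" "s > 0" and b: "\<And>k. b k \<ge> (1::real)" "filterlim b at_top sequentially"
    and t: "t \<in> {0..1}" and l: "lpar q \<in> I" "rpar q \<in> I" and lim: "scaled_lim I a b m y"
  shows "(\<lambda>k. (of_int (lat_step r s q (m k) t) - a k) / b k) \<longlonglongrightarrow> gap_step q y t"
proof -
  let ?lo = "\<lambda>k. real_of_int (m k (lpar q))" and ?hi = "\<lambda>k. real_of_int (m k (rpar q))"
  have lo: "(\<lambda>k. (?lo k - a k) / b k) \<longlonglongrightarrow> y (lpar q)" and hi: "(\<lambda>k. (?hi k - a k) / b k) \<longlonglongrightarrow> y (rpar q)"
    using lim l by (auto simp: scaled_lim_def)
  have "(\<lambda>k. (?lo k - a k) / b k + t * ((?hi k - a k) / b k - (?lo k - a k) / b k)) \<longlonglongrightarrow> gap_step q y t"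
    unfolding gap_step_def by (intro tendsto_intros lo hi)
  moreover have "(\<lambda>k. (of_int (lat_step r s q (m k) t) - a k) / b k
       - ((?lo k - a k) / b k + t * ((?hi k - a k) / b k - (?lo k - a k) / b k))) \<longlonglongrightarrow> 0"
  proof (rule Lim_null_comparison[where g = "\<lambda>k. (r + s + 2) / b k"])
    show "(\<lambda>k. (r + s + 2) / b k) \<longlonglongrightarrow> 0"
      by (rule tendsto_divide_0[OF tendsto_const filterlim_at_top_imp_at_infinity[OF b(2)]])
    have "norm ((of_int (lat_step r s q (m k) t) - a k) / b k
       - ((?lo k - a k) / b k + t * ((?hi k - a k) / b k - (?lo k - a k) / b k))) \<le> (r + s + 2) / b k" for k
    proof -
      have bk: "b k > 0" using b(1)[of k] by simp
      have "(of_int (lat_step r s q (m k) t) - a k) / b k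
       - ((?lo k - a k) / b k + t * ((?hi k - a k) / b k - (?lo k - a k) / b k))
       = (of_int (lat_step r s q (m k) t) - (?lo k + t * (?hi k - ?lo k))) / b k"
        using bk by (simp add: field_simps)
      also have "norm \<dots> = \<bar>of_int (lat_step r s q (m k) t) - (?lo k + t * (?hi k - ?lo k))\<bar> / b k"
        using bk by simp
      also have "\<dots> \<le> (r + s + 2) / b k"
        using gap_quantile_close[of t r s "m k (lpar q)" "m k (rpar q)"] t rs bk
        by (intro divide_right_mono) (auto simp: lat_step_def)
      finally show ?thesis .
    qed
    then show "\<forall>\<^sub>F k in sequentially. norm ((of_int (lat_step r s q (m k) t) - a k) / b k
       - ((?lo k - a k) / b k + t * ((?hi k - a k) / b k - (?lo k - a k) / b k))) \<le> (r + s + 2) / b k" by simp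
  qed
  ultimately show ?thesis by (rule Lim_transform)
qed

lemma lat_fac_tendsto:
  assumes rs: "r > 0" "s > 0" and b: "\<And>k. b k \<ge> (1::real)" "filterlim b at_top sequentially"
    and l: "lpar q \<in> I" "rpar q \<in> I" and lim: "scaled_lim I a b m y"
  shows "(\<lambda>k. lat_fac n r s (b k) q (m k)) \<longlonglongrightarrow> gap_fac n q y"
proof (cases "Suc (fst q) = n")
  case False
  let ?d = "\<lambda>k. m k (rpar q) - m k (lpar q)"
  have "(\<lambda>k. (of_int (m k (rpar q)) - a k) / b k - (of_int (m k (lpar q)) - a k) / b k) \<longlonglongrightarrow> y (rpar q) - y (lpar q)"
    using lim l by (intro tendsto_diff) (auto simp: scaled_lim_def)
  moreover have "(of_int (m k (rpar q)) - a k) / b k - (of_int (m k (lpar q)) - a k) / b k = of_int (?d k) / b k" for k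
    by (simp add: diff_divide_distrib)
  ultimately have d: "(\<lambda>k. of_int (?d k) / b k) \<longlonglongrightarrow> y (rpar q) - y (lpar q)" by (simp only:)
  have "(\<lambda>k. gap_mass r s (?d k) / b k - max 0 (of_int (?d k) / b k)) \<longlonglongrightarrow> 0"
  proof (rule Lim_null_comparison[where g = "\<lambda>k. (r + s + 1) / b k"])
    show "(\<lambda>k. (r + s + 1) / b k) \<longlonglongrightarrow> 0"
      by (rule tendsto_divide_0[OF tendsto_const filterlim_at_top_imp_at_infinity[OF b(2)]])
    have "norm (gap_mass r s (?d k) / b k - max 0 (of_int (?d k) / b k)) \<le> (r + s + 1) / b k" for k
    proof -
      have bk: "b k > 0" using b(1)[of k] by simp
      have "max 0 (of_int (?d k) / b k) = max 0 (of_int (?d k)) / b k"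
        using bk by (cases "?d k \<le> 0") (simp_all add: max_def divide_le_0_iff zero_le_divide_iff)
      then have "norm (gap_mass r s (?d k) / b k - max 0 (of_int (?d k) / b k)) = \<bar>gap_mass r s (?d k) - max 0 (of_int (?d k))\<bar> / b k"
        using bk by (simp add: diff_divide_distrib[symmetric])
      also have "\<dots> \<le> (r + s + 1) / b k"
        by (rule divide_right_mono[OF gap_mass_close[OF rs]]) (use bk in simp)
      finally show ?thesis .
    qed
    then show "\<forall>\<^sub>F k in sequentially. norm (gap_mass r s (?d k) / b k - max 0 (of_int (?d k) / b k)) \<le> (r + s + 1) / b k" by simp
  qed
  moreover have "(\<lambda>k. max 0 (of_int (?d k) / b k)) \<longlonglongrightarrow> max 0 (y (rpar q) - y (lpar q))"
    by (intro tendsto_max tendsto_const d)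
  ultimately have "(\<lambda>k. gap_mass r s (?d k) / b k) \<longlonglongrightarrow> max 0 (y (rpar q) - y (lpar q))"
    by (rule Lim_transform[rotated])
  then have "(\<lambda>k. ennreal (gap_mass r s (?d k) / b k)) \<longlonglongrightarrow> ennreal (max 0 (y (rpar q) - y (lpar q)))"
    by (rule tendsto_ennrealI)
  then show ?thesis using False by (simp add: lat_fac_def gap_fac_def)
qed (simp add: lat_fac_def gap_fac_def)



lemma scaled_lim_update:
  assumes "scaled_lim I a b m y" "(\<lambda>k. (of_int (z k) - a k) / b k) \<longlonglongrightarrow> v"
  shows "scaled_lim I a b (\<lambda>k. (m k)(q := z k)) (y(q := v))"
  unfolding scaled_lim_def
proof
  fix p assume "p \<in> I"
  then show "(\<lambda>k. (of_int (((m k)(q := z k)) p) - a k) / b k) \<longlonglongrightarrow> (y(q := v)) p"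
    using assms by (cases "p = q") (simp_all add: scaled_lim_def)
qed

lemma scaled_lim_bounded:
  assumes "finite I" "scaled_lim I a b m y"
  obtains R where "R \<ge> 0" "\<And>k p. p \<in> I \<Longrightarrow> \<bar>(of_int (m k p) - a k) / b k\<bar> \<le> R"
proof -
  have "\<exists>R. \<forall>k. \<bar>(of_int (m k p) - a k) / b k\<bar> \<le> R" if "p \<in> I" for p
  proof -
    have "(\<lambda>k. (of_int (m k p) - a k) / b k) \<longlonglongrightarrow> y p" using assms(2) that by (simp add: scaled_lim_def)
    then have "Bseq (\<lambda>k. (of_int (m k p) - a k) / b k)" by (intro convergent_imp_Bseq convergentI)
    then show ?thesis unfolding Bseq_def real_norm_def by blast
  qed
  then obtain R where R: "\<And>p k. p \<in> I \<Longrightarrow> \<bar>(of_int (m k p) - a k) / b k\<bar> \<le> R p" by metis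
  show thesis
  proof (rule that[of "\<Sum>p\<in>I. \<bar>R p\<bar>"])
    show "0 \<le> (\<Sum>p\<in>I. \<bar>R p\<bar>)" by (intro sum_nonneg) simp
    fix k p assume p: "p \<in> I"
    have "R p \<le> \<bar>R p\<bar>" by simp
    also have "\<dots> \<le> (\<Sum>p\<in>I. \<bar>R p\<bar>)" using assms(1) p by (intro member_le_sum) simp_all
    finally show "\<bar>(of_int (m k p) - a k) / b k\<bar> \<le> (\<Sum>p\<in>I. \<bar>R p\<bar>)" using R[OF p, of k] by linarith
  qed
qed

text \<open>Dominated convergence, one coordinate at a time: for every fixed parameter \<open>t\<close> the rescaled
  quantile converges to the point that divides the limiting interval in the ratio \<open>t\<close>, and the
  rescaled mass to its length.\<close>

lemma nest_tendsto_ge1: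
  assumes rs: "r > 0" "s > 0" and b: "\<And>k. b k \<ge> (1::real)" "filterlim b at_top sequentially"
    and I: "finite I" and B: "B < \<top>" and F_le: "\<And>k m. F k m \<le> B"
    and F: "\<And>m y. scaled_lim I a b m y \<Longrightarrow> (\<lambda>k. F k (m k)) \<longlonglongrightarrow> G y"
    and par: "\<And>q. q \<in> set qs \<Longrightarrow> lpar q \<in> I \<and> rpar q \<in> I"
    and lim: "scaled_lim I a b m y"
  shows "(\<lambda>k. nest (lat_fac n r s (b k)) (lat_step r s) qs (F k) (m k)) \<longlonglongrightarrow> nest (gap_fac n) gap_step qs G y"
  using par lim
proof (induction qs arbitrary: m y)
  case Nil
  then show ?case using F by simp
next
  case (Cons q qs)
  have l: "lpar q \<in> I" "rpar q \<in> I" using Cons.prems(1) by auto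
  have par: "\<And>q. q \<in> set qs \<Longrightarrow> lpar q \<in> I \<and> rpar q \<in> I" using Cons.prems(1) by simp
  let ?N = "\<lambda>k. nest (lat_fac n r s (b k)) (lat_step r s) qs (F k)"
  let ?L = "nest (gap_fac n) gap_step qs G"
  let ?u = "\<lambda>k t. ?N k ((m k)(q := lat_step r s q (m k) t)) * indicator {0..1} t"
  let ?u' = "\<lambda>t. ?L (y(q := gap_step q y t)) * indicator {0..1} t"
  have upd: "scaled_lim I a b (\<lambda>k. (m k)(q := lat_step r s q (m k) t)) (y(q := gap_step q y t))"
    if "t \<in> {0..1}" for t
    by (rule scaled_lim_update[OF Cons.prems(2) lat_step_tendsto[OF rs b that l Cons.prems(2)]])
  have pt: "(\<lambda>k. ?u k t) \<longlonglongrightarrow> ?u' t" for t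
  proof (cases "t \<in> {0..1}")
    case True
    have "(\<lambda>k. ?N k ((m k)(q := lat_step r s q (m k) t))) \<longlonglongrightarrow> ?L (y(q := gap_step q y t))"
      by (rule Cons.IH[OF par upd[OF True]])
    then show ?thesis unfolding indicator_simps(1)[OF True] mult_1_right .
  next
    case False
    show ?thesis unfolding indicator_simps(2)[OF False] mult_zero_right by (rule tendsto_const)
  qed
  have um: "?u k \<in> borel_measurable lborel" for k
    unfolding lat_step_def by (intro borel_measurable_times_ennreal) (simp_all add: measurable_int_update)
  have um': "?u' \<in> borel_measurable lborel"
    by (rule borel_measurable_LIMSEQ_order[OF pt um])
  obtain R where R: "R \<ge> 0" "\<And>k p. p \<in> I \<Longrightarrow> \<bar>(of_int (m k p) - a k) / b k\<bar> \<le> R"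
    using scaled_lim_bounded[OF I Cons.prems(2)] by metis
  define C where "C = (B * ennreal (2 * R + r + s + 1) ^ length qs) "
  have C: "C < \<top>" unfolding C_def using B by (simp add: ennreal_mult_less_top power_less_top_ennreal)
  have bd: "?N k ((m k)(q := lat_step r s q (m k) t)) \<le> C" if t: "t \<in> {0..1}" for k t
    unfolding C_def
  proof (rule lat_nest_bound[OF rs b(1) R(1) par])
    fix p assume p: "p \<in> I"
    show "\<bar>(of_int (((m k)(q := lat_step r s q (m k) t)) p) - a k) / b k\<bar> \<le> R"
    proof (cases "p = q")
      case True
      have bk: "b k > 0" using b(1)[of k] by simp
      define z where "z = lat_step r s q (m k) t"
      have "min (m k (lpar q)) (m k (rpar q)) \<le> z" "z \<le> max (m k (lpar q)) (m k (rpar q))"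
        using gap_quantile_range[of t] t unfolding z_def lat_step_def by simp_all
      then have zz: "real_of_int (m k (lpar q)) \<le> z \<or> real_of_int (m k (rpar q)) \<le> z" 
        "z \<le> real_of_int (m k (lpar q)) \<or> z \<le> real_of_int (m k (rpar q))" by linarith+
      have "\<bar>of_int (m k (lpar q)) - a k\<bar> \<le> R * b k" "\<bar>of_int (m k (rpar q)) - a k\<bar> \<le> R * b k"
        using R(2)[OF l(1), of k] R(2)[OF l(2), of k] bk by (simp_all add: divide_le_eq)
      then have "\<bar>of_int z - a k\<bar> \<le> R * b k" using zz by linarith
      then show ?thesis using True bk by (simp add: z_def divide_le_eq)
    qed (use R(2)[OF p] in simp)
  qed (simp_all add: F_le)
  have int: "(\<lambda>k. \<integral>\<^sup>+t. ?u k t \<partial>lborel) \<longlonglongrightarrow> (\<integral>\<^sup>+t. ?u' t \<partial>lborel)"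
  proof (rule nn_integral_dominated_convergence[where w = "\<lambda>t. C * indicator {0..1} t"])
    show "?u k \<in> borel_measurable lborel" for k by (rule um)
    show "?u' \<in> borel_measurable lborel" by (rule um')
    show "(\<lambda>t. C * indicator {0..1::real} t) \<in> borel_measurable lborel" by simp
    show "AE t in lborel. ?u k t \<le> C * indicator {0..1} t" for k
      using bd by (intro AE_I2) (simp split: split_indicator)
    show "(\<integral>\<^sup>+ t. C * indicator {0..1::real} t \<partial>lborel) < \<infinity>"
      using C by (simp add: nn_integral_cmult_indicator)
    show "AE t in lborel. (\<lambda>k. ?u k t) \<longlonglongrightarrow> ?u' t" using pt by simp
  qed
  have intle: "(\<integral>\<^sup>+t. ?u k t \<partial>lborel) \<le> C" for k
    using bd by (rule nn_integral_unit_le)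
  have fin: "(\<integral>\<^sup>+t. ?u' t \<partial>lborel) \<noteq> \<infinity>"
    using LIMSEQ_le_const2[OF int, of C] intle C by (auto simp: top_unique)
  have fac: "(\<lambda>k. lat_fac n r s (b k) q (m k)) \<longlonglongrightarrow> gap_fac n q y"
    by (rule lat_fac_tendsto[OF rs b l Cons.prems(2)])
  have fin2: "gap_fac n q y \<noteq> \<infinity>" by (simp add: gap_fac_def)
  show ?case unfolding nest.simps
    by (rule tendsto_mult_ennreal[OF fac int]) (use fin fin2 in blast)
qed

lemma nest_tendsto:
  assumes rs: "r > 0" "s > 0" and b: "filterlim b at_top sequentially"
    and I: "finite I" and B: "B < \<top>" and F_le: "\<And>k m. F k m \<le> B"
    and F: "\<And>N m y. scaled_lim I (\<lambda>k. a (k + N)) (\<lambda>k. b (k + N)) m y \<Longrightarrow> (\<lambda>k. F (k + N) (m k)) \<longlonglongrightarrow> G y"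
    and par: "\<And>q. q \<in> set qs \<Longrightarrow> lpar q \<in> I \<and> rpar q \<in> I"
    and lim: "scaled_lim I a b m y"
  shows "(\<lambda>k. nest (lat_fac n r s (b k)) (lat_step r s) qs (F k) (m k)) \<longlonglongrightarrow> nest (gap_fac n) gap_step qs G y"
proof -
  have "\<forall>\<^sub>F k in sequentially. b k \<ge> 1" using b by (simp add: filterlim_at_top)
  then obtain N where N: "\<And>k. k \<ge> N \<Longrightarrow> b k \<ge> 1" by (auto simp: eventually_sequentially)
  have "(\<lambda>k. nest (lat_fac n r s (b (k + N))) (lat_step r s) qs (F (k + N)) (m (k + N))) \<longlonglongrightarrow> nest (gap_fac n) gap_step qs G y"
  proof (rule nest_tendsto_ge1[OF rs _ _ I B])
    show "1 \<le> b (k + N)" for k using N by simp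
    show "filterlim (\<lambda>k. b (k + N)) at_top sequentially"
      by (rule filterlim_compose[OF b filterlim_add_const_nat_at_top])
    show "F (k + N) m \<le> B" for k m by (rule F_le)
    show "scaled_lim I (\<lambda>k. a (k + N)) (\<lambda>k. b (k + N)) (\<lambda>k. m (k + N)) y"
      using lim unfolding scaled_lim_def by (auto intro: LIMSEQ_ignore_initial_segment)
  qed (use par F in auto)
  then show ?thesis by (rule LIMSEQ_offset)
qed


section \<open>Order of filling, measurability and positivity\<close>


text \<open>The upper neighbours of a position lie in the next higher row, so in this order they are never
  filled in after the position itself.\<close>

definition row_order :: "(nat \<times> nat) list \<Rightarrow> bool" where
  "row_order qs \<longleftrightarrow> sorted_wrt (\<lambda>p q. fst q \<le> fst p) qs \<and> distinct qs"

fun tri_list :: "nat \<Rightarrow> (nat \<times> nat) list" where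
  "tri_list 0 = []"
| "tri_list (Suc k) = map (Pair (Suc k)) [1..<Suc (Suc k)] @ tri_list k"

lemma set_tri_list: "set (tri_list k) = tri k"
proof (induction k)
  case 0
  then show ?case by (auto simp: tri_def)
next
  case (Suc k)
  have "tri (Suc k) = Pair (Suc k) ` {1..<Suc (Suc k)} \<union> tri k"
    unfolding tri_def by (auto simp: image_iff le_Suc_eq)
  then show ?case using Suc by (simp only: tri_list.simps set_append set_map set_upt)
qed

lemma row_order_tri_list: "row_order (tri_list k)"
proof (induction k)
  case 0
  then show ?case by (simp add: row_order_def)
next
  case (Suc k)
  let ?A = "map (Pair (Suc k)) [1..<Suc (Suc k)]"
  have "sorted_wrt (\<lambda>p q. fst q \<le> fst p) ?A" unfolding sorted_wrt_map by (simp add: sorted_wrt_iff_nth_less)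
  moreover have "distinct ?A" by (simp only: distinct_map distinct_upt inj_on_def) blast
  moreover have "fst q \<le> k" if "q \<in> set (tri_list k)" for q
    using that unfolding set_tri_list by (auto simp: tri_def)
  moreover have "fst p = Suc k" if "p \<in> set ?A" for p using that by (simp only: set_map) auto
  ultimately show ?case using Suc unfolding row_order_def tri_list.simps sorted_wrt_append distinct_append
    by (metis (no_types, lifting) Suc_n_not_le_n disjoint_iff le_SucI)
qed

lemma row_order_Cons: "row_order (q # qs) \<Longrightarrow> row_order qs"
  by (simp add: row_order_def)

lemma row_order_parents:
  assumes "row_order (q # qs)" shows "lpar q \<notin> set (q # qs)" "rpar q \<notin> set (q # qs)"
proof -
  have "fst p \<le> fst q" if "p \<in> set (q # qs)" for p using assms that by (auto simp: row_order_def)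
  then show "lpar q \<notin> set (q # qs)" "rpar q \<notin> set (q # qs)"
    by (metis Suc_n_not_le_n fst_conv lpar_def, metis Suc_n_not_le_n fst_conv rpar_def)
qed

lemma nest_cong_off:
  assumes "row_order qs" and "\<And>p. p \<notin> set qs \<Longrightarrow> y p = y' p"
    and dep: "\<And>q y y'. y (lpar q) = y' (lpar q) \<Longrightarrow> y (rpar q) = y' (rpar q) \<Longrightarrow> c q y = c q y' \<and> s q y = s q y'"
  shows "nest c s qs F y = nest c s qs F y'"
  using assms(1,2)
proof (induction qs arbitrary: y y')
  case Nil
  then have "y = y'" by auto
  then show ?case by simp
next
  case (Cons q qs)
  have e: "c q y = c q y' \<and> s q y = s q y'"
    using Cons.prems(2)[OF row_order_parents(1)[OF Cons.prems(1)]] Cons.prems(2)[OF row_order_parents(2)[OF Cons.prems(1)]]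
    by (rule dep)
  have "nest c s qs F (y(q := s q y t)) = nest c s qs F (y'(q := s q y' t))" for t
    using e Cons.prems(2) by (intro Cons.IH row_order_Cons[OF Cons.prems(1)]) auto
  then show ?case using e by simp
qed

lemma gap_nest_cong:
  "row_order qs \<Longrightarrow> (\<And>p. p \<notin> set qs \<Longrightarrow> y p = y' p) \<Longrightarrow> nest (gap_fac n) gap_step qs F y = nest (gap_fac n) gap_step qs F y'"
  by (rule nest_cong_off) (auto simp: gap_fac_def gap_step_def fun_eq_iff)

lemma lat_nest_cong:
  "row_order qs \<Longrightarrow> (\<And>p. p \<notin> set qs \<Longrightarrow> y p = y' p) \<Longrightarrow> nest (lat_fac n r s b) (lat_step r s) qs F y = nest (lat_fac n r s b) (lat_step r s) qs F y'"
  by (rule nest_cong_off) (auto simp: lat_fac_def lat_step_def fun_eq_iff)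

lemma measurable_coord: "p \<in> I \<Longrightarrow> (\<lambda>y. y p) \<in> borel_measurable (coord_space I)"
  by (rule measurable_component_singleton)

lemma measurable_gap_update:
  assumes "q \<in> I" "lpar q \<in> I" "rpar q \<in> I"
  shows "(\<lambda>x. (fst x)(q := gap_step q (fst x) (snd x))) \<in> coord_space I \<Otimes>\<^sub>M lborel \<rightarrow>\<^sub>M coord_space I"
proof (rule measurable_fun_upd)
  show "I = I \<union> {q}" using assms by auto
  show "fst \<in> coord_space I \<Otimes>\<^sub>M lborel \<rightarrow>\<^sub>M coord_space I" by (rule measurable_fst)
  have c: "(\<lambda>x. fst x p) \<in> borel_measurable (coord_space I \<Otimes>\<^sub>M lborel)" if "p \<in> I" for p
    by (rule measurable_compose[OF measurable_fst measurable_coord[OF that]])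
  have s: "snd \<in> borel_measurable (coord_space I \<Otimes>\<^sub>M lborel)"
    using measurable_snd[of "coord_space I" lborel] by simp
  show "(\<lambda>x. gap_step q (fst x) (snd x)) \<in> borel_measurable (coord_space I \<Otimes>\<^sub>M lborel)"
    unfolding gap_step_def
    by (intro borel_measurable_add borel_measurable_times borel_measurable_diff c s assms)
qed

lemma nest_measurable:
  assumes F: "F \<in> borel_measurable (coord_space I)"
    and qs: "\<And>q. q \<in> set qs \<Longrightarrow> q \<in> I \<and> lpar q \<in> I \<and> rpar q \<in> I"
  shows "nest (gap_fac n) gap_step qs F \<in> borel_measurable (coord_space I)"
  using qs
proof (induction qs)
  case Nil
  have "nest (gap_fac n) gap_step [] F = F" by auto
  then show ?case using F by simp
next
  case (Cons q qs)
  have q: "q \<in> I" "lpar q \<in> I" "rpar q \<in> I" using Cons.prems by auto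
  have IH: "nest (gap_fac n) gap_step qs F \<in> borel_measurable (coord_space I)"
    using Cons by auto
  have fac: "gap_fac n q \<in> borel_measurable (coord_space I)"
  proof (cases "Suc (fst q) = n")
    case True
    then have "gap_fac n q = (\<lambda>_. 1)" by (auto simp: gap_fac_def)
    then show ?thesis by simp
  next
    case False
    then have "gap_fac n q = (\<lambda>y. ennreal (y (rpar q) - y (lpar q)))" by (auto simp: gap_fac_def)
    moreover
    have "(\<lambda>y. y (rpar q) - y (lpar q)) \<in> borel_measurable (coord_space I)"
      by (intro borel_measurable_diff measurable_coord q)
    from measurable_compose[OF this measurable_ennreal]
    have "(\<lambda>y. ennreal (y (rpar q) - y (lpar q))) \<in> borel_measurable (coord_space I)" .
    ultimately show ?thesis by (simp only:)
  qed
  have j: "(\<lambda>x. nest (gap_fac n) gap_step qs F ((fst x)(q := gap_step q (fst x) (snd x))) * indicator {0..1} (snd x))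
      \<in> borel_measurable (coord_space I \<Otimes>\<^sub>M lborel)"
  proof (intro borel_measurable_times_ennreal)
    show "(\<lambda>x. nest (gap_fac n) gap_step qs F ((fst x)(q := gap_step q (fst x) (snd x)))) \<in> borel_measurable (coord_space I \<Otimes>\<^sub>M lborel)"
      by (rule measurable_compose[OF measurable_gap_update[OF q] IH])
    have "(\<lambda>t. indicator {0..1::real} t :: ennreal) \<in> borel_measurable lborel" by simp
    then show "(\<lambda>x. indicator {0..1::real} (snd x) :: ennreal) \<in> borel_measurable (coord_space I \<Otimes>\<^sub>M lborel)"
      by (rule measurable_compose[OF measurable_snd])
  qed
  have "(\<lambda>y. \<integral>\<^sup>+t\<in>{0..1}. nest (gap_fac n) gap_step qs F (y(q := gap_step q y t)) \<partial>lborel) \<in> borel_measurable (coord_space I)"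
    by (rule lborel.borel_measurable_nn_integral) (use j in \<open>simp add: case_prod_beta\<close>)
  with fac have "(\<lambda>y. gap_fac n q y * (\<integral>\<^sup>+t\<in>{0..1}. nest (gap_fac n) gap_step qs F (y(q := gap_step q y t)) \<partial>lborel)) \<in> borel_measurable (coord_space I)"
    by (rule borel_measurable_times_ennreal)
  moreover have "nest (gap_fac n) gap_step (q # qs) F = (\<lambda>y. gap_fac n q y * (\<integral>\<^sup>+t\<in>{0..1}. nest (gap_fac n) gap_step qs F (y(q := gap_step q y t)) \<partial>lborel))"
    by auto
  ultimately show ?case by (simp only:)
qed

text \<open>Strict interlacing as far as it is possible: at a degenerate interval the entry is forced.\<close>

definition inner_at :: "nat \<times> nat \<Rightarrow> (nat \<times> nat \<Rightarrow> real) \<Rightarrow> bool" where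
  "inner_at q y \<longleftrightarrow> y (lpar q) \<le> y q \<and> y q \<le> y (rpar q) \<and>
     (y (lpar q) < y (rpar q) \<longrightarrow> y (lpar q) < y q \<and> y q < y (rpar q))"

text \<open>A weakly increasing top row without three equal consecutive entries.\<close>

definition good_top :: "nat \<Rightarrow> (nat \<times> nat \<Rightarrow> real) \<Rightarrow> bool" where
  "good_top n y \<longleftrightarrow> (\<forall>i\<in>{1..<n}. y (n, i) \<le> y (n, Suc i)) \<and>
     (\<forall>i\<in>{1..n - 2}. \<not> (y (n, i) = y (n, i + 1) \<and> y (n, i + 1) = y (n, i + 2)))"

text \<open>If two neighbours in row \<open>j\<close> agree, they agree with the entry between them in row \<open>j + 1\<close>. An
  entry meets one end of its interval only if the interval is degenerate, so row \<open>j + 1\<close> has three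
  equal consecutive entries. In the top row this is excluded, in the other rows by induction.\<close>

lemma strict_rows:
  assumes top: "good_top n y" and inner: "\<And>q. q \<in> tri (n - 1) \<Longrightarrow> K \<le> fst q \<Longrightarrow> inner_at q y"
    and "K \<le> j" "j < n" "1 \<le> i" "i < j"
  shows "y (j, i) < y (j, Suc i)"
  using assms(3-)
proof (induction "n - j" arbitrary: j)
  case (Suc d)
  have "inner_at (j, i) y" "inner_at (j, Suc i) y"
    using Suc.prems by (auto intro!: inner simp: tri_def)
  then have le: "y (Suc j, i) \<le> y (j, i)" "y (j, i) \<le> y (Suc j, Suc i)" "y (Suc j, Suc i) \<le> y (j, Suc i)"
      "y (j, Suc i) \<le> y (Suc j, Suc (Suc i))"
    and st: "y (Suc j, i) < y (Suc j, Suc i) \<Longrightarrow> y (j, i) < y (Suc j, Suc i)"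
      "y (Suc j, Suc i) < y (Suc j, Suc (Suc i)) \<Longrightarrow> y (Suc j, Suc i) < y (j, Suc i)"
    by (auto simp: inner_at_def lpar_def rpar_def)
  show ?case
  proof (rule ccontr)
    assume "\<not> y (j, i) < y (j, Suc i)"
    then have "y (Suc j, i) = y (Suc j, Suc i)" "y (Suc j, Suc i) = y (Suc j, Suc (Suc i))"
      using le st by linarith+
    moreover have "y (Suc j, i) < y (Suc j, Suc i)" if "Suc j < n"
      using Suc.hyps(1)[of "Suc j"] Suc.hyps(2) Suc.prems that by auto
    moreover have "\<not> (y (Suc j, i) = y (Suc j, Suc i) \<and> y (Suc j, Suc i) = y (Suc j, Suc (Suc i)))" if "Suc j = n"
      using top Suc.prems that unfolding good_top_def by auto
    ultimately show False using Suc.prems(2) by (cases "Suc j = n") auto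
  qed
qed simp

text \<open>An array whose rows above \<open>q\<close>, and the part of the row of \<open>q\<close> not in the list, are already filled
  in strictly.\<close>

locale fill_state =
  fixes n q qs and y :: "nat \<times> nat \<Rightarrow> real"
  assumes top: "good_top n y" and ord: "row_order (q # qs)" and sub: "set (q # qs) \<subseteq> tri (n - 1)"
    and inner: "\<And>p. p \<in> tri (n - 1) - set (q # qs) \<Longrightarrow> inner_at p y"
    and above: "\<And>p q'. p \<in> tri (n - 1) - set (q # qs) \<Longrightarrow> q' \<in> set (q # qs) \<Longrightarrow> fst q' \<le> fst p"
begin

lemma tri_q: "1 \<le> snd q" "snd q \<le> fst q" "Suc (fst q) \<le> n" "fst q < n"
  using sub by (auto simp: tri_def)

lemma parent_less: assumes "Suc (fst q) < n" shows "y (lpar q) < y (rpar q)"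
  unfolding lpar_def rpar_def
proof (rule strict_rows[OF top, of "Suc (fst q)"])
  fix p assume p: "p \<in> tri (n - 1)" "Suc (fst q) \<le> fst p"
  have "fst p' \<le> fst q" if "p' \<in> set (q # qs)" for p' using ord that by (auto simp: row_order_def)
  then have "p \<notin> set (q # qs)" using p(2) by (meson Suc_n_not_le_n le_trans)
  then show "inner_at p y" using inner p by blast
qed (use tri_q assms in auto)

lemma parent_le: "y (lpar q) \<le> y (rpar q)"
proof (cases "Suc (fst q) < n")
  case False
  then have "Suc (fst q) = n" using tri_q by simp
  then show ?thesis using top tri_q unfolding good_top_def lpar_def rpar_def by auto
qed (use parent_less in force)

lemma next_state:
  assumes "0 < t" "t < 1"
  shows "good_top n (y(q := gap_step q y t))" 
    "\<And>p. p \<in> tri (n - 1) - set qs \<Longrightarrow> inner_at p (y(q := gap_step q y t))"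
    "\<And>p q'. p \<in> tri (n - 1) - set qs \<Longrightarrow> q' \<in> set qs \<Longrightarrow> fst q' \<le> fst p"
proof -
  have "fst q \<noteq> n" using tri_q by simp
  then have "(n, i) \<noteq> q" for i by auto
  then show "good_top n (y(q := gap_step q y t))" using top by (simp add: good_top_def)
  show "fst q' \<le> fst p" if "p \<in> tri (n - 1) - set qs" "q' \<in> set qs" for p q'
  proof (cases "p = q")
    case True
    then show ?thesis using ord that by (auto simp: row_order_def)
  next
    case False
    then show ?thesis using above[of p q'] that by simp
  qed
  show "inner_at p (y(q := gap_step q y t))" if p: "p \<in> tri (n - 1) - set qs" for p
  proof (cases "p = q")
    case True
    have ne: "lpar q \<noteq> q" "rpar q \<noteq> q" using row_order_parents[OF ord] by auto
    have "y (lpar q) < gap_step q y t \<and> gap_step q y t < y (rpar q)" if lt: "y (lpar q) < y (rpar q)"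
    proof -
      define e where "e = t * (y (rpar q) - y (lpar q))"
      have "0 < e" unfolding e_def using assms lt by (intro mult_pos_pos) auto
      moreover have "e < 1 * (y (rpar q) - y (lpar q))" unfolding e_def
        using assms lt by (intro mult_strict_right_mono) auto
      ultimately show ?thesis unfolding gap_step_def e_def[symmetric] by simp
    qed
    moreover have "y (lpar q) = y (rpar q) \<Longrightarrow> gap_step q y t = y (rpar q)" by (simp add: gap_step_def)
    ultimately show ?thesis unfolding True inner_at_def using ne parent_le
      by (cases "y (lpar q) < y (rpar q)") auto
  next
    case False
    then have p': "p \<in> tri (n - 1) - set (q # qs)" using p by simp
    then have "fst q \<le> fst p" using above[of p q] by simp
    then have "lpar p \<noteq> q" "rpar p \<noteq> q" by (auto simp: lpar_def rpar_def)
    then show ?thesis using inner[OF p'] False by (simp add: inner_at_def)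
  qed
qed

end

text \<open>For \<open>0 < t < 1\<close> every choice is strictly inside its interval, hence the intervals of the next
  rows have positive length.\<close>

lemma nest_pos:
  assumes "good_top n y" "row_order qs" "set qs \<subseteq> tri (n - 1)"
    and "\<And>p. p \<in> tri (n - 1) - set qs \<Longrightarrow> inner_at p y"
    and "\<And>p q. p \<in> tri (n - 1) - set qs \<Longrightarrow> q \<in> set qs \<Longrightarrow> fst q \<le> fst p"
    and "y \<in> space (coord_space (tri n))"
  shows "nest (gap_fac n) gap_step qs (\<lambda>_. 1) y > 0"
  using assms
proof (induction qs arbitrary: y)
  case (Cons q qs)
  interpret fill_state n q qs y using Cons.prems by unfold_locales auto
  let ?N = "nest (gap_fac n) gap_step qs (\<lambda>_. 1)"
  have sub': "q' \<in> tri n \<and> lpar q' \<in> tri n \<and> rpar q' \<in> tri n" if "q' \<in> set (q # qs)" for q'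
    using sub that by (auto simp: tri_def lpar_def rpar_def)
  have sp: "y(q := v) \<in> space (coord_space (tri n))" for v
    using Cons.prems(6) sub'[of q] by (auto simp: space_PiM PiE_iff extensional_def)
  have pos: "?N (y(q := gap_step q y t)) > 0" if "t \<in> {0<..<1}" for t
  proof (rule Cons.IH)
    have t: "0 < t" "t < 1" using that by auto
    show "good_top n (y(q := gap_step q y t))" by (rule next_state(1)[OF t])
    show "inner_at p (y(q := gap_step q y t))" if "p \<in> tri (n - 1) - set qs" for p by (rule next_state(2)[OF t that])
    show "fst q' \<le> fst p" if "p \<in> tri (n - 1) - set qs" "q' \<in> set qs" for p q' by (rule next_state(3)[OF t that])
    show "y(q := gap_step q y t) \<in> space (coord_space (tri n))" by (rule sp)
  qed (use row_order_Cons[OF ord] sub in auto)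
  have m: "(\<lambda>t. ?N (y(q := gap_step q y t))) \<in> borel_measurable lborel"
  proof -
    have "?N \<in> borel_measurable (coord_space (tri n))"
    proof (rule nest_measurable)
      show "q' \<in> tri n \<and> lpar q' \<in> tri n \<and> rpar q' \<in> tri n" if "q' \<in> set qs" for q'
        using sub'[of q'] that by simp
    qed simp
    moreover have "q \<in> tri n" "lpar q \<in> tri n" "rpar q \<in> tri n" using sub'[of q] by simp_all
    from measurable_gap_update[OF this]
    have "(\<lambda>x. (fst x)(q := gap_step q (fst x) (snd x))) \<in> coord_space (tri n) \<Otimes>\<^sub>M lborel \<rightarrow>\<^sub>M coord_space (tri n)" .
    from measurable_compose[OF measurable_Pair1'[OF Cons.prems(6), of lborel] this]
    have "(\<lambda>t. y(q := gap_step q y t)) \<in> lborel \<rightarrow>\<^sub>M coord_space (tri n)" by (simp only: fst_conv snd_conv)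
    ultimately show ?thesis by (rule measurable_compose[rotated])
  qed
  have "(\<integral>\<^sup>+t\<in>{0..1}. ?N (y(q := gap_step q y t)) \<partial>lborel) \<noteq> 0"
  proof
    assume "(\<integral>\<^sup>+t\<in>{0..1}. ?N (y(q := gap_step q y t)) \<partial>lborel) = 0"
    then have "emeasure lborel {t\<in>space lborel. ?N (y(q := gap_step q y t)) * indicator {0..1} t \<noteq> 0} = 0"
      using m by (subst (asm) nn_integral_0_iff) simp_all
    moreover have "emeasure lborel {0<..<1::real} \<le> emeasure lborel {t\<in>space lborel. ?N (y(q := gap_step q y t)) * indicator {0..1} t \<noteq> 0}"
    proof (rule emeasure_mono)
      show "{0<..<1} \<subseteq> {t\<in>space lborel. ?N (y(q := gap_step q y t)) * indicator {0..1} t \<noteq> 0}"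
        using pos by force
      show "{t\<in>space lborel. ?N (y(q := gap_step q y t)) * indicator {0..1} t \<noteq> 0} \<in> sets lborel"
        using m by measurable
    qed
    ultimately show False by simp
  qed
  moreover have "gap_fac n q y > 0" using parent_less tri_q by (auto simp: gap_fac_def)
  ultimately show ?case by (simp add: zero_less_iff_neq_zero)
qed simp

text \<open>Midpoints throughout give a relatively interior point of the polytope.\<close>

lemma inner_fill:
  assumes "good_top n y" "row_order qs" "set qs \<subseteq> tri (n - 1)"
    and "\<And>p. p \<in> tri (n - 1) - set qs \<Longrightarrow> inner_at p y"
    and "\<And>p q. p \<in> tri (n - 1) - set qs \<Longrightarrow> q \<in> set qs \<Longrightarrow> fst q \<le> fst p"
  shows "\<exists>z. (\<forall>p. p \<notin> set qs \<longrightarrow> z p = y p) \<and> (\<forall>p\<in>tri (n - 1). inner_at p z)"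
  using assms
proof (induction qs arbitrary: y)
  case (Cons q qs)
  interpret fill_state n q qs y using Cons.prems by unfold_locales auto
  have "\<exists>z. (\<forall>p. p \<notin> set qs \<longrightarrow> z p = (y(q := gap_step q y (1/2))) p) \<and> (\<forall>p\<in>tri (n - 1). inner_at p z)"
  proof (rule Cons.IH)
    have t: "0 < (1/2 :: real)" "(1/2 :: real) < 1" by auto
    show "good_top n (y(q := gap_step q y (1/2)))" by (rule next_state(1)[OF t])
    show "inner_at p (y(q := gap_step q y (1/2)))" if "p \<in> tri (n - 1) - set qs" for p by (rule next_state(2)[OF t that])
    show "fst q' \<le> fst p" if "p \<in> tri (n - 1) - set qs" "q' \<in> set qs" for p q' by (rule next_state(3)[OF t that])
  qed (use row_order_Cons[OF ord] sub in auto)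
  then show ?case by (metis fun_upd_other list.set_intros)
qed auto


section \<open>Discrete conditional laws as nested averages\<close>


definition slot_wt :: "real \<Rightarrow> real \<Rightarrow> int \<Rightarrow> int \<Rightarrow> int \<Rightarrow> real" where
  "slot_wt r s lo hi z = (if z = lo then r else if z = hi then s else 1)"

lemma clamp_eq_iff:
  fixes f :: int
  shows "1 \<le> d \<Longrightarrow> max 0 (min d (f + 1)) = 0 \<longleftrightarrow> f < 0"
    "0 < j \<Longrightarrow> j < d \<Longrightarrow> max 0 (min d (f + 1)) = j \<longleftrightarrow> f = j - 1"
    "1 \<le> d \<Longrightarrow> max 0 (min d (f + 1)) = d \<longleftrightarrow> d - 1 \<le> f"
  by linarith+

lemma unit_slots:
  fixes a b :: real
  shows "b \<le> 1 \<Longrightarrow> {t \<in> {0..1}. t < b} = {0..<b}"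
    "b \<le> 1 \<Longrightarrow> 0 \<le> a \<Longrightarrow> {t \<in> {0..1}. t \<in> {a..<b}} = {a..<b}"
    "0 \<le> a \<Longrightarrow> {t \<in> {0..1}. a \<le> t} = {a..1}"
  by auto

text \<open>Each value is taken on an interval of parameters whose length is its normalized weight.\<close>

lemma emeasure_quantile_slot:
  assumes rs: "r > 0" "s > 0" and lt: "lo < hi" and z: "z \<in> {lo..hi}"
  shows "{t \<in> {0..1}. gap_quantile r s lo hi t = z} \<in> sets lborel"
    "emeasure lborel {t \<in> {0..1}. gap_quantile r s lo hi t = z}
      = ennreal (slot_wt r s lo hi z / gap_mass r s (hi - lo))"
proof -
  define d where "d = hi - lo"
  define Z where "Z = r + s + real_of_int d - 1"
  have d: "d \<ge> 1" using lt by (simp add: d_def)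
  then have dr: "real_of_int d \<ge> 1" by simp
  have Z: "Z > 0" unfolding Z_def using rs dr by linarith
  have mass: "gap_mass r s (hi - lo) = Z" unfolding gap_mass_def d_def[symmetric] Z_def using d by simp
  define j where "j = z - lo"
  have j: "0 \<le> j" "j \<le> d" using z by (auto simp: j_def d_def)
  have Q: "gap_quantile r s lo hi t = z \<longleftrightarrow> max 0 (min d (\<lfloor>t * Z - r\<rfloor> + 1)) = j" for t
    using lt unfolding gap_quantile_def d_def[symmetric] Z_def[symmetric] j_def by auto
  consider "j = 0" | "0 < j" "j < d" | "j = d" using j by linarith
  then have "\<exists>a b. {t \<in> {0..1}. gap_quantile r s lo hi t = z} \<in> {{a..<b}, {a..b}} \<and> a \<le> b \<and> b - a = slot_wt r s lo hi z / Z"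
  proof cases
    case 1
    have slot: "max 0 (min d (\<lfloor>t * Z - r\<rfloor> + 1)) = j \<longleftrightarrow> t < r / Z" for t
    proof -
      have "max 0 (min d (\<lfloor>t * Z - r\<rfloor> + 1)) = j \<longleftrightarrow> \<lfloor>t * Z - r\<rfloor> < 0" unfolding 1 by (rule clamp_eq_iff(1)[OF d])
      also have "\<dots> \<longleftrightarrow> t * Z < r" unfolding floor_less_zero by (rule diff_less_0_iff_less)
      also have "\<dots> \<longleftrightarrow> t < r / Z" using Z by (simp only: pos_less_divide_eq)
      finally show ?thesis .
    qed
    have "r \<le> Z" unfolding Z_def using rs dr by linarith
    then have "r / Z \<le> 1" by (simp only: divide_le_eq_1_pos[OF Z])
    then have "{t \<in> {0..1}. gap_quantile r s lo hi t = z} = {0..<r / Z}" unfolding Q slot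
      by (rule unit_slots(1))
    moreover have "slot_wt r s lo hi z = r" using 1 by (simp add: slot_wt_def j_def)
    moreover have "0 \<le> r / Z" using Z rs by simp
    ultimately show ?thesis by (intro exI[of _ 0] exI[of _ "r / Z"]) simp
  next
    case 2
    have slot: "max 0 (min d (\<lfloor>t * Z - r\<rfloor> + 1)) = j \<longleftrightarrow> t \<in> {(r + j - 1) / Z..<(r + j) / Z}" for t
    proof -
      have "max 0 (min d (\<lfloor>t * Z - r\<rfloor> + 1)) = j \<longleftrightarrow> \<lfloor>t * Z - r\<rfloor> = j - 1" by (rule clamp_eq_iff(2)[OF 2])
      also have "\<dots> \<longleftrightarrow> r + j - 1 \<le> t * Z \<and> t * Z < r + j" unfolding floor_eq_iff of_int_diff of_int_1 by (intro conj_cong) linarith+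
      also have "\<dots> \<longleftrightarrow> t \<in> {(r + j - 1) / Z..<(r + j) / Z}"
        using Z by (simp only: pos_less_divide_eq pos_divide_le_eq atLeastLessThan_iff)
      finally show ?thesis .
    qed
    have jr: "1 \<le> real_of_int j" "real_of_int j \<le> real_of_int d - 1" using 2 by linarith+
    have "r + j \<le> Z" "0 \<le> r + j - 1" unfolding Z_def using rs jr by linarith+
    then have "(r + j) / Z \<le> 1" "0 \<le> (r + j - 1) / Z"
      using Z by (simp only: divide_le_eq_1_pos, intro divide_nonneg_pos)
    then have "{t \<in> {0..1}. gap_quantile r s lo hi t = z} = {(r + j - 1) / Z..<(r + j) / Z}" unfolding Q slot
      by (rule unit_slots(2))
    moreover have "slot_wt r s lo hi z = 1" using 2 by (simp add: slot_wt_def j_def d_def)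
    moreover have "(r + j) / Z - (r + j - 1) / Z = 1 / Z" by (simp add: diff_divide_distrib[symmetric])
    moreover have "(r + j - 1) / Z \<le> (r + j) / Z" using Z by (intro divide_right_mono) simp_all
    ultimately show ?thesis by (intro exI[of _ "(r + j - 1) / Z"] exI[of _ "(r + j) / Z"]) simp
  next
    case 3
    have slot: "max 0 (min d (\<lfloor>t * Z - r\<rfloor> + 1)) = j \<longleftrightarrow> (r + d - 1) / Z \<le> t" for t
    proof -
      have "max 0 (min d (\<lfloor>t * Z - r\<rfloor> + 1)) = j \<longleftrightarrow> d - 1 \<le> \<lfloor>t * Z - r\<rfloor>" unfolding 3 by (rule clamp_eq_iff(3)[OF d])
      also have "\<dots> \<longleftrightarrow> r + d - 1 \<le> t * Z" unfolding le_floor_iff of_int_diff of_int_1 by linarith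
      also have "\<dots> \<longleftrightarrow> (r + d - 1) / Z \<le> t" using Z by (simp only: pos_divide_le_eq)
      finally show ?thesis .
    qed
    have "r + d - 1 \<le> Z" "0 \<le> r + d - 1" unfolding Z_def using rs dr by linarith+
    then have le: "(r + d - 1) / Z \<le> 1" "0 \<le> (r + d - 1) / Z"
      using Z by (simp only: divide_le_eq_1_pos, intro divide_nonneg_pos)
    then have "{t \<in> {0..1}. gap_quantile r s lo hi t = z} = {(r + d - 1) / Z..1}" unfolding Q slot
      by (intro unit_slots(3))
    moreover have "slot_wt r s lo hi z = s" using 3 d by (auto simp: slot_wt_def j_def d_def)
    moreover have "1 - (r + d - 1) / Z = s / Z"
    proof -
      have "1 - (r + d - 1) / Z = (Z - (r + d - 1)) / Z" using Z by (simp add: diff_divide_distrib)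
      also have "Z - (r + d - 1) = s" by (simp add: Z_def)
      finally show ?thesis .
    qed
    ultimately show ?thesis using le(1) by (intro exI[of _ "(r + d - 1) / Z"] exI[of _ 1]) simp
  qed
  then obtain a b where ab: "{t \<in> {0..1}. gap_quantile r s lo hi t = z} \<in> {{a..<b}, {a..b}}" "a \<le> b" 
    "b - a = slot_wt r s lo hi z / Z" by blast
  then show "{t \<in> {0..1}. gap_quantile r s lo hi t = z} \<in> sets lborel" by auto
  show "emeasure lborel {t \<in> {0..1}. gap_quantile r s lo hi t = z}
      = ennreal (slot_wt r s lo hi z / gap_mass r s (hi - lo))"
    unfolding mass ab(3)[symmetric] using ab(1,2) by auto
qed

lemma nn_integral_finitely_many_values:
  fixes g :: "'b \<Rightarrow> ennreal"
  assumes "finite Z" "\<And>t. t \<in> A \<Longrightarrow> Q t \<in> Z" "\<And>z. z \<in> Z \<Longrightarrow> {t \<in> A. Q t = z} \<in> sets M"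
  shows "(\<integral>\<^sup>+t\<in>A. g (Q t) \<partial>M) = (\<Sum>z\<in>Z. g z * emeasure M {t \<in> A. Q t = z})"
proof -
  have "g (Q t) * indicator A t = (\<Sum>z\<in>Z. g z * indicator {t \<in> A. Q t = z} t)" for t
  proof (cases "t \<in> A")
    case True
    have "(\<Sum>z\<in>Z. g z * indicator {t \<in> A. Q t = z} t) = (\<Sum>z\<in>Z. if z = Q t then g z else 0)"
      using True by (intro sum.cong refl) auto
    then show ?thesis using assms(1) assms(2)[OF True] True by simp
  qed (simp add: indicator_def)
  then have "(\<integral>\<^sup>+t\<in>A. g (Q t) \<partial>M) = (\<Sum>z\<in>Z. \<integral>\<^sup>+t. g z * indicator {t \<in> A. Q t = z} t \<partial>M)"
    using assms(3) by (simp add: nn_integral_sum)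
  also have "\<dots> = (\<Sum>z\<in>Z. g z * emeasure M {t \<in> A. Q t = z})"
    using assms(3) by (intro sum.cong refl nn_integral_cmult_indicator)
  finally show ?thesis .
qed

lemma quantile_integral:
  assumes rs: "r > 0" "s > 0"
  shows "ennreal (gap_mass r s (hi - lo)) * (\<integral>\<^sup>+t\<in>{0..1}. g (gap_quantile r s lo hi t) \<partial>lborel)
    = (if lo < hi then \<Sum>z\<in>{lo..hi}. ennreal (slot_wt r s lo hi z) * g z else 0)"
proof (cases "lo < hi")
  case True
  let ?S = "\<lambda>z. {t \<in> {0..1}. gap_quantile r s lo hi t = z}"
  have pos: "gap_mass r s (hi - lo) > 0"
  proof -
    have "real_of_int (hi - lo) \<ge> 1" using True by linarith
    then show ?thesis using True rs unfolding gap_mass_def by simp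
  qed
  have "(\<integral>\<^sup>+t\<in>{0..1}. g (gap_quantile r s lo hi t) \<partial>lborel) = (\<Sum>z\<in>{lo..hi}. g z * emeasure lborel (?S z))"
  proof (rule nn_integral_finitely_many_values[where g = g and Q = "gap_quantile r s lo hi"])
    fix t :: real assume "t \<in> {0..1}"
    then have "0 \<le> t" "t \<le> 1" by simp_all
    note range = gap_quantile_range[OF this, where lo = lo and hi = hi and r = r and s = s]
    have "lo \<le> gap_quantile r s lo hi t"
      using range(1) unfolding min_absorb1[OF less_imp_le[OF True]] .
    moreover have "gap_quantile r s lo hi t \<le> hi"
      using range(2) unfolding max_absorb2[OF less_imp_le[OF True]] .
    ultimately show "gap_quantile r s lo hi t \<in> {lo..hi}" unfolding atLeastAtMost_iff by (rule conjI)
  next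
    show "finite {lo..hi}" by simp
    show "?S z \<in> sets lborel" if "z \<in> {lo..hi}" for z by (rule emeasure_quantile_slot(1)[OF rs True that])
  qed
  also have "\<dots> = (\<Sum>z\<in>{lo..hi}. g z * ennreal (slot_wt r s lo hi z / gap_mass r s (hi - lo)))"
    by (rule sum.cong[OF refl]) (simp only: emeasure_quantile_slot(2)[OF rs True])
  finally have "ennreal (gap_mass r s (hi - lo)) * (\<integral>\<^sup>+t\<in>{0..1}. g (gap_quantile r s lo hi t) \<partial>lborel)
    = (\<Sum>z\<in>{lo..hi}. (ennreal (gap_mass r s (hi - lo)) * ennreal (slot_wt r s lo hi z / gap_mass r s (hi - lo))) * g z)"
    by (simp only: sum_distrib_left mult_ac)
  also have "\<dots> = (\<Sum>z\<in>{lo..hi}. ennreal (slot_wt r s lo hi z) * g z)"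
    using pos rs by (intro sum.cong refl) (simp add: ennreal_mult'[symmetric] slot_wt_def)
  finally show ?thesis using True by simp
next
  case False
  then show ?thesis by (simp add: gap_mass_def)
qed

fun lat_sum :: "real \<Rightarrow> real \<Rightarrow> (nat \<times> nat) list \<Rightarrow> ((nat \<times> nat \<Rightarrow> int) \<Rightarrow> ennreal) \<Rightarrow> (nat \<times> nat \<Rightarrow> int) \<Rightarrow> ennreal" where
  "lat_sum r s [] F m = F m"
| "lat_sum r s (q # qs) F m = (if m (lpar q) < m (rpar q) then
     \<Sum>z\<in>{m (lpar q)..m (rpar q)}. ennreal (slot_wt r s (m (lpar q)) (m (rpar q)) z) * lat_sum r s qs F (m(q := z)) else 0)"

definition lat_norm :: "nat \<Rightarrow> real \<Rightarrow> real \<Rightarrow> real \<Rightarrow> (nat \<times> nat) list \<Rightarrow> (nat \<times> nat \<Rightarrow> int) \<Rightarrow> ennreal" where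
  "lat_norm n r s b qs m = (\<Prod>q\<leftarrow>qs. if Suc (fst q) = n then ennreal (gap_mass r s (m (rpar q) - m (lpar q))) else ennreal b)"

lemma lat_norm_update:
  assumes "fst q < n" shows "lat_norm n r s b qs (m(q := z)) = lat_norm n r s b qs m"
  unfolding lat_norm_def
proof -
  have "(if Suc (fst q') = n then ennreal (gap_mass r s ((m(q := z)) (rpar q') - (m(q := z)) (lpar q'))) else ennreal b)
     = (if Suc (fst q') = n then ennreal (gap_mass r s (m (rpar q') - m (lpar q'))) else ennreal b)" for q'
  proof (cases "Suc (fst q') = n")
    case True
    then have "lpar q' \<noteq> q" "rpar q' \<noteq> q" using assms by (auto simp: lpar_def rpar_def)
    then show ?thesis by (simp only: fun_upd_other simp_thms)
  qed (simp only: if_False simp_thms)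
  then show "(\<Prod>q'\<leftarrow>qs. if Suc (fst q') = n then ennreal (gap_mass r s ((m(q := z)) (rpar q') - (m(q := z)) (lpar q'))) else ennreal b)
    = (\<Prod>q'\<leftarrow>qs. if Suc (fst q') = n then ennreal (gap_mass r s (m (rpar q') - m (lpar q'))) else ennreal b)"
    by (simp only:)
qed

text \<open>The norming collects what the nested average omits or rescales: the mass in the row below the
  top one, and a power of \<open>b\<close>.\<close>

lemma lat_nest_eq_sum:
  assumes rs: "r > 0" "s > 0" and b: "b > 0" and qs: "\<And>q. q \<in> set qs \<Longrightarrow> fst q < n"
  shows "lat_norm n r s b qs m * nest (lat_fac n r s b) (lat_step r s) qs F m = lat_sum r s qs F m"
  using qs
proof (induction qs arbitrary: m)
  case Nil
  then show ?case by (simp add: lat_norm_def)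
next
  case (Cons q qs)
  let ?N = "nest (lat_fac n r s b) (lat_step r s)" and ?K = "lat_norm n r s b"
  let ?M = "ennreal (gap_mass r s (m (rpar q) - m (lpar q)))"
  define c where "c = (if Suc (fst q) = n then ?M else ennreal b)"
  have c: "c * lat_fac n r s b q m = ?M"
    using b gap_mass_nonneg[OF rs, of "m (rpar q) - m (lpar q)"]
    by (auto simp: c_def lat_fac_def ennreal_mult'[symmetric])
  have K: "?K (q # qs) m = c * ?K qs m" by (simp add: lat_norm_def c_def)
  have IH: "?K qs m * ?N qs F (m(q := z)) = lat_sum r s qs F (m(q := z))" for z
  proof -
    have qn: "fst q < n" and qsn: "\<And>q'. q' \<in> set qs \<Longrightarrow> fst q' < n" using Cons.prems by auto
    from Cons.IH[OF qsn, of "m(q := z)"] show ?thesis unfolding lat_norm_update[OF qn] .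
  qed
  let ?g = "\<lambda>t. ?N qs F (m(q := gap_quantile r s (m (lpar q)) (m (rpar q)) t)) * indicator {0..1} t"
  have gm: "?g \<in> borel_measurable lborel"
    by (intro borel_measurable_times_ennreal) (simp_all add: measurable_int_update)
  have "?K (q # qs) m * ?N (q # qs) F m = (c * lat_fac n r s b q m) * (?K qs m * (\<integral>\<^sup>+t. ?g t \<partial>lborel))"
    unfolding K nest.simps lat_step_def by (simp only: mult_ac)
  also have "?K qs m * (\<integral>\<^sup>+t. ?g t \<partial>lborel) = (\<integral>\<^sup>+t. ?K qs m * ?g t \<partial>lborel)"
    by (rule nn_integral_cmult[symmetric, OF gm])
  also have "\<dots> = (\<integral>\<^sup>+t\<in>{0..1}. lat_sum r s qs F (m(q := gap_quantile r s (m (lpar q)) (m (rpar q)) t)) \<partial>lborel)"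
    by (simp only: mult.assoc[symmetric] IH)
  also have "(c * lat_fac n r s b q m) * \<dots> = lat_sum r s (q # qs) F m"
    unfolding c quantile_integral[OF rs, of "m (rpar q)" "m (lpar q)" "\<lambda>z. lat_sum r s qs F (m(q := z))"] lat_sum.simps ..
  finally show ?case .
qed

text \<open>The strict inequality is strictness of the next higher row at the two neighbours of \<open>q\<close>.\<close>

definition fillings :: "(nat \<times> nat) list \<Rightarrow> (nat \<times> nat \<Rightarrow> int) \<Rightarrow> (nat \<times> nat \<Rightarrow> int) set" where
  "fillings qs m = {m'. (\<forall>p. p \<notin> set qs \<longrightarrow> m' p = m p) \<and>
     (\<forall>q\<in>set qs. m' (lpar q) \<le> m' q \<and> m' q \<le> m' (rpar q) \<and> m' (lpar q) < m' (rpar q))}"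

lemma fillings_off: "m' \<in> fillings qs m \<Longrightarrow> p \<notin> set qs \<Longrightarrow> m' p = m p"
  unfolding fillings_def mem_Collect_eq by (erule conjE, erule allE, erule mp)

lemma fillings_at: "m' \<in> fillings qs m \<Longrightarrow> q \<in> set qs \<Longrightarrow> m' (lpar q) \<le> m' q \<and> m' q \<le> m' (rpar q) \<and> m' (lpar q) < m' (rpar q)"
  unfolding fillings_def mem_Collect_eq by (erule conjE, erule bspec)

lemma fillingsI:
  assumes "\<And>p. p \<notin> set qs \<Longrightarrow> m' p = m p"
    and "\<And>q. q \<in> set qs \<Longrightarrow> m' (lpar q) \<le> m' q \<and> m' q \<le> m' (rpar q) \<and> m' (lpar q) < m' (rpar q)"
  shows "m' \<in> fillings qs m"
  unfolding fillings_def mem_Collect_eq by (intro conjI allI impI ballI assms)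

lemma fillings_Cons:
  assumes "row_order (q # qs)"
  shows "fillings (q # qs) m = (if m (lpar q) < m (rpar q) then (\<Union>z\<in>{m (lpar q)..m (rpar q)}. fillings qs (m(q := z))) else {})"
proof -
  note par = row_order_parents[OF assms]
  have nq: "q \<notin> set qs" using assms by (simp add: row_order_def)
  have l: "m' \<in> fillings (q # qs) m \<Longrightarrow> m (lpar q) < m (rpar q) \<and> m' q \<in> {m (lpar q)..m (rpar q)} \<and> m' \<in> fillings qs (m(q := m' q))" for m'
  proof -
    assume m': "m' \<in> fillings (q # qs) m"
    note off = fillings_off[OF m']
    have at: "m' (lpar q') \<le> m' q' \<and> m' q' \<le> m' (rpar q') \<and> m' (lpar q') < m' (rpar q')" if "q' \<in> set (q # qs)" for q'
      by (rule fillings_at[OF m' that])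
    have "m' \<in> fillings qs (m(q := m' q))"
    proof (rule fillingsI)
      fix p assume "p \<notin> set qs"
      then show "m' p = (m(q := m' q)) p" using off[of p] by (cases "p = q") simp_all
    qed (rule at, simp)
    then show ?thesis using at[of q] unfolding off[OF par(1)] off[OF par(2)] by simp
  qed
  have r: "m (lpar q) < m (rpar q) \<Longrightarrow> z \<in> {m (lpar q)..m (rpar q)} \<Longrightarrow> m' \<in> fillings qs (m(q := z)) \<Longrightarrow> m' \<in> fillings (q # qs) m" for m' z
  proof -
    assume lt: "m (lpar q) < m (rpar q)" and z: "z \<in> {m (lpar q)..m (rpar q)}" and m': "m' \<in> fillings qs (m(q := z))"
    note off = fillings_off[OF m']
    have "m' q = z" "m' (lpar q) = m (lpar q)" "m' (rpar q) = m (rpar q)"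
      using off[OF nq] off[of "lpar q"] off[of "rpar q"] par by simp_all
    note e = this
    show ?thesis
    proof (rule fillingsI)
      fix p assume "p \<notin> set (q # qs)"
      then show "m' p = m p" using off[of p] by simp
    next
      fix q' assume "q' \<in> set (q # qs)"
      then consider "q' = q" | "q' \<in> set qs" by auto
      then show "m' (lpar q') \<le> m' q' \<and> m' q' \<le> m' (rpar q') \<and> m' (lpar q') < m' (rpar q')"
      proof cases
        case 1
        show ?thesis unfolding 1 e using lt z by simp
      next
        case 2
        show ?thesis by (rule fillings_at[OF m' 2])
      qed
    qed
  qed
  show ?thesis
  proof (cases "m (lpar q) < m (rpar q)")
    case True
    then show ?thesis using l r by (simp only: if_True) blast
  next
    case False
    then show ?thesis using l by (simp only: if_False) blast
  qed
qed

lemma lat_sum_fillings: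
  assumes rs: "r > 0" "s > 0" and ord: "row_order qs"
  shows "finite (fillings qs m)"
    "lat_sum r s qs F m = (\<Sum>m'\<in>fillings qs m. ennreal (\<Prod>q\<in>set qs. site_weight r s m' q) * F m')"
proof -
  have "finite (fillings qs m) \<and> lat_sum r s qs F m = (\<Sum>m'\<in>fillings qs m. ennreal (\<Prod>q\<in>set qs. site_weight r s m' q) * F m')"
    using ord
  proof (induction qs arbitrary: m)
    case Nil
    have "fillings [] m = {m}" by (auto simp: fillings_def)
    then show ?case by simp
  next
    case (Cons q qs)
    note par = row_order_parents[OF Cons.prems]
    have nq: "q \<notin> set qs" using Cons.prems by (simp add: row_order_def)
    note IH = Cons.IH[OF row_order_Cons[OF Cons.prems]]
    show ?case
    proof (cases "m (lpar q) < m (rpar q)")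
      case True
      let ?Z = "{m (lpar q)..m (rpar q)}"
      have fc: "fillings (q # qs) m = (\<Union>z\<in>?Z. fillings qs (m(q := z)))"
        using True by (simp only: fillings_Cons[OF Cons.prems] if_True)
      have off: "m' q = z \<and> m' (lpar q) = m (lpar q) \<and> m' (rpar q) = m (rpar q)" if "m' \<in> fillings qs (m(q := z))" for m' z
      proof -
        note o = fillings_off[OF that]
        show ?thesis using o[OF nq] o[of "lpar q"] o[of "rpar q"] par by simp
      qed
      have "(\<Sum>m'\<in>fillings (q # qs) m. ennreal (\<Prod>q\<in>set (q # qs). site_weight r s m' q) * F m')
        = (\<Sum>z\<in>?Z. \<Sum>m'\<in>fillings qs (m(q := z)). ennreal (\<Prod>q\<in>set (q # qs). site_weight r s m' q) * F m')"
        unfolding fc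
      proof (rule sum.UNION_disjoint)
        show "\<forall>z\<in>?Z. \<forall>z'\<in>?Z. z \<noteq> z' \<longrightarrow> fillings qs (m(q := z)) \<inter> fillings qs (m(q := z')) = {}"
          using off by (metis disjoint_iff)
      qed (use IH in auto)
      also have "\<dots> = (\<Sum>z\<in>?Z. ennreal (slot_wt r s (m (lpar q)) (m (rpar q)) z) * lat_sum r s qs F (m(q := z)))"
      proof (rule sum.cong[OF refl])
        fix z assume z: "z \<in> ?Z"
        have "(\<Sum>m'\<in>fillings qs (m(q := z)). ennreal (\<Prod>q\<in>set (q # qs). site_weight r s m' q) * F m')
          = (\<Sum>m'\<in>fillings qs (m(q := z)). ennreal (slot_wt r s (m (lpar q)) (m (rpar q)) z) * (ennreal (\<Prod>q\<in>set qs. site_weight r s m' q) * F m'))"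
        proof (rule sum.cong[OF refl])
          fix m' assume m': "m' \<in> fillings qs (m(q := z))"
          have "site_weight r s m' q = slot_wt r s (m (lpar q)) (m (rpar q)) z"
            using off[OF m'] unfolding site_weight_def slot_wt_def by simp
          then have "(\<Prod>q\<in>set (q # qs). site_weight r s m' q) = slot_wt r s (m (lpar q)) (m (rpar q)) z * (\<Prod>q\<in>set qs. site_weight r s m' q)"
            using nq by (simp add: prod.insert)
          moreover have "0 \<le> slot_wt r s (m (lpar q)) (m (rpar q)) z" using rs by (simp add: slot_wt_def)
          ultimately show "ennreal (\<Prod>q\<in>set (q # qs). site_weight r s m' q) * F m'
             = ennreal (slot_wt r s (m (lpar q)) (m (rpar q)) z) * (ennreal (\<Prod>q\<in>set qs. site_weight r s m' q) * F m')"
            by (simp only: ennreal_mult' mult.assoc)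
        qed
        also have "\<dots> = ennreal (slot_wt r s (m (lpar q)) (m (rpar q)) z) * lat_sum r s qs F (m(q := z))"
          using IH[of "m(q := z)"] by (simp only: sum_distrib_left)
        finally show "(\<Sum>m'\<in>fillings qs (m(q := z)). ennreal (\<Prod>q\<in>set (q # qs). site_weight r s m' q) * F m')
          = ennreal (slot_wt r s (m (lpar q)) (m (rpar q)) z) * lat_sum r s qs F (m(q := z))" .
      qed
      finally have "lat_sum r s (q # qs) F m = (\<Sum>m'\<in>fillings (q # qs) m. ennreal (\<Prod>q\<in>set (q # qs). site_weight r s m' q) * F m')"
        using True by (simp only: lat_sum.simps if_True)
      moreover have "finite (fillings (q # qs) m)" unfolding fc using IH by (intro finite_UN_I) auto
      ultimately show ?thesis by blast
    next
      case False
      then have "fillings (q # qs) m = {}" by (simp only: fillings_Cons[OF Cons.prems] if_False)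
      then show ?thesis using False by simp
    qed
  qed
  then show "finite (fillings qs m)"
    "lat_sum r s qs F m = (\<Sum>m'\<in>fillings qs m. ennreal (\<Prod>q\<in>set qs. site_weight r s m' q) * F m')" by blast+
qed



lemma strict_mono_on_consecutive:
  fixes f :: "nat \<Rightarrow> int"
  assumes "\<And>i. 1 \<le> i \<Longrightarrow> i < k \<Longrightarrow> f i < f (Suc i)"
  shows "strict_mono_on {1..k} f"
proof -
  have "1 \<le> i \<Longrightarrow> i + Suc d \<le> k \<Longrightarrow> f i < f (i + Suc d)" for i d
  proof (induction d)
    case 0
    then show ?case using assms[of i] by simp
  next
    case (Suc d)
    then have "f i < f (i + Suc d)" by simp
    also have "\<dots> < f (Suc (i + Suc d))" using Suc.prems by (intro assms) auto
    finally show ?case by simp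
  qed
  note step = this
  show ?thesis
  proof (rule strict_mono_onI)
    fix i j assume ij: "i \<in> {1..k}" "j \<in> {1..k}" "i < j"
    then have "j = i + Suc (j - i - 1)" by simp
    with step[of i "j - i - 1"] ij show "f i < f j" by (metis atLeastAtMost_iff)
  qed
qed

text \<open>The strict inequalities between upper neighbours cover every pair of neighbours in the rows
  above the first, and the first row has one entry.\<close>

lemma fillings_patterns:
  assumes n: "1 \<le> n" and m: "m \<in> nonneg_patterns n"
  shows "fillings (tri_list (n - 1)) m = {m' \<in> nonneg_patterns n. pat_row n m' = pat_row n m}"
proof (intro set_eqI iffI)
  fix m' assume m': "m' \<in> {m' \<in> nonneg_patterns n. pat_row n m' = pat_row n m}"
  then have p': "m' \<in> patterns n" and top: "pat_row n m' = pat_row n m" by (auto simp: nonneg_patterns_def)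
  have p: "m \<in> patterns n" using m by (simp add: nonneg_patterns_def)
  show "m' \<in> fillings (tri_list (n - 1)) m"
  proof (rule fillingsI)
    fix p :: "nat \<times> nat" assume "p \<notin> set (tri_list (n - 1))"
    then have off: "p \<notin> tri (n - 1)" by (simp only: set_tri_list simp_thms)
    show "m' p = m p"
    proof (cases "p \<in> tri n")
      case True
      then have "fst p = n" "snd p \<in> {1..n}" using off by (auto simp: tri_def)
      then show ?thesis using fun_cong[OF top, of "snd p"] by (cases p) (simp add: pat_row_def)
    next
      case False
      have e: "m' \<in> tri n \<rightarrow>\<^sub>E UNIV" "m \<in> tri n \<rightarrow>\<^sub>E UNIV" using p p' by (simp_all add: patterns_def)
      show ?thesis unfolding PiE_arb[OF e(1) False] PiE_arb[OF e(2) False] ..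
    qed
  next
    fix q assume "q \<in> set (tri_list (n - 1))"
    then have q: "q \<in> tri (n - 1)" by (simp only: set_tri_list)
    then have "1 \<le> snd q" "snd q \<le> fst q" "fst q < n" by (auto simp: tri_def)
    from patterns_interlace[OF p' this] patterns_parents_less[OF p' q]
    show "m' (lpar q) \<le> m' q \<and> m' q \<le> m' (rpar q) \<and> m' (lpar q) < m' (rpar q)"
      by (simp add: lpar_def rpar_def)
  qed
next
  fix m' assume m': "m' \<in> fillings (tri_list (n - 1)) m"
  have off: "m' p = m p" if "p \<notin> tri (n - 1)" for p
    using fillings_off[OF m', of p] that unfolding set_tri_list .
  have at: "m' (Suc k, i) \<le> m' (k, i)" "m' (k, i) \<le> m' (Suc k, Suc i)" "m' (Suc k, i) < m' (Suc k, Suc i)"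
    if "1 \<le> i" "i \<le> k" "k < n" for i k
  proof -
    have "(k, i) \<in> set (tri_list (n - 1))" unfolding set_tri_list using that by (auto simp: tri_def)
    from fillings_at[OF m' this] show "m' (Suc k, i) \<le> m' (k, i)" "m' (k, i) \<le> m' (Suc k, Suc i)" "m' (Suc k, i) < m' (Suc k, Suc i)"
      by (simp_all add: lpar_def rpar_def)
  qed
  have p: "m \<in> patterns n" and nn: "pat_row n m \<in> nonneg_signatures n" using m by (simp_all add: nonneg_patterns_def)
  have top: "pat_row n m' = pat_row n m"
  proof -
    have "m' (n, i) = m (n, i)" for i using n by (intro off) (auto simp: tri_def)
    then show ?thesis by (simp add: pat_row_def)
  qed
  have ext: "m' \<in> tri n \<rightarrow>\<^sub>E UNIV"
  proof -
    have "m' p = undefined" if "p \<notin> tri n" for p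
    proof -
      have "p \<notin> tri (n - 1)" using that by (auto simp: tri_def)
      moreover have "m p = undefined" using p that PiE_arb[of m "tri n" "\<lambda>_. UNIV" p] by (simp add: patterns_def)
      ultimately show ?thesis using off[of p] by simp
    qed
    then show ?thesis by (auto simp: PiE_def extensional_def)
  qed
  have rows: "pat_row k m' \<in> signatures k" if k: "k \<in> {1..n}" for k
  proof -
    have "m' (k, i) < m' (k, Suc i)" if "1 \<le> i" "i < k" for i
    proof -
      obtain k' where k': "k = Suc k'" using k by (cases k) auto
      show ?thesis unfolding k' using at(3)[of i k'] that k k' by simp
    qed
    then have "strict_mono_on {1..k} (\<lambda>i. m' (k, i))" by (rule strict_mono_on_consecutive)
    then have "strict_mono_on {1..k} (pat_row k m')"
      unfolding pat_row_def by (auto simp: strict_mono_on_def)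
    then show ?thesis unfolding signatures_def by (auto simp: pat_row_def)
  qed
  have "interlaces (k + 1) (pat_row k m') (pat_row (k + 1) m')" if "k \<in> {1..<n}" for k
    using at(1,2)[of _ k] that by (auto simp: interlaces_def pat_row_def)
  then have "m' \<in> patterns n" unfolding patterns_def using ext rows by blast
  then show "m' \<in> {m' \<in> nonneg_patterns n. pat_row n m' = pat_row n m}"
    unfolding nonneg_patterns_def using top nn by simp
qed

text \<open>By the product form of the weights, conditioning on the top row replaces a function by the
  ratio of two nested averages, because the constant from the top row and the norming cancel.\<close>

theorem gibbs_average:
  assumes n: "1 \<le> n" and w: "\<And>t. t \<in> {1..6} \<Longrightarrow> w t > 0"
    and supp: "set_pmf \<rho> \<subseteq> nonneg_patterns n" and gibbs: "six_vertex_gibbs n w \<rho>" and b: "b > 0"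
  defines "avg \<equiv> \<lambda>F m. nest (lat_fac n (left_wt w) (right_wt w) b) (lat_step (left_wt w) (right_wt w)) (tri_list (n - 1)) F m"
  shows "(\<integral>\<^sup>+m. F m \<partial>measure_pmf \<rho>) = (\<integral>\<^sup>+m. avg F m / avg (\<lambda>_. 1) m \<partial>measure_pmf \<rho>)"
proof -
  let ?r = "left_wt w" and ?s = "right_wt w" and ?L = "tri_list (n - 1)"
  have rs: "?r > 0" "?s > 0" using w by (auto simp: left_wt_def right_wt_def)
  let ?R = "\<lambda>m m'. pat_row n m = pat_row n m'"
  have cond: "(\<integral>\<^sup>+m'. F m' \<partial>measure_pmf (cond_pmf \<rho> {m'. ?R m m'})) = avg F m / avg (\<lambda>_. 1) m"
    if m: "m \<in> set_pmf \<rho>" for m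
  proof -
    have mn: "m \<in> nonneg_patterns n" using m supp by blast
    let ?A = "{m'. ?R m m'}"
    let ?E = "fillings ?L m"
    have E: "?E = {m' \<in> nonneg_patterns n. pat_row n m' = pat_row n m}" by (rule fillings_patterns[OF n mn])
    have finE: "finite ?E" by (rule lat_sum_fillings(1)[OF rs row_order_tri_list])
    from six_vertex_gibbs_pmf[OF n w supp gibbs]
    obtain c where c: "c \<ge> 0" "\<And>m'. m' \<in> nonneg_patterns n \<Longrightarrow> pat_row n m' = pat_row n m \<Longrightarrow>
      pmf \<rho> m' = c * (\<Prod>q\<in>tri (n - 1). site_weight ?r ?s m' q)" by metis
    have int: "(\<integral>\<^sup>+m'. G m' * indicator ?A m' \<partial>measure_pmf \<rho>) = ennreal c * lat_norm n ?r ?s b ?L m * avg G m" for G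
    proof -
      have "(\<integral>\<^sup>+m'. G m' * indicator ?A m' \<partial>measure_pmf \<rho>) = (\<Sum>m'\<in>?E. (G m' * indicator ?A m') * pmf \<rho> m')"
      proof (rule nn_integral_measure_pmf_support[OF finE])
        fix m' assume "m' \<in> set_pmf \<rho>" "m' \<notin> ?E"
        then have "m' \<notin> ?A" using supp unfolding E by auto
        then show "G m' * indicator ?A m' = 0" by simp
      qed simp
      also have "\<dots> = (\<Sum>m'\<in>?E. ennreal c * (ennreal (\<Prod>q\<in>set ?L. site_weight ?r ?s m' q) * G m'))"
      proof (rule sum.cong[OF refl])
        fix m' assume "m' \<in> ?E"
        then have "m' \<in> nonneg_patterns n" "pat_row n m' = pat_row n m" unfolding E by auto
        then have "m' \<in> ?A" "ennreal (pmf \<rho> m') = ennreal c * ennreal (\<Prod>q\<in>set ?L. site_weight ?r ?s m' q)"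
          using c unfolding set_tri_list by (auto simp: ennreal_mult')
        then show "(G m' * indicator ?A m') * pmf \<rho> m' = ennreal c * (ennreal (\<Prod>q\<in>set ?L. site_weight ?r ?s m' q) * G m')"
          by (simp add: mult_ac)
      qed
      also have "\<dots> = ennreal c * lat_sum ?r ?s ?L G m"
        unfolding lat_sum_fillings(2)[OF rs row_order_tri_list] by (rule sum_distrib_left[symmetric])
      also have "lat_sum ?r ?s ?L G m = lat_norm n ?r ?s b ?L m * avg G m"
        unfolding avg_def using n
        by (intro lat_nest_eq_sum[symmetric] rs b) (auto simp: set_tri_list tri_def)
      finally show ?thesis by (simp only: mult.assoc)
    qed
    define C where "C = ennreal c * lat_norm n ?r ?s b ?L m"
    have A: "emeasure (measure_pmf \<rho>) ?A = C * avg (\<lambda>_. 1) m"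
      using int[of "\<lambda>_. 1"] unfolding C_def by simp
    have ne: "set_pmf \<rho> \<inter> ?A \<noteq> {}" using m by auto
    then have "emeasure (measure_pmf \<rho>) ?A \<noteq> 0" by (simp add: emeasure_measure_pmf_not_zero)
    then have C0: "C \<noteq> 0" unfolding A by auto
    have "C \<noteq> \<infinity>"
    proof -
      have "(\<Prod>q\<leftarrow>qs. f q) < (\<top>::ennreal)" if "\<And>q. f q < \<top>" for qs and f :: "nat \<times> nat \<Rightarrow> ennreal"
        using that by (induction qs) (simp_all add: ennreal_mult_less_top)
      then have "lat_norm n ?r ?s b ?L m < \<top>" unfolding lat_norm_def by simp
      then show ?thesis unfolding C_def by (simp add: ennreal_mult_eq_top_iff)
    qed
    have "(\<integral>\<^sup>+m'. F m' \<partial>measure_pmf (cond_pmf \<rho> ?A)) = (\<integral>\<^sup>+m'. F m' * indicator ?A m' \<partial>measure_pmf \<rho>) / emeasure (measure_pmf \<rho>) ?A"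
      unfolding cond_pmf.rep_eq[OF ne] by (rule nn_integral_uniform_measure) simp_all
    also have "\<dots> = (avg F m * C) / (avg (\<lambda>_. 1) m * C)"
      unfolding int A C_def by (simp only: mult_ac)
    also have "\<dots> = avg F m / avg (\<lambda>_. 1) m" by (rule divide_mult_eq[OF C0 \<open>C \<noteq> \<infinity>\<close>])
    finally show ?thesis .
  qed
  \<comment> \<open>Averaging the conditional laws given the top row returns the law itself.\<close>
  have "bind_pmf \<rho> (\<lambda>m. cond_pmf \<rho> {m'. ?R m m'}) = \<rho>"
  proof (rule bind_cond_pmf_cancel)
    show "set_pmf \<rho> \<inter> {m'. ?R m m'} \<noteq> {}" if "m \<in> set_pmf \<rho>" for m using that by auto
    show "set_pmf \<rho> \<inter> {m. ?R m m'} \<noteq> {}" if "m' \<in> set_pmf \<rho>" for m' using that by auto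
    show "measure \<rho> {m''. ?R m m''} = measure \<rho> {m''. ?R m'' m'}" if "?R m m'" for m m'
      using that by (intro arg_cong[where f = "measure \<rho>"]) auto
  qed
  then have "(\<integral>\<^sup>+m. F m \<partial>measure_pmf \<rho>) = (\<integral>\<^sup>+m. F m \<partial>measure_pmf (bind_pmf \<rho> (\<lambda>m. cond_pmf \<rho> {m'. ?R m m'})))" by simp
  also have "\<dots> = (\<integral>\<^sup>+m. (\<integral>\<^sup>+m'. F m' \<partial>measure_pmf (cond_pmf \<rho> {m'. ?R m m'})) \<partial>measure_pmf \<rho>)"
    by (rule nn_integral_bind_pmf)
  also have "\<dots> = (\<integral>\<^sup>+m. avg F m / avg (\<lambda>_. 1) m \<partial>measure_pmf \<rho>)"
    by (rule nn_integral_cong_AE) (simp add: AE_measure_pmf_iff cond)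
  finally show ?thesis .
qed


section \<open>Weak convergence and varying test functions\<close>


definition coord_dist :: "'p set \<Rightarrow> ('p \<Rightarrow> real) \<Rightarrow> ('p \<Rightarrow> real) \<Rightarrow> real" where
  "coord_dist I x y = (\<Sum>p\<in>I. \<bar>x p - y p\<bar>)"

lemma coord_dist_nonneg: "0 \<le> coord_dist I x y"
  unfolding coord_dist_def by (intro sum_nonneg) simp

lemma coord_dist_self [simp]: "coord_dist I x x = 0"
  unfolding coord_dist_def by simp

lemma coord_dist_commute: "coord_dist I x y = coord_dist I y x"
  unfolding coord_dist_def by (intro sum.cong refl abs_minus_commute)

lemma coord_dist_triangle: "coord_dist I x z \<le> coord_dist I x y + coord_dist I y z"
  unfolding coord_dist_def sum.distrib[symmetric] by (intro sum_mono) linarith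

lemma continuous_map_lipschitz:
  assumes I: "finite I" and lip: "\<And>x y. f x - f y \<le> L * coord_dist I x y"
  shows "continuous_map (powertop_real I) euclideanreal f"
  unfolding continuous_map_atin
proof
  fix x assume x: "x \<in> topspace (powertop_real I)"
  have "continuous_map (powertop_real I) euclideanreal (\<lambda>y. L * coord_dist I x y)"
    unfolding coord_dist_def
    by (intro continuous_map_real_mult continuous_map_sum continuous_map_real_abs continuous_map_diff
        continuous_map_product_projection continuous_map_canonical_const I)
  then have "limitin euclideanreal (\<lambda>y. L * coord_dist I x y) (L * coord_dist I x x) (atin (powertop_real I) x)"
    using x unfolding continuous_map_atin by blast
  then have lim: "((\<lambda>y. L * coord_dist I x y) \<longlongrightarrow> 0) (atin (powertop_real I) x)"
    by simp
  have "((\<lambda>y. f y - f x) \<longlongrightarrow> 0) (atin (powertop_real I) x)"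
  proof (rule Lim_null_comparison[OF always_eventually lim], rule allI)
    fix y show "norm (f y - f x) \<le> L * coord_dist I x y"
      using lip[of x y] lip[of y x] coord_dist_commute[of I x y] by (simp add: abs_le_iff)
  qed
  then have "(f \<longlongrightarrow> f x) (atin (powertop_real I) x)" by (rule LIM_zero_cancel)
  then show "limitin euclideanreal f (f x) (atin (powertop_real I) x)" by simp
qed

text \<open>On the space of all functions on a countable set the product sigma-algebra is the Borel
  sigma-algebra of the product topology; precomposition with the restriction to \<open>I\<close> reduces to it.\<close>

lemma continuous_map_coord_measurable:
  fixes f :: "('p::countable \<Rightarrow> real) \<Rightarrow> real"
  assumes "continuous_map (powertop_real I) euclideanreal f"
  shows "f \<in> borel_measurable (coord_space I)"
proof -
  let ?g = "\<lambda>y. f (restrict y I)"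
  have "continuous_map (powertop_real UNIV) (powertop_real I) (\<lambda>y. restrict y I)"
    unfolding continuous_map_componentwise
  proof (intro conjI ballI)
    show "(\<lambda>y. restrict y I) ` topspace (powertop_real UNIV) \<subseteq> extensional I"
      by (intro image_subsetI restrict_extensional)
    fix p assume "p \<in> I"
    then have e: "(\<lambda>y :: 'p \<Rightarrow> real. restrict y I p) = (\<lambda>y. y p)" by (intro ext restrict_apply')
    show "continuous_map (powertop_real UNIV) euclideanreal (\<lambda>y. restrict y I p)"
      unfolding e by (rule continuous_map_product_projection[OF UNIV_I])
  qed
  from continuous_map_compose[OF this assms] have "continuous_map (powertop_real UNIV) euclideanreal ?g"
    unfolding o_def .
  then have "continuous_on UNIV ?g" unfolding euclidean_product_topology continuous_map_iff_continuous2 .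
  then have "?g \<in> borel_measurable borel" by (rule borel_measurable_continuous_onI)
  then have g: "?g \<in> borel_measurable (PiM UNIV (\<lambda>_. borel))"
    using measurable_cong_sets[OF sets_PiM_equal_borel refl] by blast
  have e: "(\<lambda>y p. if p \<in> I then y p else 0) \<in> coord_space I \<rightarrow>\<^sub>M PiM UNIV (\<lambda>_. borel :: real measure)"
  proof (rule measurable_PiM_single')
    fix p :: 'p
    show "(\<lambda>y. if p \<in> I then y p else 0) \<in> borel_measurable (coord_space I)"
      by (cases "p \<in> I") (simp_all add: measurable_component_singleton)
  qed simp
  have "f y = ?g (\<lambda>p. if p \<in> I then y p else 0)" if "y \<in> space (coord_space I)" for y
  proof -
    have "restrict (\<lambda>p. if p \<in> I then y p else 0) I = y"
      using that by (auto simp: space_PiM PiE_iff extensional_def fun_eq_iff)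
    then show ?thesis by simp
  qed
  then show ?thesis using measurable_compose[OF e g] by (simp cong: measurable_cong)
qed

text \<open>The least function with Lipschitz constant \<open>N\<close> that is nonnegative and dominates \<open>h k m\<close> at the
  point \<open>x k m\<close> for all \<open>k \<ge> N\<close>.\<close>

definition upper_env :: "'p set \<Rightarrow> (nat \<Rightarrow> 'm \<Rightarrow> 'p \<Rightarrow> real) \<Rightarrow> (nat \<Rightarrow> 'm \<Rightarrow> real) \<Rightarrow> nat \<Rightarrow> ('p \<Rightarrow> real) \<Rightarrow> real" where
  "upper_env I x h N y = Sup (insert 0 {h k m - real N * coord_dist I y (x k m) | k m. N \<le> k})"

context
  fixes I :: "'p set" and x :: "nat \<Rightarrow> 'm \<Rightarrow> 'p \<Rightarrow> real" and h :: "nat \<Rightarrow> 'm \<Rightarrow> real" and C :: real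
  assumes C: "0 \<le> C" and hC: "\<And>k m. h k m \<le> C"
begin

lemma upper_env_upper:
  assumes "N \<le> k" shows "h k m - real N * coord_dist I y (x k m) \<le> upper_env I x h N y"
  unfolding upper_env_def
proof (rule cSup_upper)
  show "bdd_above (insert 0 {h k m - real N * coord_dist I y (x k m) | k m. N \<le> k})"
  proof (rule bdd_aboveI[of _ C])
    fix z assume "z \<in> insert 0 {h k m - real N * coord_dist I y (x k m) | k m. N \<le> k}"
    then show "z \<le> C"
    proof
      assume "z \<in> {h k m - real N * coord_dist I y (x k m) | k m. N \<le> k}"
      then obtain k m where "z = h k m - real N * coord_dist I y (x k m)" by blast
      moreover have "0 \<le> real N * coord_dist I y (x k m)" by (simp add: coord_dist_nonneg)
      ultimately show ?thesis using hC[of k m] by linarith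
    qed (use C in simp)
  qed
qed (use assms in blast)

lemma upper_env_least:
  assumes "0 \<le> z" "\<And>k m. N \<le> k \<Longrightarrow> h k m - real N * coord_dist I y (x k m) \<le> z"
  shows "upper_env I x h N y \<le> z"
  unfolding upper_env_def by (rule cSup_least) (use assms in auto)

lemma upper_env_bounds: "0 \<le> upper_env I x h N y" "upper_env I x h N y \<le> C"
proof -
  show "upper_env I x h N y \<le> C"
  proof (rule upper_env_least[OF C])
    fix k m
    have "0 \<le> real N * coord_dist I y (x k m)" by (simp add: coord_dist_nonneg)
    then show "h k m - real N * coord_dist I y (x k m) \<le> C" using hC[of k m] by linarith
  qed
  have "bdd_above (insert 0 {h k m - real N * coord_dist I y (x k m) | k m. N \<le> k})"
  proof (rule bdd_aboveI[of _ C])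
    fix z assume "z \<in> insert 0 {h k m - real N * coord_dist I y (x k m) | k m. N \<le> k}"
    then show "z \<le> C"
    proof
      assume "z \<in> {h k m - real N * coord_dist I y (x k m) | k m. N \<le> k}"
      then obtain k m where "z = h k m - real N * coord_dist I y (x k m)" by blast
      moreover have "0 \<le> real N * coord_dist I y (x k m)" by (simp add: coord_dist_nonneg)
      ultimately show ?thesis using hC[of k m] by linarith
    qed (use C in simp)
  qed
  then show "0 \<le> upper_env I x h N y" unfolding upper_env_def by (intro cSup_upper) auto
qed

lemma upper_env_lipschitz: "upper_env I x h N y - upper_env I x h N y' \<le> real N * coord_dist I y y'"
proof -
  have "upper_env I x h N y \<le> upper_env I x h N y' + real N * coord_dist I y y'"
  proof (rule upper_env_least)
    show "0 \<le> upper_env I x h N y' + real N * coord_dist I y y'"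
      using upper_env_bounds(1)[of N y'] by (simp add: coord_dist_nonneg)
    fix k m assume "N \<le> k"
    from upper_env_upper[OF this, of m y']
    have "h k m - real N * coord_dist I y' (x k m) \<le> upper_env I x h N y'" .
    moreover have "real N * coord_dist I y' (x k m) \<le> real N * (coord_dist I y y' + coord_dist I y (x k m))"
      using coord_dist_triangle[of I y' "x k m" y] by (intro mult_left_mono) (simp_all add: coord_dist_commute[of I y' y])
    ultimately show "h k m - real N * coord_dist I y (x k m) \<le> upper_env I x h N y' + real N * coord_dist I y y'"
      by (simp add: distrib_left)
  qed
  then show ?thesis by simp
qed

end

text \<open>The functions \<open>h k\<close> live on varying discrete sets and need not extend continuously. Their
  Lipschitz envelopes are continuous, so weak convergence applies to each of them, and by the local
  bound the envelopes decrease below \<open>H\<close> up to any positive error as \<open>N\<close> grows.\<close>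

theorem extended_mapping_upper:
  fixes x :: "nat \<Rightarrow> 'm \<Rightarrow> 'p::countable \<Rightarrow> real" and \<rho> :: "nat \<Rightarrow> 'm pmf"
    and h :: "nat \<Rightarrow> 'm \<Rightarrow> real" and H :: "('p \<Rightarrow> real) \<Rightarrow> real"
  assumes I: "finite I" and \<mu>: "prob_space \<mu>" "sets \<mu> = sets (coord_space I)"
    and weak: "\<And>f. continuous_map (powertop_real I) euclideanreal f \<Longrightarrow> bounded (f ` (I \<rightarrow>\<^sub>E UNIV)) \<Longrightarrow>
        (\<lambda>k. \<integral>m. f (x k m) \<partial>measure_pmf (\<rho> k)) \<longlonglongrightarrow> (\<integral>y. f y \<partial>\<mu>)"
    and h: "\<And>k m. 0 \<le> h k m \<and> h k m \<le> C"
    and H: "H \<in> borel_measurable \<mu>" "\<And>y. 0 \<le> H y \<and> H y \<le> C"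
    and lim: "AE y in \<mu>. \<forall>\<epsilon>>0. \<exists>\<delta>>0. \<exists>K. \<forall>k\<ge>K. \<forall>m. coord_dist I y (x k m) < \<delta> \<longrightarrow> h k m \<le> H y + \<epsilon>"
    and eps: "\<epsilon> > 0"
  shows "\<forall>\<^sub>F k in sequentially. (\<integral>m. h k m \<partial>measure_pmf (\<rho> k)) \<le> (\<integral>y. H y \<partial>\<mu>) + \<epsilon>"
proof -
  interpret prob_space \<mu> by fact
  have C: "0 \<le> C" by (rule order_trans[OF conjunct1[OF h[of 0 undefined]] conjunct2[OF h[of 0 undefined]]])
  have hC: "h k m \<le> C" for k m using h by blast
  let ?\<phi> = "upper_env I x h"
  note env_bounds = upper_env_bounds[where h = h and C = C and I = I and x = x, OF C hC]
    and env_upper = upper_env_upper[where h = h and C = C and I = I and x = x, OF C hC]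
    and env_least = upper_env_least[where h = h and C = C and I = I and x = x, OF C hC]
    and env_lip = upper_env_lipschitz[where h = h and C = C and I = I and x = x, OF C hC]
  have cont: "continuous_map (powertop_real I) euclideanreal (?\<phi> N)" for N
    by (rule continuous_map_lipschitz[OF I env_lip])
  have meas: "?\<phi> N \<in> borel_measurable \<mu>" for N
    using continuous_map_coord_measurable[OF cont] measurable_cong_sets[OF \<mu>(2) refl] by blast
  have small: "\<exists>N0. \<forall>N\<ge>N0. ?\<phi> N y \<le> H y + \<eta>"
    if y: "\<forall>\<epsilon>>0. \<exists>\<delta>>0. \<exists>K. \<forall>k\<ge>K. \<forall>m. coord_dist I y (x k m) < \<delta> \<longrightarrow> h k m \<le> H y + \<epsilon>" and "\<eta> > 0" for y \<eta>
  proof -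
    obtain \<delta> K where d: "\<delta> > 0" and K: "\<And>k m. k \<ge> K \<Longrightarrow> coord_dist I y (x k m) < \<delta> \<Longrightarrow> h k m \<le> H y + \<eta>"
      using y \<open>\<eta> > 0\<close> by meson
    obtain N1 :: nat where N1: "C / \<delta> \<le> real N1" using real_arch_simple by blast
    show ?thesis
    proof (intro exI allI impI)
      fix N assume N: "max K N1 \<le> N"
      show "?\<phi> N y \<le> H y + \<eta>"
      proof (rule env_least)
        show "0 \<le> H y + \<eta>" using H(2)[of y] \<open>\<eta> > 0\<close> by linarith
        fix k m assume k: "N \<le> k"
        show "h k m - real N * coord_dist I y (x k m) \<le> H y + \<eta>"
        proof (cases "coord_dist I y (x k m) < \<delta>")
          case True
          have "0 \<le> real N * coord_dist I y (x k m)" by (simp add: coord_dist_nonneg)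
          then show ?thesis using K[of k m] True k N by linarith
        next
          case False
          have "C \<le> real N1 * \<delta>" using N1 d by (simp add: pos_divide_le_eq)
          also have "\<dots> \<le> real N * coord_dist I y (x k m)"
            using N False d by (intro mult_mono) auto
          finally show ?thesis using hC[of k m] H(2)[of y] \<open>\<eta> > 0\<close> by linarith
        qed
      qed
    qed
  qed
  \<comment> \<open>The maximum with \<open>H\<close> converges to \<open>H\<close>, so no lower bound on the envelopes is needed.\<close>
  let ?\<psi> = "\<lambda>N y. max (?\<phi> N y) (H y)"
  have \<psi>C: "norm (?\<psi> N y) \<le> C" for N y
  proof -
    have "0 \<le> ?\<psi> N y" by (rule max.coboundedI1[OF env_bounds(1)])
    moreover have "?\<psi> N y \<le> C" by (rule max.boundedI[OF env_bounds(2) conjunct2[OF H(2)]])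
    ultimately show ?thesis unfolding real_norm_def by (simp only: abs_of_nonneg)
  qed
  have "(\<lambda>N. \<integral>y. ?\<psi> N y \<partial>\<mu>) \<longlonglongrightarrow> (\<integral>y. H y \<partial>\<mu>)"
  proof (rule integral_dominated_convergence[where w = "\<lambda>_. C"])
    show "AE y in \<mu>. (\<lambda>N. ?\<psi> N y) \<longlonglongrightarrow> H y"
      using lim
    proof eventually_elim
      case (elim y)
      show ?case
      proof (rule LIMSEQ_I)
        fix r :: real assume "r > 0"
        then obtain N0 where N0: "\<And>N. N \<ge> N0 \<Longrightarrow> ?\<phi> N y \<le> H y + r / 2" using small[OF elim, of "r / 2"] by auto
        have "norm (?\<psi> N y - H y) < r" if "N \<ge> N0" for N using N0[OF that] \<open>r > 0\<close> by (simp add: max_def)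
        then show "\<exists>N0. \<forall>N\<ge>N0. norm (?\<psi> N y - H y) < r" by blast
      qed
    qed
    show "AE y in \<mu>. norm (?\<psi> N y) \<le> C" for N
by (intro AE_I2 \<psi>C)
    show "(\<lambda>y. ?\<psi> N y) \<in> borel_measurable \<mu>" for N by (intro borel_measurable_max meas H(1))
    show "H \<in> borel_measurable \<mu>" by (rule H(1))
    show "integrable \<mu> (\<lambda>_. C)" by simp
  qed
  then have "\<forall>\<^sub>F N in sequentially. (\<integral>y. ?\<psi> N y \<partial>\<mu>) < (\<integral>y. H y \<partial>\<mu>) + \<epsilon> / 2"
    by (rule order_tendstoD) (use eps in simp)
  then obtain N where N: "(\<integral>y. ?\<psi> N y \<partial>\<mu>) < (\<integral>y. H y \<partial>\<mu>) + \<epsilon> / 2"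
    by (auto simp: eventually_sequentially)
  have bd: "norm (?\<phi> N y) \<le> C" for y using env_bounds[of N y] by simp
  have int\<mu>: "integrable \<mu> (?\<phi> N)" "integrable \<mu> (?\<psi> N)"
  proof -
    show "integrable \<mu> (?\<phi> N)" using bd by (intro integrable_const_bound[of _ C] AE_I2 meas)
    show "integrable \<mu> (?\<psi> N)"
      by (intro integrable_const_bound[of _ C] AE_I2 \<psi>C borel_measurable_max meas H(1))
  qed
  have "(\<integral>y. ?\<phi> N y \<partial>\<mu>) \<le> (\<integral>y. ?\<psi> N y \<partial>\<mu>)"
    by (rule integral_mono[OF int\<mu>]) simp
  with N have lt: "(\<integral>y. ?\<phi> N y \<partial>\<mu>) < (\<integral>y. H y \<partial>\<mu>) + \<epsilon>" using eps by linarith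
  have "bounded (?\<phi> N ` (I \<rightarrow>\<^sub>E UNIV))" using bd by (auto simp: bounded_iff)
  from order_tendstoD(2)[OF weak[OF cont this] lt]
  have "\<forall>\<^sub>F k in sequentially. (\<integral>m. ?\<phi> N (x k m) \<partial>measure_pmf (\<rho> k)) < (\<integral>y. H y \<partial>\<mu>) + \<epsilon>" .
  with eventually_ge_at_top[of N] show ?thesis
  proof eventually_elim
    case (elim k)
    have "(\<integral>m. h k m \<partial>measure_pmf (\<rho> k)) \<le> (\<integral>m. ?\<phi> N (x k m) \<partial>measure_pmf (\<rho> k))"
    proof (rule integral_mono)
      show "integrable (measure_pmf (\<rho> k)) (h k)"
        using h by (intro measure_pmf.integrable_const_bound[of _ C]) auto
      show "integrable (measure_pmf (\<rho> k)) (\<lambda>m. ?\<phi> N (x k m))"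
        using bd by (intro measure_pmf.integrable_const_bound[of _ C]) auto
      fix m show "h k m \<le> ?\<phi> N (x k m)" using env_upper[OF elim(1), of m "x k m"] by simp
    qed
    then show ?case using elim(2) by linarith
  qed
qed


section \<open>Nested averages as Lebesgue integrals\<close>


fun iter_int :: "'p list \<Rightarrow> (('p \<Rightarrow> real) \<Rightarrow> ennreal) \<Rightarrow> ('p \<Rightarrow> real) \<Rightarrow> ennreal" where
  "iter_int [] G y = G y"
| "iter_int (q # qs) G y = (\<integral>\<^sup>+s. iter_int qs G (y(q := s)) \<partial>lborel)"

text \<open>The list is read from its end, so that the first entry of the list gets the coordinate with the
  highest index; this matches the rule that integrates out the newest coordinate of a product first.\<close>

fun overlay :: "('p \<Rightarrow> real) \<Rightarrow> 'p list \<Rightarrow> (nat \<Rightarrow> real) \<Rightarrow> 'p \<Rightarrow> real" where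
  "overlay y [] t = y"
| "overlay y (q # rs) t = (overlay y rs t)(q := t (length rs))"

lemma iter_int_snoc: "iter_int (qs @ [q]) G y = iter_int qs (\<lambda>z. \<integral>\<^sup>+s. G (z(q := s)) \<partial>lborel) y"
  by (induction qs arbitrary: y) simp_all

lemma iter_int_cong:
  assumes "\<And>z. (\<And>p. p \<notin> set qs \<Longrightarrow> z p = y p) \<Longrightarrow> G z = G' z"
  shows "iter_int qs G y = iter_int qs G' y"
  using assms
proof (induction qs arbitrary: y)
  case Nil
  then show ?case by simp
next
  case (Cons q qs)
  have "iter_int qs G (y(q := s)) = iter_int qs G' (y(q := s))" for s
  proof (rule Cons.IH)
    fix z assume z: "\<And>p. p \<notin> set qs \<Longrightarrow> z p = (y(q := s)) p"
    show "G z = G' z"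
    proof (rule Cons.prems)
      fix p assume "p \<notin> set (q # qs)"
      then show "z p = y p" using z[of p] by simp
    qed
  qed
  then show ?case by simp
qed

lemma iter_int_zero: "iter_int qs (\<lambda>_. 0) y = 0"
  by (induction qs arbitrary: y) simp_all

lemma overlay_cong: "(\<And>j. j < length rs \<Longrightarrow> t j = t' j) \<Longrightarrow> overlay y rs t = overlay y rs t'"
  by (induction rs) simp_all

lemma measurable_overlay:
  assumes "set rs \<subseteq> I" "y \<in> space (coord_space I)" "length rs \<le> d"
  shows "overlay y rs \<in> PiM {..<d} (\<lambda>_. lborel) \<rightarrow>\<^sub>M coord_space I"
  using assms
proof (induction rs)
  case Nil
  have "overlay y [] = (\<lambda>_. y)" by auto
  then show ?case using Nil.prems(2) by simp
next
  case (Cons q rs)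
  have e: "overlay y (q # rs) = (\<lambda>t. (overlay y rs t)(q := t (length rs)))" by auto
  show ?case unfolding e
  proof (rule measurable_fun_upd)
    show "I = I \<union> {q}" using Cons.prems by auto
    show "overlay y rs \<in> PiM {..<d} (\<lambda>_. lborel) \<rightarrow>\<^sub>M coord_space I" using Cons by simp
    have "(\<lambda>t. t (length rs)) \<in> PiM {..<d} (\<lambda>_. lborel) \<rightarrow>\<^sub>M (lborel :: real measure)"
      using Cons.prems by (intro measurable_component_singleton) simp
    then show "(\<lambda>t. t (length rs)) \<in> PiM {..<d} (\<lambda>_. lborel) \<rightarrow>\<^sub>M (borel :: real measure)" by simp
  qed
qed

lemma measurable_update_coord:
  assumes "q \<in> I" shows "(\<lambda>x. (fst x)(q := snd x)) \<in> coord_space I \<Otimes>\<^sub>M lborel \<rightarrow>\<^sub>M coord_space I"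
proof (rule measurable_fun_upd)
  show "I = I \<union> {q}" using assms by auto
  show "fst \<in> coord_space I \<Otimes>\<^sub>M lborel \<rightarrow>\<^sub>M coord_space I" by (rule measurable_fst)
  show "snd \<in> borel_measurable (coord_space I \<Otimes>\<^sub>M lborel)" using measurable_snd[of "coord_space I" lborel] by simp
qed

lemma nn_integral_overlay:
  assumes "G \<in> borel_measurable (coord_space I)" "set rs \<subseteq> I" "y \<in> space (coord_space I)"
  shows "(\<integral>\<^sup>+t. G (overlay y rs t) \<partial>PiM {..<length rs} (\<lambda>_. lborel)) = iter_int (rev rs) G y"
  using assms
proof (induction rs arbitrary: G)
  case Nil
  interpret product_sigma_finite "\<lambda>_::nat. lborel :: real measure" by unfold_locales
  show ?case by (simp add: PiM_empty)
next
  case (Cons q rs)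
  interpret product_sigma_finite "\<lambda>_::nat. lborel :: real measure" by unfold_locales
  let ?d = "length rs"
  let ?G = "\<lambda>z. \<integral>\<^sup>+s. G (z(q := s)) \<partial>lborel"
  have q: "q \<in> I" using Cons.prems by simp
  have "(\<lambda>x. G ((fst x)(q := snd x))) \<in> borel_measurable (coord_space I \<Otimes>\<^sub>M lborel)"
    by (rule measurable_compose[OF measurable_update_coord[OF q] Cons.prems(1)])
  then have mG: "?G \<in> borel_measurable (coord_space I)"
    by (intro lborel.borel_measurable_nn_integral) (simp add: case_prod_beta)
  have ins: "{..<length (q # rs)} = insert ?d {..<?d}" by auto
  have m: "(\<lambda>t. G (overlay y (q # rs) t)) \<in> borel_measurable (PiM (insert ?d {..<?d}) (\<lambda>_. lborel))"
    using measurable_compose[OF measurable_overlay[OF Cons.prems(2,3) order_refl] Cons.prems(1)] unfolding ins .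
  have "(\<integral>\<^sup>+t. G (overlay y (q # rs) t) \<partial>PiM {..<length (q # rs)} (\<lambda>_. lborel))
    = (\<integral>\<^sup>+t. (\<integral>\<^sup>+s. G (overlay y (q # rs) (t(?d := s))) \<partial>lborel) \<partial>PiM {..<?d} (\<lambda>_. lborel))"
    unfolding ins by (rule product_nn_integral_insert[OF _ _ m]) simp_all
  also have "\<dots> = (\<integral>\<^sup>+t. ?G (overlay y rs t) \<partial>PiM {..<?d} (\<lambda>_. lborel))"
  proof (intro nn_integral_cong)
    fix t s
    have "overlay y rs (t(?d := s)) = overlay y rs t" by (rule overlay_cong) simp
    then show "G (overlay y (q # rs) (t(?d := s))) = G ((overlay y rs t)(q := s))" by simp
  qed
  also have "\<dots> = iter_int (rev rs) ?G y"
    by (rule Cons.IH[OF mG _ Cons.prems(3)]) (use Cons.prems(2) in simp)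
  also have "\<dots> = iter_int (rev (q # rs)) G y" by (simp add: iter_int_snoc)
  finally show ?case .
qed

lemma overlay_nth:
  assumes "distinct rs" "j < length rs" shows "overlay y rs t (rev rs ! j) = t j"
  using assms
proof (induction rs)
  case (Cons q rs)
  show ?case
  proof (cases "j = length rs")
    case True
    then show ?thesis by (simp add: nth_append)
  next
    case False
    then have j: "j < length rs" using Cons.prems by simp
    then have "rev (q # rs) ! j = rev rs ! j" by (simp add: nth_append)
    moreover have "rev rs ! j \<in> set rs" using j by (metis length_rev nth_mem set_rev)
    then have "rev rs ! j \<noteq> q" using Cons.prems by auto
    ultimately show ?thesis using Cons j by simp
  qed
qed simp

lemma overlay_off: "p \<notin> set rs \<Longrightarrow> overlay y rs t p = y p"
  by (induction rs) auto

text \<open>For \<open>r < l\<close> the left factor is zero by truncation and for \<open>r = l\<close> the interval is a null set, so no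
  order of the endpoints has to be assumed.\<close>

lemma nn_integral_unit_affine:
  fixes h :: "real \<Rightarrow> ennreal"
  assumes h: "h \<in> borel_measurable borel"
  shows "ennreal (r - l) * (\<integral>\<^sup>+t\<in>{0..1}. h (l + t * (r - l)) \<partial>lborel) = (\<integral>\<^sup>+s. h s * indicator {l..r} s \<partial>lborel)"
proof (cases "l < r")
  case True
  have "(\<integral>\<^sup>+s. h s * indicator {l..r} s \<partial>lborel)
     = ennreal \<bar>r - l\<bar> * (\<integral>\<^sup>+t. h (l + (r - l) * t) * indicator {l..r} (l + (r - l) * t) \<partial>lborel)"
    by (rule nn_integral_real_affine) (use h True in auto)
  moreover have "indicator {l..r} (l + (r - l) * t) = (indicator {0..1} t :: ennreal)" for t
  proof -
    have "l + (r - l) * t \<in> {l..r} \<longleftrightarrow> 0 \<le> (r - l) * t \<and> (r - l) * t \<le> (r - l) * 1" by auto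
    also have "\<dots> \<longleftrightarrow> t \<in> {0..1}" using True by (simp only: mult_le_cancel_left_pos zero_le_mult_iff atLeastAtMost_iff) auto
    finally show ?thesis by (auto simp: indicator_def)
  qed
  ultimately show ?thesis using True by (simp add: mult.commute)
next
  case False
  have "(\<integral>\<^sup>+s. h s * indicator {l..r} s \<partial>lborel) = (\<integral>\<^sup>+s. 0 \<partial>(lborel :: real measure))"
  proof (rule nn_integral_cong_AE)
    have "AE s in lborel. s \<noteq> l" by (rule AE_lborel_singleton)
    then show "AE s in lborel. h s * indicator {l..r} s = 0"
      by eventually_elim (use False in \<open>auto simp: indicator_def\<close>)
  qed
  then show ?thesis using False by (simp add: ennreal_neg)
qed



definition cell :: "(nat \<times> nat) list \<Rightarrow> (nat \<times> nat \<Rightarrow> real) \<Rightarrow> bool" where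
  "cell qs z \<longleftrightarrow> (\<forall>q\<in>set qs. z (lpar q) \<le> z q \<and> z q \<le> z (rpar q))"

definition tied :: "nat \<Rightarrow> (nat \<times> nat \<Rightarrow> real) \<Rightarrow> nat \<times> nat \<Rightarrow> bool" where
  "tied n y q \<longleftrightarrow> Suc (fst q) = n \<and> y (lpar q) = y (rpar q)"

text \<open>The interval lengths that \<open>gap_fac\<close> leaves out, with factor one for degenerate intervals.\<close>

definition gap_norm :: "nat \<Rightarrow> (nat \<times> nat \<Rightarrow> real) \<Rightarrow> (nat \<times> nat) list \<Rightarrow> ennreal" where
  "gap_norm n y qs = (\<Prod>q\<leftarrow>qs. if Suc (fst q) = n \<and> y (lpar q) \<noteq> y (rpar q) then ennreal (y (rpar q) - y (lpar q)) else 1)"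

lemma gap_norm_update:
  assumes "fst q < n" shows "gap_norm n (y(q := s)) qs = gap_norm n y qs" "tied n (y(q := s)) q' = tied n y q'"
proof -
  have par: "(y(q := s)) (lpar q') = y (lpar q')" "(y(q := s)) (rpar q') = y (rpar q')" if "Suc (fst q') = n" for q'
    using assms that by (auto simp: lpar_def rpar_def)
  show "tied n (y(q := s)) q' = tied n y q'" unfolding tied_def using par[of q'] by metis
  have "(if Suc (fst q') = n \<and> (y(q := s)) (lpar q') \<noteq> (y(q := s)) (rpar q') then ennreal ((y(q := s)) (rpar q') - (y(q := s)) (lpar q')) else 1)
     = (if Suc (fst q') = n \<and> y (lpar q') \<noteq> y (rpar q') then ennreal (y (rpar q') - y (lpar q')) else 1)" for q'
  proof (cases "Suc (fst q') = n")
    case True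
    show ?thesis unfolding par[OF True] ..
  qed (simp only: simp_thms if_False)
  then show "gap_norm n (y(q := s)) qs = gap_norm n y qs" unfolding gap_norm_def by (simp only:)
qed

lemma gap_nest_update_measurable:
  assumes F: "F \<in> borel_measurable (coord_space I)" and y: "y \<in> space (coord_space I)" and q: "q \<in> I"
    and qs: "\<And>q. q \<in> set qs \<Longrightarrow> q \<in> I \<and> lpar q \<in> I \<and> rpar q \<in> I"
  shows "(\<lambda>s. nest (gap_fac n) gap_step qs F (y(q := s))) \<in> borel_measurable borel"
proof -
  have "(\<lambda>s. y(q := s)) \<in> lborel \<rightarrow>\<^sub>M coord_space I"
    using measurable_compose[OF measurable_Pair1'[OF y, of lborel] measurable_update_coord[OF q]]
    by (simp only: fst_conv snd_conv)
  from measurable_compose[OF this nest_measurable[OF F qs]] show ?thesis by simp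
qed

text \<open>Substitution in each coordinate turns averages over the unit interval into integrals over the
  interlacing intervals. A coordinate tied between two equal top entries is constant and disappears
  from the list of integrations.\<close>

lemma gap_nest_eq_iter:
  assumes F: "F \<in> borel_measurable (coord_space (tri n))" and "row_order qs" "set qs \<subseteq> tri (n - 1)"
    and "y \<in> space (coord_space (tri n))"
    and "\<And>q. q \<in> set qs \<Longrightarrow> Suc (fst q) = n \<Longrightarrow> y (lpar q) \<le> y (rpar q) \<and> (y (lpar q) = y (rpar q) \<longrightarrow> y q = y (lpar q))"
  shows "nest (gap_fac n) gap_step qs F y * gap_norm n y qs
    = iter_int (filter (\<lambda>q. \<not> tied n y q) qs) (\<lambda>z. if cell qs z then F z else 0) y"
  using assms(2-)
proof (induction qs arbitrary: y)
  case Nil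
  then show ?case by (simp add: gap_norm_def cell_def)
next
  case (Cons q qs)
  note par = row_order_parents[OF Cons.prems(1)]
  have nq: "q \<notin> set qs" using Cons.prems(1) by (simp add: row_order_def)
  have sub: "q' \<in> tri n \<and> lpar q' \<in> tri n \<and> rpar q' \<in> tri n" if "q' \<in> set (q # qs)" for q'
    using Cons.prems(2) that by (auto simp: tri_def lpar_def rpar_def)
  have qn: "fst q < n" using Cons.prems(2) by (auto simp: tri_def)
  define l where "l = y (lpar q)"
  define r where "r = y (rpar q)"
  define W where "W = gap_norm n y qs"
  define js where "js = filter (\<lambda>q. \<not> tied n y q) qs"
  define g where "g s = nest (gap_fac n) gap_step qs F (y(q := s))" for s
  define R where "R s = iter_int js (\<lambda>z. if cell qs z then F z else 0) (y(q := s))" for s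
  have IH: "g s * W = R s" for s
  proof -
    have "nest (gap_fac n) gap_step qs F (y(q := s)) * gap_norm n (y(q := s)) qs
       = iter_int (filter (\<lambda>q'. \<not> tied n (y(q := s)) q') qs) (\<lambda>z. if cell qs z then F z else 0) (y(q := s))"
    proof (rule Cons.IH)
      show "row_order qs" by (rule row_order_Cons[OF Cons.prems(1)])
      show "set qs \<subseteq> tri (n - 1)" using Cons.prems(2) by simp
      show "y(q := s) \<in> space (coord_space (tri n))"
        using Cons.prems(3) sub[of q] by (auto simp: space_PiM PiE_iff extensional_def)
      fix q' assume q': "q' \<in> set qs" "Suc (fst q') = n"
      have "q' \<noteq> q" using nq q' by auto
      moreover have "lpar q' \<noteq> q" "rpar q' \<noteq> q" using q'(2) qn by (auto simp: lpar_def rpar_def)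
      ultimately show "(y(q := s)) (lpar q') \<le> (y(q := s)) (rpar q') \<and>
        ((y(q := s)) (lpar q') = (y(q := s)) (rpar q') \<longrightarrow> (y(q := s)) q' = (y(q := s)) (lpar q'))"
        using Cons.prems(4)[of q'] q' by simp
    qed
    then show ?thesis unfolding g_def R_def W_def js_def gap_norm_update[OF qn] .
  qed
  have key: "iter_int js (\<lambda>z. if cell (q # qs) z then F z else 0) (y(q := s)) = (if l \<le> s \<and> s \<le> r then R s else 0)" for s
  proof -
    have "iter_int js (\<lambda>z. if cell (q # qs) z then F z else 0) (y(q := s))
      = iter_int js (\<lambda>z. if l \<le> s \<and> s \<le> r then (if cell qs z then F z else 0) else 0) (y(q := s))"
    proof (rule iter_int_cong)
      fix z assume z: "\<And>p. p \<notin> set js \<Longrightarrow> z p = (y(q := s)) p"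
      have "z q = s" "z (lpar q) = l" "z (rpar q) = r"
        using z[of q] z[of "lpar q"] z[of "rpar q"] nq par by (auto simp: js_def l_def r_def)
      then have "cell (q # qs) z \<longleftrightarrow> (l \<le> s \<and> s \<le> r) \<and> cell qs z" by (simp add: cell_def)
      then show "(if cell (q # qs) z then F z else 0) = (if l \<le> s \<and> s \<le> r then (if cell qs z then F z else 0) else 0)"
        by (simp only: if_splits simp_thms split: if_split) blast
    qed
    then show ?thesis by (cases "l \<le> s \<and> s \<le> r") (simp_all only: R_def if_True if_False simp_thms iter_int_zero)
  qed
  show ?case
  proof (cases "tied n y q")
    case True
    then have lr: "l = r" "Suc (fst q) = n" by (simp_all add: tied_def l_def r_def)
    then have yq: "y q = l" using Cons.prems(4)[of q] by (simp add: l_def r_def)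
    have st: "y(q := gap_step q y t) = y(q := l)" for t unfolding gap_step_def l_def[symmetric] r_def[symmetric] lr(1) by simp
    have "nest (gap_fac n) gap_step (q # qs) F y = g l"
      unfolding nest.simps st g_def[symmetric] gap_fac_def using lr(2) by (simp add: nn_integral_cmult_indicator)
    moreover have "gap_norm n y (q # qs) = W" using lr by (simp add: gap_norm_def W_def l_def r_def)
    moreover have "filter (\<lambda>q. \<not> tied n y q) (q # qs) = js" using True by (simp add: js_def)
    moreover have "iter_int js (\<lambda>z. if cell (q # qs) z then F z else 0) y = R l"
      using key[of l] unfolding yq[symmetric] fun_upd_triv using lr yq by simp
    ultimately show ?thesis using IH[of l] by simp
  next
    case False
    define c where "c = ennreal (r - l)"
    have norm: "gap_fac n q y * gap_norm n y (q # qs) = c * W"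
      using False by (auto simp: gap_fac_def gap_norm_def tied_def c_def W_def l_def r_def)
    have gm: "g \<in> borel_measurable borel"
      using gap_nest_update_measurable[OF F Cons.prems(3), of q qs n] sub unfolding g_def[abs_def] by simp
    have Rm: "R \<in> borel_measurable borel"
    proof -
      have "(\<lambda>s. g s * W) \<in> borel_measurable borel" by (intro borel_measurable_times_ennreal gm) simp
      then show ?thesis by (simp only: IH)
    qed
    have ind: "(\<lambda>t. g (gap_step q y t) * indicator {0..1} t) \<in> borel_measurable lborel"
    proof -
      have "(\<lambda>t. gap_step q y t) \<in> borel_measurable borel" unfolding gap_step_def
        by (intro borel_measurable_continuous_onI continuous_intros)
      from measurable_compose[OF this gm] have "(\<lambda>t. g (gap_step q y t)) \<in> borel_measurable lborel" by simp
      then show ?thesis by (intro borel_measurable_times_ennreal) simp_all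
    qed
    have "nest (gap_fac n) gap_step (q # qs) F y * gap_norm n y (q # qs)
      = gap_fac n q y * (\<integral>\<^sup>+t\<in>{0..1}. g (gap_step q y t) \<partial>lborel) * gap_norm n y (q # qs)"
      unfolding nest.simps g_def ..
    also have "\<dots> = (gap_fac n q y * gap_norm n y (q # qs)) * (\<integral>\<^sup>+t\<in>{0..1}. g (gap_step q y t) \<partial>lborel)"
      by (simp only: mult_ac)
    also have "\<dots> = c * (W * (\<integral>\<^sup>+t\<in>{0..1}. g (gap_step q y t) \<partial>lborel))"
      unfolding norm by (simp only: mult.assoc)
    also have "W * (\<integral>\<^sup>+t\<in>{0..1}. g (gap_step q y t) \<partial>lborel) = (\<integral>\<^sup>+t. W * (g (gap_step q y t) * indicator {0..1} t) \<partial>lborel)"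
      by (rule nn_integral_cmult[symmetric, OF ind])
    also have "\<dots> = (\<integral>\<^sup>+t\<in>{0..1}. R (l + t * (r - l)) \<partial>lborel)"
    proof (rule nn_integral_cong)
      fix t
      have "gap_step q y t = l + t * (r - l)" by (simp add: gap_step_def l_def r_def)
      then show "W * (g (gap_step q y t) * indicator {0..1} t) = R (l + t * (r - l)) * indicator {0..1} t"
        unfolding IH[symmetric] by (simp only: mult_ac)
    qed
    also have "c * \<dots> = (\<integral>\<^sup>+s. R s * indicator {l..r} s \<partial>lborel)"
      unfolding c_def by (rule nn_integral_unit_affine[OF Rm])
    also have "\<dots> = (\<integral>\<^sup>+s. iter_int js (\<lambda>z. if cell (q # qs) z then F z else 0) (y(q := s)) \<partial>lborel)"
      by (rule nn_integral_cong) (simp add: key indicator_def)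
    also have "\<dots> = iter_int (filter (\<lambda>q. \<not> tied n y q) (q # qs)) (\<lambda>z. if cell (q # qs) z then F z else 0) y"
      using False by (simp add: js_def)
    finally show ?thesis .
  qed
qed


section \<open>Lebesgue measure on slices of the cone\<close>


definition top_embed :: "nat \<Rightarrow> (nat \<Rightarrow> real) \<Rightarrow> nat \<times> nat \<Rightarrow> real" where
  "top_embed n x = (\<lambda>p\<in>tri n. if fst p = n then x (snd p) else 0)"

text \<open>The forced coordinates of the polytope with top row \<open>x\<close>, completed by zero at the free ones.\<close>

definition base_point :: "nat \<Rightarrow> (nat \<Rightarrow> real) \<Rightarrow> nat \<times> nat \<Rightarrow> real" where
  "base_point n x = (\<lambda>p\<in>tri n. if fst p = n \<or> Suc (fst p) = n \<and> x (snd p) = x (Suc (snd p)) then x (snd p) else 0)"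

definition free_coords :: "nat \<Rightarrow> (nat \<Rightarrow> real) \<Rightarrow> (nat \<times> nat) list" where
  "free_coords n x = filter (\<lambda>q. \<not> tied n (base_point n x) q) (tri_list (n - 1))"

definition slice_measure :: "nat \<Rightarrow> (nat \<Rightarrow> real) \<Rightarrow> (nat \<times> nat \<Rightarrow> real) measure" where
  "slice_measure n x = distr (PiM {..<length (free_coords n x)} (\<lambda>_. lborel)) (coord_space (tri n))
     (overlay (base_point n x) (rev (free_coords n x)))"

lemma tri_sub: "q \<in> tri (n - 1) \<Longrightarrow> q \<in> tri n \<and> lpar q \<in> tri n \<and> rpar q \<in> tri n \<and> fst q < n"
  by (auto simp: tri_def lpar_def rpar_def)

lemma set_free: "set (free_coords n x) \<subseteq> tri (n - 1)" "set (free_coords n x) \<subseteq> tri n" "distinct (free_coords n x)"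
  using row_order_tri_list[of "n - 1"] tri_sub
  by (auto simp: free_coords_def set_tri_list row_order_def)

lemma base_space: "base_point n x \<in> space (coord_space (tri n))"
  by (simp add: base_point_def space_PiM)

lemma base_top: "i \<in> {1..n} \<Longrightarrow> base_point n x (n, i) = x i"
  by (auto simp: base_point_def tri_def)

lemma base_parents:
  assumes "q \<in> tri (n - 1)" "Suc (fst q) = n"
  shows "base_point n x (lpar q) = x (snd q)" "base_point n x (rpar q) = x (Suc (snd q))"
proof -
  have "snd q \<in> {1..n}" "Suc (snd q) \<in> {1..n}" using assms by (auto simp: tri_def)
  then show "base_point n x (lpar q) = x (snd q)" "base_point n x (rpar q) = x (Suc (snd q))"
    unfolding lpar_def rpar_def assms(2) using base_top by blast+
qed

lemma base_tied:
  assumes "q \<in> tri (n - 1)" "tied n (base_point n x) q"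
  shows "base_point n x q = base_point n x (lpar q)"
proof -
  have n: "Suc (fst q) = n" using assms by (simp add: tied_def)
  have "x (snd q) = x (Suc (snd q))" using assms(2) unfolding tied_def base_parents[OF assms(1) n] by simp
  then show ?thesis unfolding base_parents[OF assms(1) n] using n tri_sub[OF assms(1)] by (simp add: base_point_def)
qed

lemma base_free: "q \<in> set (free_coords n x) \<Longrightarrow> base_point n x q = 0"
proof -
  assume q: "q \<in> set (free_coords n x)"
  then have t: "q \<in> tri (n - 1)" "\<not> tied n (base_point n x) q" by (auto simp: free_coords_def set_tri_list)
  have "\<not> (Suc (fst q) = n \<and> x (snd q) = x (Suc (snd q)))"
  proof
    assume a: "Suc (fst q) = n \<and> x (snd q) = x (Suc (snd q))"
    then show False using t(2) base_parents[OF t(1), of x] by (simp add: tied_def)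
  qed
  moreover have "fst q \<noteq> n" using tri_sub[OF t(1)] by simp
  ultimately show ?thesis using tri_sub[OF t(1)] by (auto simp: base_point_def)
qed

lemma GT_cone_iff_cell: "z \<in> GT_cone n \<longleftrightarrow> z \<in> tri n \<rightarrow>\<^sub>E UNIV \<and> cell (tri_list (n - 1)) z"
proof -
  have "(\<forall>k\<in>{1..<n}. interlaces (k + 1) (pat_row k z) (pat_row (k + 1) z)) \<longleftrightarrow> cell (tri_list (n - 1)) z"
  proof
    assume L: "\<forall>k\<in>{1..<n}. interlaces (k + 1) (pat_row k z) (pat_row (k + 1) z)"
    show "cell (tri_list (n - 1)) z" unfolding cell_def set_tri_list
    proof
      fix q assume "q \<in> tri (n - 1)"
      then obtain k i where q: "q = (k, i)" "k \<in> {1..<n}" "1 \<le> i" "i \<le> k" by (auto simp: tri_def)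
      then show "z (lpar q) \<le> z q \<and> z q \<le> z (rpar q)"
        using L[rule_format, OF q(2)] by (auto simp: interlaces_def pat_row_def lpar_def rpar_def)
    qed
  next
    assume R: "cell (tri_list (n - 1)) z"
    show "\<forall>k\<in>{1..<n}. interlaces (k + 1) (pat_row k z) (pat_row (k + 1) z)"
      unfolding interlaces_def
    proof (intro ballI)
      fix k i assume ki: "k \<in> {1..<n}" "i \<in> {1..<k + 1}"
      then have "(k, i) \<in> tri (n - 1)" by (auto simp: tri_def)
      then have "z (lpar (k, i)) \<le> z (k, i) \<and> z (k, i) \<le> z (rpar (k, i))" using R by (simp add: cell_def set_tri_list)
      then show "pat_row (k + 1) z i \<le> pat_row k z i \<and> pat_row k z i \<le> pat_row (k + 1) z (i + 1)"
        using ki by (simp add: pat_row_def lpar_def rpar_def)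
    qed
  qed
  then show ?thesis by (simp add: GT_cone_def)
qed

text \<open>An entry between two equal top entries is squeezed to their common value.\<close>

lemma polytope_off_free:
  assumes z: "z \<in> GT_polytope n x" and p: "p \<notin> set (free_coords n x)"
  shows "z p = base_point n x p"
proof (cases "p \<in> tri n")
  case False
  have "z \<in> tri n \<rightarrow>\<^sub>E UNIV" using z by (simp add: GT_polytope_def GT_cone_def)
  then have "z p = undefined" using False by (rule PiE_arb)
  then show ?thesis using False by (simp add: base_point_def)
next
  case True
  have top: "z (n, i) = x i" if "i \<in> {1..n}" for i
    using z that by (auto simp: GT_polytope_def pat_row_def)
  show ?thesis
  proof (cases "fst p = n")
    case fn: True
    then have "snd p \<in> {1..n}" using True by (auto simp: tri_def)
    then show ?thesis using top[of "snd p"] base_top[of "snd p" n x] fn by (metis prod.collapse)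
  next
    case False
    then have pt: "p \<in> tri (n - 1)" using True by (auto simp: tri_def)
    then have t: "tied n (base_point n x) p" using p by (simp add: free_coords_def set_tri_list)
    then have n: "Suc (fst p) = n" by (simp add: tied_def)
    have s: "snd p \<in> {1..n}" "Suc (snd p) \<in> {1..n}" using pt n by (auto simp: tri_def)
    have "z (lpar p) = base_point n x (lpar p)" "z (rpar p) = base_point n x (rpar p)"
      unfolding base_parents[OF pt n] unfolding lpar_def rpar_def n using top[OF s(1)] top[OF s(2)] by simp_all
    moreover have "z (lpar p) \<le> z p \<and> z p \<le> z (rpar p)"
      using z pt by (simp add: GT_polytope_def GT_cone_iff_cell cell_def set_tri_list)
    ultimately show ?thesis using t base_tied[OF pt t] unfolding tied_def by linarith
  qed
qed

lemma polytope_iff_cell: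
  assumes n: "1 \<le> n" and x: "x \<in> extensional {1..n}"
    and z: "\<And>p. p \<notin> set (free_coords n x) \<Longrightarrow> z p = base_point n x p"
  shows "z \<in> GT_polytope n x \<longleftrightarrow> cell (tri_list (n - 1)) z"
proof -
  have "z p = undefined" if "p \<notin> tri n" for p
  proof -
    have "p \<notin> set (free_coords n x)" using set_free(2) that by blast
    then show ?thesis using z[of p] that by (simp add: base_point_def)
  qed
  then have "z \<in> tri n \<rightarrow>\<^sub>E UNIV" by (simp add: PiE_def extensional_def)
  moreover have "pat_row n z = x"
  proof
    fix i
    show "pat_row n z i = x i"
    proof (cases "i \<in> {1..n}")
      case True
      have "(n, i) \<notin> set (free_coords n x)" using set_free(1) n by (fastforce simp: tri_def)
      then show ?thesis using z[of "(n, i)"] base_top[OF True, of x] True by (simp add: pat_row_def)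
    next
      case False
      then show ?thesis using x by (auto simp: pat_row_def extensional_def)
    qed
  qed
  ultimately show ?thesis by (simp add: GT_polytope_def GT_cone_iff_cell)
qed

lemma polytope_measurable:
  assumes "x \<in> extensional {1..n}" shows "GT_polytope n x \<in> sets (coord_space (tri n))"
proof -
  have row: "pat_row n z = x \<longleftrightarrow> (\<forall>i\<in>{1..n}. z (n, i) = x i)" for z
    using assms by (auto simp: pat_row_def extensional_def fun_eq_iff)
  have "GT_polytope n x = {z \<in> space (coord_space (tri n)). \<forall>q\<in>tri (n - 1). z (lpar q) \<le> z q \<and> z q \<le> z (rpar q)}
      \<inter> {z \<in> space (coord_space (tri n)). \<forall>i\<in>{1..n}. z (n, i) = x i}"
    unfolding GT_polytope_def GT_cone_iff_cell row cell_def set_tri_list space_PiM by auto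
  also have "\<dots> \<in> sets (coord_space (tri n))"
  proof (rule sets.Int; rule sets.sets_Collect_finite_All[OF _ finite_tri] sets.sets_Collect_finite_All[OF _ finite_atLeastAtMost])
    fix q assume "q \<in> tri (n - 1)"
    note q = tri_sub[OF this]
    have m: "(\<lambda>z. z q) \<in> borel_measurable (coord_space (tri n))" "(\<lambda>z. z (lpar q)) \<in> borel_measurable (coord_space (tri n))"
      "(\<lambda>z. z (rpar q)) \<in> borel_measurable (coord_space (tri n))" using q by (simp_all add: measurable_coord)
    show "{z \<in> space (coord_space (tri n)). z (lpar q) \<le> z q \<and> z q \<le> z (rpar q)} \<in> sets (coord_space (tri n))"
      by (intro sets.sets_Collect_conj borel_measurable_le m)
  next
    fix i assume "i \<in> {1..n}"
    then have "(n, i) \<in> tri n" by (auto simp: tri_def)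
    from borel_measurable_eq[OF measurable_coord[OF this] borel_measurable_const, of "x i"]
    show "{z \<in> space (coord_space (tri n)). z (n, i) = x i} \<in> sets (coord_space (tri n))" .
  qed
  finally show ?thesis .
qed

lemma slice_integral:
  assumes "F \<in> borel_measurable (coord_space (tri n))"
  shows "(\<integral>\<^sup>+z. F z \<partial>slice_measure n x) = iter_int (free_coords n x) F (base_point n x)"
proof -
  have ov: "overlay (base_point n x) (rev (free_coords n x)) \<in> PiM {..<length (free_coords n x)} (\<lambda>_. lborel) \<rightarrow>\<^sub>M coord_space (tri n)"
  proof (rule measurable_overlay)
    show "set (rev (free_coords n x)) \<subseteq> tri n" unfolding set_rev by (rule set_free(2))
    show "base_point n x \<in> space (coord_space (tri n))" by (rule base_space)
  qed simp
  have "set (rev (free_coords n x)) \<subseteq> tri n" unfolding set_rev by (rule set_free(2))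
  note int = nn_integral_overlay[OF assms this base_space, unfolded length_rev rev_rev_ident]
  have "(\<integral>\<^sup>+z. F z \<partial>slice_measure n x)
    = (\<integral>\<^sup>+t. F (overlay (base_point n x) (rev (free_coords n x)) t) \<partial>PiM {..<length (free_coords n x)} (\<lambda>_. lborel))"
    unfolding slice_measure_def by (rule nn_integral_distr[OF ov]) (use assms in simp)
  then show ?thesis by (rule trans[OF _ int])
qed

lemma gap_norm_nz:
  assumes "\<And>q. q \<in> set qs \<Longrightarrow> Suc (fst q) = n \<Longrightarrow> y (lpar q) \<le> y (rpar q)"
  shows "gap_norm n y qs \<noteq> 0 \<and> gap_norm n y qs \<noteq> \<infinity>"
  using assms
proof (induction qs)
  case (Cons q qs)
  define c where "c = (if Suc (fst q) = n \<and> y (lpar q) \<noteq> y (rpar q) then ennreal (y (rpar q) - y (lpar q)) else 1)"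
  have "c \<noteq> 0 \<and> c \<noteq> \<infinity>" using Cons.prems[of q] by (auto simp: c_def)
  moreover have "gap_norm n y (q # qs) = c * gap_norm n y qs" by (simp add: gap_norm_def c_def)
  moreover have "gap_norm n y qs \<noteq> 0 \<and> gap_norm n y qs \<noteq> \<infinity>" using Cons by simp
  ultimately show ?case by (auto simp: ennreal_mult_eq_top_iff)
qed (simp add: gap_norm_def)

abbreviation "gap_avg n \<equiv> nest (gap_fac n) gap_step (tri_list (n - 1))"

text \<open>Numerator and denominator of the normalized integral carry the same factor \<open>gap_norm\<close>.\<close>

lemma uniform_slice_integral:
  assumes n: "1 \<le> n" and x: "x \<in> extensional {1..n}" and mono: "\<And>i. i \<in> {1..<n} \<Longrightarrow> x i \<le> x (Suc i)"
    and F: "F \<in> borel_measurable (coord_space (tri n))"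
  shows "(\<integral>\<^sup>+z. F z \<partial>uniform_measure (slice_measure n x) (GT_polytope n x))
    = gap_avg n F (base_point n x) / gap_avg n (\<lambda>_. 1) (base_point n x)"
proof -
  let ?K = "GT_polytope n x" and ?b = "base_point n x" and ?W = "gap_norm n (base_point n x) (tri_list (n - 1))"
  have K: "?K \<in> sets (coord_space (tri n))" by (rule polytope_measurable[OF x])
  have sets: "sets (slice_measure n x) = sets (coord_space (tri n))" by (simp add: slice_measure_def)
  have parle: "?b (lpar q) \<le> ?b (rpar q) \<and> (?b (lpar q) = ?b (rpar q) \<longrightarrow> ?b q = ?b (lpar q))"
    if q: "q \<in> set (tri_list (n - 1))" "Suc (fst q) = n" for q
  proof -
    have qt: "q \<in> tri (n - 1)" using q(1) by (simp add: set_tri_list)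
    have "snd q \<in> {1..<n}" using qt q(2) by (auto simp: tri_def)
    from mono[OF this] show ?thesis using base_parents[OF qt q(2), of x] base_tied[OF qt, of x] q(2)
      by (simp add: tied_def)
  qed
  have int: "(\<integral>\<^sup>+z. G z * indicator ?K z \<partial>slice_measure n x) = gap_avg n G ?b * ?W"
    if G: "G \<in> borel_measurable (coord_space (tri n))" for G
  proof -
    have "(\<integral>\<^sup>+z. G z * indicator ?K z \<partial>slice_measure n x) = iter_int (free_coords n x) (\<lambda>z. G z * indicator ?K z) ?b"
      using G K by (intro slice_integral borel_measurable_times_ennreal borel_measurable_indicator)
    also have "\<dots> = iter_int (free_coords n x) (\<lambda>z. if cell (tri_list (n - 1)) z then G z else 0) ?b"
    proof (rule iter_int_cong)
      fix z assume "\<And>p. p \<notin> set (free_coords n x) \<Longrightarrow> z p = ?b p"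
      from polytope_iff_cell[OF n x this]
      show "G z * indicator ?K z = (if cell (tri_list (n - 1)) z then G z else 0)"
        by (simp add: indicator_def)
    qed
    also have "\<dots> = gap_avg n G ?b * ?W"
      unfolding free_coords_def
      by (rule gap_nest_eq_iter[symmetric, OF G row_order_tri_list _ base_space]) (use parle in \<open>simp_all add: set_tri_list\<close>)
    finally show ?thesis .
  qed
  have "(\<integral>\<^sup>+z. F z \<partial>uniform_measure (slice_measure n x) ?K) = (\<integral>\<^sup>+z. F z * indicator ?K z \<partial>slice_measure n x) / emeasure (slice_measure n x) ?K"
  proof (rule nn_integral_uniform_measure)
    show "F \<in> borel_measurable (slice_measure n x)" using F measurable_cong_sets[OF sets refl] by blast
    show "?K \<in> sets (slice_measure n x)" using K sets by simp
  qed
  also have "emeasure (slice_measure n x) ?K = gap_avg n (\<lambda>_. 1) ?b * ?W"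
    using int[of "\<lambda>_. 1"] K sets by simp
  also have "(\<integral>\<^sup>+z. F z * indicator ?K z \<partial>slice_measure n x) = gap_avg n F ?b * ?W" by (rule int[OF F])
  also have "(gap_avg n F ?b * ?W) / (gap_avg n (\<lambda>_. 1) ?b * ?W) = gap_avg n F ?b / gap_avg n (\<lambda>_. 1) ?b"
    using gap_norm_nz[of "tri_list (n - 1)" n ?b] parle by (intro divide_mult_eq) blast+
  finally show ?thesis .
qed

text \<open>The free coordinates are part of the standard basis, so the parametrization is isometric.\<close>

lemma slice_affine_lebesgue:
  "affine_lebesgue (tri n) {y \<in> tri n \<rightarrow>\<^sub>E UNIV. \<forall>p\<in>tri n - set (free_coords n x). y p = base_point n x p} (slice_measure n x)"
proof -
  let ?b = "base_point n x" and ?I = "tri n"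
  define js where "js = free_coords n x"
  define d where "d = length js"
  define v where "v j i = (of_bool (js ! j = i) :: real)" for j i
  have js: "distinct js" "set js \<subseteq> ?I" using set_free by (simp_all add: js_def)
  have orth: "(\<Sum>i\<in>?I. v j i * v j' i) = of_bool (j = j')" if "j < d" "j' < d" for j j'
  proof -
    have "js ! j \<in> ?I" using js that by (auto simp: d_def)
    have "(\<Sum>i\<in>?I. v j i * v j' i) = (\<Sum>i\<in>?I. if js ! j = i then of_bool (js ! j' = i) else 0)"
      by (intro sum.cong) (auto simp: v_def)
    also have "\<dots> = of_bool (js ! j' = js ! j)" using \<open>js ! j \<in> ?I\<close> by (simp only: sum.delta'[OF finite_tri] if_True)
    also have "(js ! j' = js ! j) = (j = j')" using js(1) that by (auto simp: nth_eq_iff_index_eq d_def)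
    finally show ?thesis .
  qed
  define \<phi> where "\<phi> = (\<lambda>t. \<lambda>i\<in>?I. ?b i + (\<Sum>j<d. t j * v j i))"
  have \<phi>: "\<phi> t = overlay ?b (rev js) t" for t
  proof
    fix i
    show "\<phi> t i = overlay ?b (rev js) t i"
    proof (cases "i \<in> set js")
      case True
      then obtain j where j: "j < d" "i = js ! j" by (auto simp: in_set_conv_nth d_def)
      have "(\<Sum>j'<d. t j' * v j' i) = (\<Sum>j'<d. if j' = j then t j' else 0)"
      proof (rule sum.cong[OF refl])
        fix j' assume "j' \<in> {..<d}"
        then have "js ! j' = i \<longleftrightarrow> j' = j" unfolding j(2) using js(1) j(1) by (simp add: nth_eq_iff_index_eq d_def)
        then show "t j' * v j' i = (if j' = j then t j' else 0)" by (simp add: v_def)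
      qed
      also have "\<dots> = t j" using j(1) by simp
      finally have "\<phi> t i = t j" using True js(2) base_free[of i n x] by (auto simp: \<phi>_def js_def)
      also have "t j = overlay ?b (rev js) t (rev (rev js) ! j)"
        using js(1) j(1) by (intro overlay_nth[symmetric]) (simp_all add: d_def)
      finally show ?thesis using j(2) by simp
    next
      case False
      have "(\<Sum>j<d. t j * v j i) = 0" using False by (intro sum.neutral) (auto simp: v_def d_def)
      moreover have "overlay ?b (rev js) t i = ?b i" using False by (intro overlay_off) simp
      ultimately show ?thesis by (cases "i \<in> ?I") (simp_all add: \<phi>_def base_point_def)
    qed
  qed
  have img: "\<phi> ` ({..<d} \<rightarrow>\<^sub>E UNIV) = {y \<in> ?I \<rightarrow>\<^sub>E UNIV. \<forall>p\<in>?I - set js. y p = ?b p}" (is "?A = ?B")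
  proof (intro set_eqI iffI)
    fix y assume "y \<in> ?A"
    then obtain t where t: "y = \<phi> t" by blast
    have "y \<in> ?I \<rightarrow>\<^sub>E UNIV" unfolding t \<phi>_def by simp
    moreover have "y p = ?b p" if "p \<notin> set js" for p
      unfolding t \<phi> using that by (intro overlay_off) simp
    ultimately show "y \<in> ?B" by simp
  next
    fix y assume y: "y \<in> ?B"
    define t where "t = (\<lambda>j\<in>{..<d}. y (js ! j))"
    have "y = \<phi> t"
    proof
      fix i
      consider "i \<in> set js" | "i \<in> ?I" "i \<notin> set js" | "i \<notin> ?I" by blast
      then show "y i = \<phi> t i"
      proof cases
        case 1
        then obtain j where j: "j < d" "i = js ! j" by (auto simp: in_set_conv_nth d_def)
        have "overlay ?b (rev js) t (rev (rev js) ! j) = t j"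
          using js(1) j(1) by (intro overlay_nth) (simp_all add: d_def)
        then show ?thesis unfolding \<phi> using j by (simp add: t_def)
      next
        case 2
        then have "overlay ?b (rev js) t i = ?b i" by (intro overlay_off) simp
        then show ?thesis unfolding \<phi> using y 2 by simp
      next
        case 3
        have "y \<in> ?I \<rightarrow>\<^sub>E UNIV" using y by blast
        then have "y i = undefined" using 3 by (rule PiE_arb)
        then show ?thesis using 3 by (simp add: \<phi>_def)
      qed
    qed
    moreover have "t \<in> {..<d} \<rightarrow>\<^sub>E UNIV" by (simp add: t_def)
    ultimately show "y \<in> ?A" by blast
  qed
  have L: "slice_measure n x = distr (PiM {..<d} (\<lambda>_. lborel)) (coord_space ?I) \<phi>"
    unfolding slice_measure_def js_def[symmetric] d_def[symmetric] \<phi>[abs_def] ..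
  show ?thesis unfolding affine_lebesgue_def js_def[symmetric]
    by (intro exI[of _ d] exI[of _ ?b] exI[of _ v] exI[of _ \<phi>] conjI allI impI orth img L) (simp_all only: \<phi>_def)
qed



definition good_row :: "nat \<Rightarrow> (nat \<Rightarrow> real) \<Rightarrow> bool" where
  "good_row n x \<longleftrightarrow> (\<forall>i\<in>{1..<n}. x i \<le> x (Suc i)) \<and> (\<forall>i\<in>{1..n - 2}. \<not> (x i = x (i + 1) \<and> x (i + 1) = x (i + 2)))"

lemma good_top_iff:
  assumes "\<And>i. i \<in> {1..n} \<Longrightarrow> y (n, i) = x i"
  shows "good_top n y \<longleftrightarrow> good_row n x"
proof -
  have "y (n, i) = x i \<and> y (n, Suc i) = x (Suc i)" if "i \<in> {1..<n}" for i using assms that by simp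
  moreover have "y (n, i) = x i \<and> y (n, i + 1) = x (i + 1) \<and> y (n, i + 2) = x (i + 2)" if "i \<in> {1..n - 2}" for i
    using assms that by auto
  ultimately show ?thesis unfolding good_top_def good_row_def by (intro arg_cong2[where f = conj] ball_cong refl) simp_all
qed

lemma good_top_base: "good_top n (base_point n x) \<longleftrightarrow> good_row n x"
  by (rule good_top_iff) (rule base_top)

lemma good_top_row: "good_top n y \<longleftrightarrow> good_row n (pat_row n y)"
  by (rule good_top_iff) (simp add: pat_row_def)

lemma gap_nest_bound:
  assumes R: "0 \<le> R" and par: "\<And>q. q \<in> set qs \<Longrightarrow> lpar q \<in> I \<and> rpar q \<in> I"
    and y: "\<And>p. p \<in> I \<Longrightarrow> \<bar>y p\<bar> \<le> R" and F: "\<And>y. F y \<le> B"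
  shows "nest (gap_fac n) gap_step qs F y \<le> B * ennreal (2 * R + 1) ^ length qs"
  using par y
proof (induction qs arbitrary: y)
  case Nil
  then show ?case by (simp add: F)
next
  case (Cons q qs)
  let ?C = "ennreal (2 * R + 1)"
  have l: "\<bar>y (lpar q)\<bar> \<le> R" "\<bar>y (rpar q)\<bar> \<le> R" using Cons.prems(1)[of q] Cons.prems(2) by auto
  have "nest (gap_fac n) gap_step qs F (y(q := gap_step q y t)) \<le> B * ?C ^ length qs" if t: "t \<in> {0..1}" for t
  proof (rule Cons.IH)
    show "lpar q' \<in> I \<and> rpar q' \<in> I" if "q' \<in> set qs" for q' using Cons.prems(1)[of q'] that by simp
    fix p assume p: "p \<in> I"
    have "\<bar>gap_step q y t\<bar> \<le> R"
    proof -
      have "gap_step q y t = (1 - t) * y (lpar q) + t * y (rpar q)" by (simp add: gap_step_def algebra_simps)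
      then have "\<bar>gap_step q y t\<bar> \<le> \<bar>(1 - t) * y (lpar q)\<bar> + \<bar>t * y (rpar q)\<bar>" by (simp only: abs_triangle_ineq)
      also have "\<dots> = (1 - t) * \<bar>y (lpar q)\<bar> + t * \<bar>y (rpar q)\<bar>" using t by (simp add: abs_mult)
      also have "\<dots> \<le> (1 - t) * R + t * R" using t l by (intro add_mono mult_left_mono) auto
      finally show ?thesis by (simp add: algebra_simps)
    qed
    then show "\<bar>(y(q := gap_step q y t)) p\<bar> \<le> R" using Cons.prems(2)[OF p] by (cases "p = q") simp_all
  qed
  then have i: "(\<integral>\<^sup>+t\<in>{0..1}. nest (gap_fac n) gap_step qs F (y(q := gap_step q y t)) \<partial>lborel) \<le> B * ?C ^ length qs"
    by (rule nn_integral_unit_le)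
  have "y (rpar q) - y (lpar q) \<le> 2 * R + 1" "1 \<le> 2 * R + 1" using l R by linarith+
  then have "ennreal (y (rpar q) - y (lpar q)) \<le> ?C" "ennreal 1 \<le> ?C" by (blast intro: ennreal_leI)+
  then have f: "gap_fac n q y \<le> ?C" by (simp add: gap_fac_def)
  have "nest (gap_fac n) gap_step (q # qs) F y \<le> ?C * (B * ?C ^ length qs)"
    unfolding nest.simps by (rule mult_mono[OF f i]) simp_all
  also have "\<dots> = B * ?C ^ length (q # qs)" by (simp only: length_Cons power_Suc mult_ac)
  finally show ?case .
qed

lemma gap_avg_finite: "gap_avg n (\<lambda>_. 1) y \<noteq> \<infinity>"
proof -
  have "gap_avg n (\<lambda>_. 1) y \<le> 1 * ennreal (2 * (\<Sum>p\<in>tri n. \<bar>y p\<bar>) + 1) ^ length (tri_list (n - 1))"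
  proof (rule gap_nest_bound[where I = "tri n"])
    show "\<bar>y p\<bar> \<le> (\<Sum>p\<in>tri n. \<bar>y p\<bar>)" if "p \<in> tri n" for p
      using that finite_tri by (intro member_le_sum) simp_all
    show "lpar q \<in> tri n \<and> rpar q \<in> tri n" if "q \<in> set (tri_list (n - 1))" for q
      using that tri_sub by (simp add: set_tri_list)
  qed (simp_all add: sum_nonneg)
  also have "\<dots> < \<top>" by (simp add: power_less_top_ennreal)
  finally show ?thesis by simp
qed

lemma gap_avg_pos:
  assumes "good_top n y" "y \<in> space (coord_space (tri n))" shows "gap_avg n (\<lambda>_. 1) y \<noteq> 0"
  using nest_pos[OF assms(1) row_order_tri_list, of "n - 1"] assms(2) by (auto simp: set_tri_list)

lemma gap_avg_cong:
  assumes "\<And>p. p \<notin> tri (n - 1) \<Longrightarrow> y p = y' p" shows "gap_avg n F y = gap_avg n F y'"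
  by (rule gap_nest_cong[OF row_order_tri_list]) (use assms in \<open>simp add: set_tri_list\<close>)

text \<open>Moving from a relatively interior point \<open>c\<close> a small step towards any point \<open>y\<close> of the affine
  subspace stays in the polytope, because only finitely many inequalities are involved and those that
  are not forced equalities are strict at \<open>c\<close>. Then \<open>y\<close> is an affine combination of two points of the
  polytope.\<close>

lemma affine_span_polytope:
  assumes n: "1 \<le> n" and x: "x \<in> extensional {1..n}" and good: "good_row n x"
  shows "affine_span (tri n) (GT_polytope n x)
    = {y \<in> tri n \<rightarrow>\<^sub>E UNIV. \<forall>p\<in>tri n - set (free_coords n x). y p = base_point n x p}" (is "?A = ?V")
proof (intro set_eqI iffI)
  let ?b = "base_point n x" and ?K = "GT_polytope n x" and ?I = "tri n"
  fix y assume "y \<in> ?A"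
  then obtain F u where y: "y = (\<lambda>i\<in>?I. \<Sum>z\<in>F. u z * z i)" and F: "F \<subseteq> ?K" "(\<Sum>z\<in>F. u z) = 1"
    by (auto simp: affine_span_def)
  have "y p = ?b p" if p: "p \<in> ?I - set (free_coords n x)" for p
  proof -
    have "z p = ?b p" if "z \<in> F" for z using polytope_off_free[of z n x p] that F p by blast
    then have "(\<Sum>z\<in>F. u z * z p) = (\<Sum>z\<in>F. u z * ?b p)" by (intro sum.cong) simp_all
    also have "\<dots> = ?b p" using F(2) by (simp add: sum_distrib_right[symmetric])
    finally show ?thesis using p by (simp add: y)
  qed
  then show "y \<in> ?V" by (simp add: y)
next
  let ?b = "base_point n x" and ?K = "GT_polytope n x" and ?I = "tri n" and ?L = "tri_list (n - 1)"
  fix y assume yV: "y \<in> ?V"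
  have gb: "good_top n ?b" using good by (simp add: good_top_base)
  have "\<exists>z. (\<forall>p. p \<notin> set ?L \<longrightarrow> z p = ?b p) \<and> (\<forall>p\<in>tri (n - 1). inner_at p z)"
    by (rule inner_fill[OF gb row_order_tri_list]) (auto simp: set_tri_list)
  then obtain c where c: "\<And>p. p \<notin> tri (n - 1) \<Longrightarrow> c p = ?b p" "\<And>p. p \<in> tri (n - 1) \<Longrightarrow> inner_at p c"
    unfolding set_tri_list by blast
  have row_n: "(n, i) \<notin> tri (n - 1)" for i using n by (auto simp: tri_def)
  have gc: "good_top n c" using gb c(1)[OF row_n] by (simp add: good_top_def)
  have par_n: "lpar q \<notin> tri (n - 1)" "rpar q \<notin> tri (n - 1)" if "Suc (fst q) = n" for q
    using row_n that by (simp_all add: lpar_def rpar_def)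
  have offc: "c p = ?b p" if p: "p \<notin> set (free_coords n x)" for p
  proof (cases "p \<in> tri (n - 1)")
    case True
    then have t: "tied n ?b p" using p by (simp add: free_coords_def set_tri_list)
    then have "Suc (fst p) = n" by (simp add: tied_def)
    note pn = par_n[OF this]
    have "c (lpar p) \<le> c p" "c p \<le> c (rpar p)" using c(2)[OF True] by (simp_all add: inner_at_def)
    then show ?thesis using t base_tied[OF True t] unfolding tied_def c(1)[OF pn(1)] c(1)[OF pn(2)] by simp
  qed (rule c(1))
  have offy: "y p = ?b p" if "p \<notin> set (free_coords n x)" for p
  proof (cases "p \<in> ?I")
    case False
    have "y \<in> ?I \<rightarrow>\<^sub>E UNIV" using yV by blast
    then have "y p = undefined" using False by (rule PiE_arb)
    then show ?thesis using False by (simp add: base_point_def)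
  qed (use yV that in blast)
  define z where "z \<epsilon> i = (if i \<in> set (free_coords n x) then c i + \<epsilon> * (y i - c i) else ?b i)" for \<epsilon> i
  have z: "z \<epsilon> i = c i + \<epsilon> * (y i - c i)" if "i \<in> ?I" for \<epsilon> i
    using offc[of i] offy[of i] by (auto simp: z_def)
  have lim: "((\<lambda>\<epsilon>. z \<epsilon> i) \<longlongrightarrow> c i) (at_right 0)" if "i \<in> ?I" for i
  proof -
    have "((\<lambda>\<epsilon>. c i + \<epsilon> * (y i - c i)) \<longlongrightarrow> c i + 0 * (y i - c i)) (at_right 0)" by (intro tendsto_intros)
    then show ?thesis using z[OF that] by simp
  qed
  have ev: "\<forall>\<^sub>F \<epsilon> in at_right 0. z \<epsilon> (lpar q) \<le> z \<epsilon> q \<and> z \<epsilon> q \<le> z \<epsilon> (rpar q)" if q: "q \<in> tri (n - 1)" for q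
  proof (cases "tied n ?b q")
    case True
    then have "Suc (fst q) = n" by (simp add: tied_def)
    note pn = par_n[OF this]
    have nf: "p \<notin> set (free_coords n x)" if "p \<notin> tri (n - 1) \<or> p = q" for p
      using that True set_free(1)[of n x] by (auto simp: free_coords_def)
    have "z \<epsilon> (lpar q) = ?b (lpar q)" "z \<epsilon> q = ?b q" "z \<epsilon> (rpar q) = ?b (rpar q)" for \<epsilon>
      using nf[of "lpar q"] nf[of q] nf[of "rpar q"] pn by (simp_all add: z_def)
    then show ?thesis using base_tied[OF q True] True by (simp add: tied_def)
  next
    case False
    note qs = tri_sub[OF q]
    have "c (lpar q) < c (rpar q)"
    proof (cases "Suc (fst q) = n")
      case True
      have "snd q \<in> {1..<n}" using q True by (auto simp: tri_def)
      then have "?b (lpar q) \<le> ?b (rpar q)" using gb unfolding good_top_def lpar_def rpar_def True by blast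
      then show ?thesis using False True unfolding c(1)[OF par_n(1)[OF True]] c(1)[OF par_n(2)[OF True]] tied_def by simp
    next
      case nn: False
      show ?thesis unfolding lpar_def rpar_def
        by (rule strict_rows[OF gc, of 0]) (use c(2) q nn in \<open>auto simp: tri_def\<close>)
    qed
    then have s: "c (lpar q) < c q" "c q < c (rpar q)" using c(2)[OF q] by (simp_all add: inner_at_def)
    have "\<forall>\<^sub>F \<epsilon> in at_right 0. z \<epsilon> q - z \<epsilon> (lpar q) > 0"
      by (rule order_tendstoD(1)[OF tendsto_diff[OF lim lim]]) (use qs s in auto)
    moreover have "\<forall>\<^sub>F \<epsilon> in at_right 0. z \<epsilon> (rpar q) - z \<epsilon> q > 0"
      by (rule order_tendstoD(1)[OF tendsto_diff[OF lim lim]]) (use qs s in auto)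
    ultimately show ?thesis by eventually_elim auto
  qed
  \<comment> \<open>The step length \<open>\<epsilon>\<close> has to be small enough for all inequalities at once.\<close>
  have "\<forall>\<^sub>F \<epsilon> in at_right 0. \<forall>q\<in>tri (n - 1). z \<epsilon> (lpar q) \<le> z \<epsilon> q \<and> z \<epsilon> q \<le> z \<epsilon> (rpar q)"
    by (rule eventually_ball_finite[OF finite_tri]) (use ev in blast)
  moreover have "\<forall>\<^sub>F \<epsilon> in at_right (0::real). \<epsilon> > 0" by (rule eventually_at_right_less)
  ultimately have "\<forall>\<^sub>F \<epsilon> in at_right 0. \<epsilon> > 0 \<and> cell ?L (z \<epsilon>)"
    unfolding cell_def set_tri_list by eventually_elim simp
  then obtain \<epsilon> where e: "\<epsilon> > 0" "cell ?L (z \<epsilon>)"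
    using eventually_happens[of _ "at_right (0::real)"] trivial_limit_at_right_real by blast
  have zK: "z \<epsilon> \<in> ?K" using polytope_iff_cell[OF n x, of "z \<epsilon>"] e(2) by (simp add: z_def)
  have "cell ?L c" unfolding cell_def set_tri_list using c(2) by (simp add: inner_at_def)
  then have cK: "c \<in> ?K" using polytope_iff_cell[OF n x offc] by blast
  have yI: "y i = undefined" if "i \<notin> ?I" for i
    using offy[of i] that set_free(2)[of n x] by (auto simp: base_point_def)
  show "y \<in> ?A"
  proof (cases "z \<epsilon> = c")
    case True
    have "y i = c i" if "i \<in> ?I" for i using z[OF that, of \<epsilon>] True e(1) by simp
    then have "y = (\<lambda>i\<in>?I. \<Sum>w\<in>{c}. 1 * w i)" using yI by (auto simp: fun_eq_iff)
    then show ?thesis unfolding affine_span_def using cK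
      by (intro CollectI exI[of _ "{c}"] exI[of _ "\<lambda>_. 1"]) simp
  next
    case False
    \<comment> \<open>The weights that solve \<open>z \<epsilon> = c + \<epsilon> (y - c)\<close> for \<open>y\<close>.\<close>
    define u where "u w = (if w = c then 1 - 1 / \<epsilon> else 1 / \<epsilon>)" for w :: "nat \<times> nat \<Rightarrow> real"
    have "y i = (\<Sum>w\<in>{c, z \<epsilon>}. u w * w i)" if "i \<in> ?I" for i
    proof -
      have "(\<Sum>w\<in>{c, z \<epsilon>}. u w * w i) = (1 - 1 / \<epsilon>) * c i + 1 / \<epsilon> * (c i + \<epsilon> * (y i - c i))"
        using False by (simp add: u_def z[OF that])
      also have "\<dots> = y i" using e(1) by (simp add: field_simps)
      finally show ?thesis by simp
    qed
    then have "y = (\<lambda>i\<in>?I. \<Sum>w\<in>{c, z \<epsilon>}. u w * w i)" using yI by (auto simp: fun_eq_iff)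
    moreover have "(\<Sum>w\<in>{c, z \<epsilon>}. u w) = 1" using False by (simp add: u_def)
    ultimately show ?thesis unfolding affine_span_def using cK zK
      by (intro CollectI exI[of _ "{c, z \<epsilon>}"] exI[of _ u]) simp
  qed
qed

text \<open>Top rows without a nondegenerate slice get the null measure, which keeps the kernel measurable.\<close>

definition uniform_kernel :: "nat \<Rightarrow> (nat \<Rightarrow> real) \<Rightarrow> (nat \<times> nat \<Rightarrow> real) measure" where
  "uniform_kernel n x = (if x \<in> extensional {1..n} \<and> good_row n x
     then uniform_measure (slice_measure n x) (GT_polytope n x) else null_measure (coord_space (tri n)))"

lemma uniform_kernel_is_uniform:
  assumes "1 \<le> n" "x \<in> extensional {1..n}" "good_row n x"
  shows "is_uniform_on (tri n) (GT_polytope n x) (uniform_kernel n x)"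
  unfolding is_uniform_on_def
proof (intro exI conjI)
  show "affine_lebesgue (tri n) (affine_span (tri n) (GT_polytope n x)) (slice_measure n x)"
    unfolding affine_span_polytope[OF assms] by (rule slice_affine_lebesgue)
  show "uniform_kernel n x = uniform_measure (slice_measure n x) (GT_polytope n x)"
    using assms by (simp add: uniform_kernel_def)
qed

lemma sets_uniform_kernel [simp]: "sets (uniform_kernel n x) = sets (coord_space (tri n))"
  by (simp add: uniform_kernel_def slice_measure_def)

lemma uniform_kernel_integral:
  assumes n: "1 \<le> n" and y: "y \<in> space (coord_space (tri n))" and good: "good_top n y"
    and F: "F \<in> borel_measurable (coord_space (tri n))"
  shows "(\<integral>\<^sup>+z. F z \<partial>uniform_kernel n (pat_row n y)) = gap_avg n F y / gap_avg n (\<lambda>_. 1) y"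
proof -
  let ?x = "pat_row n y"
  have x: "?x \<in> extensional {1..n}" by (simp add: pat_row_def)
  have g: "good_row n ?x" using good by (simp add: good_top_row)
  have e: "gap_avg n G (base_point n ?x) = gap_avg n G y" for G
  proof (rule gap_avg_cong)
    fix p assume p: "p \<notin> tri (n - 1)"
    show "base_point n ?x p = y p"
    proof (cases "p \<in> tri n")
      case True
      then have "fst p = n" "snd p \<in> {1..n}" using p by (auto simp: tri_def)
      then show ?thesis using True by (cases p) (simp add: base_point_def pat_row_def)
    next
      case False
      have "y \<in> tri n \<rightarrow>\<^sub>E UNIV" using y by (simp add: space_PiM)
      then have "y p = undefined" using False by (rule PiE_arb)
      then show ?thesis using False by (simp add: base_point_def)
    qed
  qed
  have K: "uniform_kernel n ?x = uniform_measure (slice_measure n ?x) (GT_polytope n ?x)"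
    using x g by (simp add: uniform_kernel_def)
  have "?x i \<le> ?x (Suc i)" if "i \<in> {1..<n}" for i using g that by (simp add: good_row_def)
  from uniform_slice_integral[OF n x this F] show ?thesis unfolding K e .
qed


section \<open>Mixtures of uniform laws\<close>


text \<open>The indicator of an open set is an increasing limit of the truncated multiples of the distance
  to its complement, and open sets are an intersection-stable generator. Extension by zero carries the
  question to the metric space of all functions on the countable index type.\<close>

lemma measure_eqI_continuous:
  fixes \<mu> \<nu> :: "('p::countable \<Rightarrow> real) measure"
  assumes \<mu>: "prob_space \<mu>" "sets \<mu> = sets (coord_space I)" and \<nu>: "prob_space \<nu>" "sets \<nu> = sets (coord_space I)"
    and eq: "\<And>f. continuous_map (powertop_real I) euclideanreal f \<Longrightarrow> (\<And>y. 0 \<le> f y \<and> f y \<le> 1) \<Longrightarrow> (\<integral>y. f y \<partial>\<mu>) = (\<integral>y. f y \<partial>\<nu>)"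
  shows "\<mu> = \<nu>"
proof -
  define ext where "ext = (\<lambda>(y :: 'p \<Rightarrow> real) p. if p \<in> I then y p else 0)"
  have ext_m: "ext \<in> coord_space I \<rightarrow>\<^sub>M borel"
  proof -
    have "ext \<in> coord_space I \<rightarrow>\<^sub>M PiM UNIV (\<lambda>_. borel :: real measure)" unfolding ext_def
    proof (rule measurable_PiM_single')
      fix p :: 'p
      show "(\<lambda>y. if p \<in> I then y p else 0) \<in> borel_measurable (coord_space I)"
        by (cases "p \<in> I") (simp_all add: measurable_component_singleton)
    qed simp
    then show ?thesis using measurable_cong_sets[OF refl sets_PiM_equal_borel] by blast
  qed
  have ext_c: "continuous_map (powertop_real I) euclidean ext"
    unfolding euclidean_product_topology[symmetric] continuous_map_componentwise
  proof (intro conjI ballI)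
    show "ext ` topspace (powertop_real I) \<subseteq> extensional UNIV" by simp
    fix p :: 'p
    show "continuous_map (powertop_real I) euclideanreal (\<lambda>y. ext y p)"
    proof (cases "p \<in> I")
      case True
      then have e: "(\<lambda>y. ext y p) = (\<lambda>y. y p)" by (simp add: ext_def)
      show ?thesis unfolding e by (rule continuous_map_product_projection[OF True])
    next
      case False
      then have e: "(\<lambda>y. ext y p) = (\<lambda>_. 0)" by (simp add: ext_def)
      show ?thesis unfolding e by simp
    qed
  qed
  have ext_\<mu>: "ext \<in> \<mu> \<rightarrow>\<^sub>M borel" and ext_\<nu>: "ext \<in> \<nu> \<rightarrow>\<^sub>M borel"
    using ext_m measurable_cong_sets[OF \<mu>(2) refl] measurable_cong_sets[OF \<nu>(2) refl] by blast+
  let ?M = "distr \<mu> borel ext" and ?N = "distr \<nu> borel ext"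
  interpret M: prob_space ?M by (rule prob_space.prob_space_distr[OF \<mu>(1) ext_\<mu>])
  interpret N: prob_space ?N by (rule prob_space.prob_space_distr[OF \<nu>(1) ext_\<nu>])
  have open_eq: "emeasure ?M U = emeasure ?N U" if U: "open U" for U
  proof (cases "U = UNIV")
    case True
    then show ?thesis using M.emeasure_space_1 N.emeasure_space_1 by simp
  next
    case False
    define g where "g k y = min 1 (real k * infdist y (- U))" for k y
    have g: "0 \<le> g k y \<and> g k y \<le> 1" for k y by (simp add: g_def infdist_nonneg)
    have gc: "continuous_on UNIV (g k)" for k unfolding g_def by (intro continuous_intros)
    have int: "(\<integral>y. g k y \<partial>?M) = (\<integral>y. g k y \<partial>?N)" for k
    proof -
      have "continuous_map (powertop_real I) euclideanreal (g k \<circ> ext)"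
        using gc[of k] by (intro continuous_map_compose[OF ext_c]) simp
      then have "(\<integral>y. (g k \<circ> ext) y \<partial>\<mu>) = (\<integral>y. (g k \<circ> ext) y \<partial>\<nu>)"
        by (rule eq) (simp add: g)
      moreover have "g k \<in> borel_measurable borel" by (rule borel_measurable_continuous_onI[OF gc])
      ultimately show ?thesis by (simp add: integral_distr[OF ext_\<mu>] integral_distr[OF ext_\<nu>])
    qed
    have lim: "(\<lambda>k. g k y) \<longlonglongrightarrow> indicator U y" for y
    proof (cases "y \<in> U")
      case True
      have "infdist y (- U) > 0"
        using True False U by (subst infdist_pos_not_in_closed) auto
      then obtain K :: nat where K: "1 / infdist y (- U) \<le> real K" using real_arch_simple by blast
      have "g k y = 1" if "K \<le> k" for k
      proof -
        have "1 / infdist y (- U) \<le> real k" using K that by linarith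
        then have "1 \<le> real k * infdist y (- U)" using \<open>infdist y (- U) > 0\<close> by (simp add: divide_le_eq)
        then show ?thesis by (simp add: g_def)
      qed
      then have "\<forall>\<^sub>F k in sequentially. g k y = indicator U y" using True by (auto simp: eventually_sequentially)
      then show ?thesis by (rule tendsto_eventually)
    next
      case False
      then have "g k y = 0" for k by (simp add: g_def)
      then show ?thesis using False by simp
    qed
    have "(\<lambda>k. \<integral>y. g k y \<partial>L) \<longlonglongrightarrow> measure L U" if "prob_space L" "sets L = sets borel" for L
    proof -
      interpret L: prob_space L by fact
      have Us: "U \<in> sets L" using U that(2) by simp
      have "(\<lambda>k. \<integral>y. g k y \<partial>L) \<longlonglongrightarrow> (\<integral>y. indicator U y \<partial>L)"
      proof (rule integral_dominated_convergence[where w = "\<lambda>_. 1"])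
        show "g k \<in> borel_measurable L" for k
          using borel_measurable_continuous_onI[OF gc] measurable_cong_sets[OF that(2) refl] by blast
        show "(indicator U :: _ \<Rightarrow> real) \<in> borel_measurable L" using Us by simp
        show "AE y in L. norm (g k y) \<le> 1" for k using g by simp
        show "AE y in L. (\<lambda>k. g k y) \<longlonglongrightarrow> indicator U y" using lim by simp
      qed simp
      then show ?thesis using Us by simp
    qed
    from this[OF M.prob_space_axioms] this[OF N.prob_space_axioms]
    have "measure ?M U = measure ?N U" unfolding int by (intro LIMSEQ_unique) simp_all
    then show ?thesis by (simp add: M.emeasure_eq_measure N.emeasure_eq_measure)
  qed
  have MN: "?M = ?N"
  proof (rule measure_eqI_generator_eq[where E = "{S. open S}" and \<Omega> = UNIV and A = "\<lambda>_. UNIV"])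
    show "Int_stable {S :: ('p \<Rightarrow> real) set. open S}" by (auto simp: Int_stable_def)
    show "emeasure ?M X = emeasure ?N X" if "X \<in> {S. open S}" for X using open_eq that by simp
    show "sets ?M = sigma_sets UNIV {S. open S}" "sets ?N = sigma_sets UNIV {S. open S}"
      by (simp_all add: borel_def)
  qed simp_all
  show ?thesis
  proof (rule measure_eqI)
    show "sets \<mu> = sets \<nu>" using \<mu>(2) \<nu>(2) by simp
    fix A assume A: "A \<in> sets \<mu>"
    have r: "(\<lambda>y. restrict y I) \<in> borel \<rightarrow>\<^sub>M coord_space I"
    proof -
      have "(\<lambda>y. restrict y I) \<in> PiM UNIV (\<lambda>_. borel) \<rightarrow>\<^sub>M coord_space I" by (rule measurable_restrict_subset) simp
      then show ?thesis using measurable_cong_sets[OF sets_PiM_equal_borel refl] by blast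
    qed
    let ?B = "(\<lambda>y. restrict y I) -` A \<inter> space borel"
    have B: "?B \<in> sets borel" using A \<mu>(2) by (intro measurable_sets[OF r]) simp
    have pre: "ext -` ?B \<inter> space (coord_space I) = A" 
    proof -
      have "restrict (ext y) I = y" if "y \<in> space (coord_space I)" for y
        using that by (auto simp: ext_def space_PiM PiE_iff extensional_def fun_eq_iff)
      moreover have "A \<subseteq> space (coord_space I)" using A \<mu>(2) sets.sets_into_space by metis
      ultimately show ?thesis by auto
    qed
    have sp: "space \<mu> = space (coord_space I)" "space \<nu> = space (coord_space I)"
      using \<mu>(2) \<nu>(2) sets_eq_imp_space_eq by blast+
    have "emeasure \<mu> A = emeasure ?M ?B" using emeasure_distr[OF ext_\<mu> B] pre sp by simp
    also have "\<dots> = emeasure \<nu> A" unfolding MN using emeasure_distr[OF ext_\<nu> B] pre sp by simp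
    finally show "emeasure \<mu> A = emeasure \<nu> A" .
  qed
qed

lemma measurable_pat_row: "pat_row n \<in> coord_space (tri n) \<rightarrow>\<^sub>M coord_space {1..n}"
  unfolding pat_row_def[abs_def]
proof (rule measurable_restrict)
  fix i assume "i \<in> {1..n}"
  then have "(n, i) \<in> tri n" by (auto simp: tri_def)
  then show "(\<lambda>y. y (n, i)) \<in> borel_measurable (coord_space (tri n))" by (rule measurable_coord)
qed

lemma measurable_top_embed: "top_embed n \<in> coord_space {1..n} \<rightarrow>\<^sub>M coord_space (tri n)"
  unfolding top_embed_def[abs_def]
proof (rule measurable_restrict)
  fix p assume p: "p \<in> tri n"
  show "(\<lambda>x. if fst p = n then x (snd p) else 0) \<in> borel_measurable (coord_space {1..n})"
  proof (cases "fst p = n")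
    case True
    then have "snd p \<in> {1..n}" using p by (auto simp: tri_def)
    then show ?thesis using True measurable_coord[of "snd p" "{1..n}"] by simp
  qed simp
qed

lemma pat_row_top_embed: "x \<in> space (coord_space {1..n}) \<Longrightarrow> pat_row n (top_embed n x) = x"
  by (auto simp: pat_row_def top_embed_def tri_def space_PiM PiE_iff extensional_def fun_eq_iff)

lemma good_row_measurable: "{x \<in> space (coord_space {1..n}). good_row n x} \<in> sets (coord_space {1..n})"
proof -
  have "{x \<in> space (coord_space {1..n}). good_row n x} =
    {x \<in> space (coord_space {1..n}). \<forall>i\<in>{1..<n}. x i \<le> x (Suc i)} \<inter>
    {x \<in> space (coord_space {1..n}). \<forall>i\<in>{1..n - 2}. \<not> (x i = x (i + 1) \<and> x (i + 1) = x (i + 2))}"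
    by (auto simp: good_row_def)
  also have "\<dots> \<in> sets (coord_space {1..n})"
  proof (rule sets.Int; rule sets.sets_Collect_finite_All)
    fix i assume "i \<in> {1..<n}"
    then have "(\<lambda>x. x i) \<in> borel_measurable (coord_space {1..n})" "(\<lambda>x. x (Suc i)) \<in> borel_measurable (coord_space {1..n})"
      by (auto intro: measurable_coord)
    then show "{x \<in> space (coord_space {1..n}). x i \<le> x (Suc i)} \<in> sets (coord_space {1..n})"
      by (rule borel_measurable_le)
  next
    fix i assume "i \<in> {1..n - 2}"
    then have "(\<lambda>x. x i) \<in> borel_measurable (coord_space {1..n})" "(\<lambda>x. x (i + 1)) \<in> borel_measurable (coord_space {1..n})"
      "(\<lambda>x. x (i + 2)) \<in> borel_measurable (coord_space {1..n})"
      by (auto intro: measurable_coord)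
    then show "{x \<in> space (coord_space {1..n}). \<not> (x i = x (i + 1) \<and> x (i + 1) = x (i + 2))} \<in> sets (coord_space {1..n})"
      by (intro sets.sets_Collect_neg sets.sets_Collect_conj borel_measurable_eq)
  qed simp_all
  finally show ?thesis .
qed

lemma uniform_kernel_mass:
  assumes n: "1 \<le> n" and y: "y \<in> space (coord_space (tri n))" and good: "good_top n y"
  shows "emeasure (uniform_kernel n (pat_row n y)) (space (coord_space (tri n))) = 1"
proof -
  have sp: "space (uniform_kernel n (pat_row n y)) = space (coord_space (tri n))"
    by (rule sets_eq_imp_space_eq) simp
  have "(\<integral>\<^sup>+z. 1 \<partial>uniform_kernel n (pat_row n y)) = gap_avg n (\<lambda>_. 1) y / gap_avg n (\<lambda>_. 1) y"
    by (rule uniform_kernel_integral[OF n y good]) simp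
  also have "\<dots> = 1" using gap_avg_pos[OF good y] gap_avg_finite[of n y] by (simp add: less_top)
  finally show ?thesis using sp by simp
qed

lemma measurable_uniform_kernel:
  assumes n: "1 \<le> n"
  shows "uniform_kernel n \<in> coord_space {1..n} \<rightarrow>\<^sub>M subprob_algebra (coord_space (tri n))"
proof (rule measurable_subprob_algebra)
  fix x assume x: "x \<in> space (coord_space {1..n})"
  have emb: "top_embed n x \<in> space (coord_space (tri n))" using measurable_space[OF measurable_top_embed x] .
  have row: "pat_row n (top_embed n x) = x" by (rule pat_row_top_embed[OF x])
  have sp: "space (uniform_kernel n x) = space (coord_space (tri n))" by (rule sets_eq_imp_space_eq) simp
  show "subprob_space (uniform_kernel n x)"
  proof (rule subprob_spaceI)
    show "space (uniform_kernel n x) \<noteq> {}" unfolding sp using emb by blast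
    show "emeasure (uniform_kernel n x) (space (uniform_kernel n x)) \<le> 1"
    proof (cases "good_row n x")
      case True
      then have "good_top n (top_embed n x)" by (simp add: good_top_row row)
      from uniform_kernel_mass[OF n emb this] show ?thesis by (simp add: row sp)
    next
      case False
      then show ?thesis by (simp add: uniform_kernel_def)
    qed
  qed
next
  fix A assume A: "A \<in> sets (coord_space (tri n))"
  let ?c = "\<lambda>x. gap_avg n (indicator A) (top_embed n x) / gap_avg n (\<lambda>_. 1) (top_embed n x)"
  have e: "emeasure (uniform_kernel n x) A = (if good_row n x then ?c x else 0)" if x: "x \<in> space (coord_space {1..n})" for x
  proof -
    have emb: "top_embed n x \<in> space (coord_space (tri n))" using measurable_space[OF measurable_top_embed x] .
    have row: "pat_row n (top_embed n x) = x" by (rule pat_row_top_embed[OF x])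
    show ?thesis
    proof (cases "good_row n x")
      case True
      then have "good_top n (top_embed n x)" by (simp add: good_top_row row)
      from uniform_kernel_integral[OF n emb this borel_measurable_indicator[OF A]] show ?thesis using A True by (simp add: row)
    next
      case False
      then show ?thesis by (simp add: uniform_kernel_def)
    qed
  qed
  have qs: "q \<in> tri n \<and> lpar q \<in> tri n \<and> rpar q \<in> tri n" if "q \<in> set (tri_list (n - 1))" for q
    using tri_sub that by (simp add: set_tri_list)
  have m: "(\<lambda>x. gap_avg n F (top_embed n x)) \<in> borel_measurable (coord_space {1..n})"
    if "F \<in> borel_measurable (coord_space (tri n))" for F
    by (rule measurable_compose[OF measurable_top_embed nest_measurable[OF that qs]])
  have "?c \<in> borel_measurable (coord_space {1..n})"
    using A by (intro borel_measurable_divide_ennreal m) simp_all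
  then have "(\<lambda>x. if good_row n x then ?c x else 0) \<in> borel_measurable (coord_space {1..n})"
    by (rule measurable_If[OF _ _ good_row_measurable]) simp
  then show "(\<lambda>x. emeasure (uniform_kernel n x) A) \<in> borel_measurable (coord_space {1..n})"
    by (subst measurable_cong[where g = "\<lambda>x. if good_row n x then ?c x else 0"]) (rule e, assumption)
qed simp

text \<open>The kernel at \<open>x\<close> sits on arrays with top row \<open>x\<close>.\<close>

lemma uniform_kernel_concentrated:
  assumes n: "1 \<le> n" and x: "x \<in> extensional {1..n}" and A: "A \<in> sets (coord_space (tri n))" and B: "B \<in> sets (coord_space {1..n})"
  shows "emeasure (uniform_kernel n x) (A \<inter> (pat_row n -` B \<inter> space (coord_space (tri n))))
    = emeasure (uniform_kernel n x) A * indicator B x"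
proof (cases "good_row n x")
  case True
  let ?S = "pat_row n -` B \<inter> space (coord_space (tri n))" and ?K = "GT_polytope n x"
  have k: "uniform_kernel n x = uniform_measure (slice_measure n x) ?K" using True x by (simp add: uniform_kernel_def)
  have sl: "sets (slice_measure n x) = sets (coord_space (tri n))" by (simp add: slice_measure_def)
  have S: "?S \<in> sets (coord_space (tri n))" by (rule measurable_sets[OF measurable_pat_row B])
  have K: "?K \<in> sets (coord_space (tri n))" by (rule polytope_measurable[OF x])
  have Ksub: "?K \<subseteq> space (coord_space (tri n))" by (rule sets.sets_into_space[OF K])
  have row: "pat_row n z = x" if "z \<in> ?K" for z using that by (simp add: GT_polytope_def)
  have "?K \<inter> (A \<inter> ?S) = (if x \<in> B then ?K \<inter> A else {})" using row Ksub by auto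
  then show ?thesis unfolding k using A S K sl by (simp add: emeasure_uniform_measure)
next
  case False
  then show ?thesis by (simp add: uniform_kernel_def)
qed

text \<open>A mixture over top rows of laws concentrated on arrays with that top row disintegrates into
  these laws, so the mixing kernel is a conditional distribution.\<close>

theorem continuous_gibbs_if_mixture:
  assumes n: "1 \<le> n" and \<mu>: "prob_space \<mu>" "sets \<mu> = sets (coord_space (tri n))"
    and good: "AE y in \<mu>. good_top n y"
    and mix: "\<mu> = \<mu> \<bind> (\<lambda>y. uniform_kernel n (pat_row n y))"
  shows "continuous_gibbs n \<mu>"
  unfolding continuous_gibbs_def
proof (intro exI conjI ballI)
  interpret prob_space \<mu> by fact
  let ?k = "\<lambda>y. uniform_kernel n (pat_row n y)" and ?F = "top_row_algebra n \<mu>"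
  have sp: "space \<mu> = space (coord_space (tri n))" by (rule sets_eq_imp_space_eq[OF \<mu>(2)])
  have pr: "pat_row n \<in> \<mu> \<rightarrow>\<^sub>M coord_space {1..n}"
    using measurable_pat_row measurable_cong_sets[OF \<mu>(2) refl] by blast
  have km: "?k \<in> \<mu> \<rightarrow>\<^sub>M subprob_algebra (coord_space (tri n))"
    by (rule measurable_compose[OF pr measurable_uniform_kernel[OF n]])
  show "AE y in \<mu>. is_uniform_on (tri n) (GT_polytope n (pat_row n y)) (?k y)"
    using good
  proof eventually_elim
    case (elim y)
    have "pat_row n y \<in> extensional {1..n}" by (simp add: pat_row_def)
    then show ?case using elim by (intro uniform_kernel_is_uniform[OF n]) (simp_all add: good_top_row)
  qed
  fix A assume A: "A \<in> sets (coord_space (tri n))"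
  have sub: "subalgebra \<mu> ?F"
    unfolding subalgebra_def top_row_algebra_def
    by (rule conjI[OF space_vimage_algebra sets_image_in_sets[OF refl pr]])
  have prs: "pat_row n \<in> space \<mu> \<rightarrow> space (coord_space {1..n})" by (rule Pi_I) (rule measurable_space[OF pr])
  interpret S: finite_measure_subalgebra \<mu> ?F
    by (intro finite_measure_subalgebra.intro finite_measure_subalgebra_axioms.intro finite_measure_axioms sub)
  have prF: "pat_row n \<in> ?F \<rightarrow>\<^sub>M coord_space {1..n}"
    unfolding top_row_algebra_def by (rule measurable_vimage_algebra1[OF prs])
  have mF: "(\<lambda>y. measure (?k y) A) \<in> borel_measurable ?F"
    using prF by (rule measurable_compose[where f = "pat_row n" and g = "\<lambda>x. measure (uniform_kernel n x) A"])
      (rule measurable_compose[where f = "uniform_kernel n" and g = "\<lambda>M. measure M A", OF measurable_uniform_kernel[OF n] measurable_measure_subprob_algebra[OF A]])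
  have k1: "emeasure (?k y) A = ennreal (measure (?k y) A)" "measure (?k y) A \<le> 1" if "y \<in> space \<mu>" for y
  proof -
    have sub1: "subprob_space (?k y)"
      using measurable_space[OF km that] unfolding space_subprob_algebra by blast
    show "emeasure (?k y) A = ennreal (measure (?k y) A)"
      by (rule finite_measure.emeasure_eq_measure[OF subprob_space.axioms(1)[OF sub1]])
    show "measure (?k y) A \<le> 1" by (rule subprob_space.subprob_measure_le_1[OF sub1])
  qed
  show "AE y in \<mu>. real_cond_exp \<mu> ?F (indicator A) y = measure (?k y) A"
  proof (rule S.real_cond_exp_charact)
    have mM: "(\<lambda>y. measure (?k y) A) \<in> borel_measurable \<mu>" by (rule measurable_from_subalg[OF sub mF])
    show "integrable \<mu> (\<lambda>y. measure (?k y) A)"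
      using k1(2) mM by (intro integrable_const_bound[of _ 1] AE_I2) simp_all
    show intA: "integrable \<mu> (indicator A :: _ \<Rightarrow> real)"
    proof (rule integrable_const_bound[of _ 1])
      show "AE y in \<mu>. norm (indicator A y :: real) \<le> 1" by (rule AE_I2) simp
      show "(indicator A :: _ \<Rightarrow> real) \<in> borel_measurable \<mu>"
        by (rule borel_measurable_indicator) (simp only: A \<mu>(2))
    qed
    show "(\<lambda>y. measure (?k y) A) \<in> borel_measurable ?F" by (rule mF)
    fix S assume "S \<in> sets ?F"
    then obtain B where B: "B \<in> sets (coord_space {1..n})" "S = pat_row n -` B \<inter> space \<mu>"
      unfolding top_row_algebra_def sets_vimage_algebra2[OF prs] by blast
    have Sm: "S \<in> sets \<mu>" unfolding B(2) by (rule measurable_sets[OF pr B(1)])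
    have AS: "A \<inter> S \<in> sets (coord_space (tri n))" using A Sm \<mu>(2) by simp
    have "ennreal (measure \<mu> (A \<inter> S)) = emeasure (\<mu> \<bind> ?k) (A \<inter> S)"
      using mix by (simp add: emeasure_eq_measure)
    also have "\<dots> = (\<integral>\<^sup>+y. emeasure (?k y) (A \<inter> S) \<partial>\<mu>)"
      by (rule emeasure_bind[OF not_empty km AS])
    also have "\<dots> = (\<integral>\<^sup>+y. ennreal (indicator S y * measure (?k y) A) \<partial>\<mu>)"
    proof (rule nn_integral_cong)
      fix y assume y: "y \<in> space \<mu>"
      have "emeasure (?k y) (A \<inter> S) = emeasure (?k y) A * indicator B (pat_row n y)"
        unfolding B(2) sp by (rule uniform_kernel_concentrated[OF n _ A B(1)]) (simp add: pat_row_def)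
      then show "emeasure (?k y) (A \<inter> S) = ennreal (indicator S y * measure (?k y) A)"
        using y k1(1)[OF y] by (auto simp: B(2) indicator_def)
    qed
    also have "\<dots> = ennreal (\<integral>y. indicator S y * measure (?k y) A \<partial>\<mu>)"
      using k1(2) Sm mM by (intro nn_integral_eq_integral integrable_const_bound[of _ 1] AE_I2 borel_measurable_times borel_measurable_indicator)
        (auto simp: indicator_def)
    finally have "measure \<mu> (A \<inter> S) = (\<integral>y. indicator S y * measure (?k y) A \<partial>\<mu>)"
      by (subst (asm) ennreal_inj) (auto intro!: integral_nonneg_AE)
    moreover have "(\<integral>y\<in>S. indicator A y \<partial>\<mu>) = measure \<mu> (A \<inter> S)"
    proof -
      have "(\<integral>y\<in>S. indicator A y \<partial>\<mu>) = (\<integral>y. indicator (A \<inter> S) y \<partial>\<mu>)"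
        unfolding set_lebesgue_integral_def
        by (rule Bochner_Integration.integral_cong[OF refl]) (auto simp: indicator_def)
      also have "\<dots> = measure \<mu> (A \<inter> S)" using AS \<mu>(2) by simp
      finally show ?thesis .
    qed
    ultimately show "(\<integral>y\<in>S. indicator A y \<partial>\<mu>) = (\<integral>y\<in>S. measure (?k y) A \<partial>\<mu>)"
      by (simp add: set_lebesgue_integral_def)
  qed
qed


section \<open>The limit law as a mixture of uniform laws\<close>


lemma ennreal_ratio_le:
  fixes a b C :: ennreal
  assumes "a \<le> C * b" shows "a / b \<le> C"
proof (cases "b = 0 \<or> b = \<infinity>")
  case True
  then show ?thesis using assms by auto
next
  case False
  have "a / b \<le> C * b / b" by (rule divide_right_mono_ennreal[OF assms])
  also have "\<dots> = C" using False by (intro mult_divide_eq_ennreal) auto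
  finally show ?thesis .
qed

lemma lat_nest_le:
  assumes "\<And>m. F m \<le> C"
  shows "nest (lat_fac n r s b) (lat_step r s) qs F m \<le> C * nest (lat_fac n r s b) (lat_step r s) qs (\<lambda>_. 1) m"
proof (induction qs arbitrary: m)
  case Nil
  then show ?case using assms by simp
next
  case (Cons q qs)
  let ?N = "nest (lat_fac n r s b) (lat_step r s) qs"
  have "(\<integral>\<^sup>+t\<in>{0..1}. ?N F (m(q := lat_step r s q m t)) \<partial>lborel)
     \<le> (\<integral>\<^sup>+t. C * (?N (\<lambda>_. 1) (m(q := lat_step r s q m t)) * indicator {0..1} t) \<partial>lborel)"
  proof (rule nn_integral_mono)
    fix t
    show "?N F (m(q := lat_step r s q m t)) * indicator {0..1} t \<le> C * (?N (\<lambda>_. 1) (m(q := lat_step r s q m t)) * indicator {0..1} t)"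
      unfolding mult.assoc[symmetric] by (rule mult_right_mono[OF Cons.IH]) simp
  qed
  also have "\<dots> = C * (\<integral>\<^sup>+t\<in>{0..1}. ?N (\<lambda>_. 1) (m(q := lat_step r s q m t)) \<partial>lborel)"
    unfolding lat_step_def by (intro nn_integral_cmult borel_measurable_times_ennreal) (simp_all add: measurable_int_update)
  finally have i: "(\<integral>\<^sup>+t\<in>{0..1}. ?N F (m(q := lat_step r s q m t)) \<partial>lborel) \<le> C * (\<integral>\<^sup>+t\<in>{0..1}. ?N (\<lambda>_. 1) (m(q := lat_step r s q m t)) \<partial>lborel)" .
  have "nest (lat_fac n r s b) (lat_step r s) (q # qs) F m \<le> lat_fac n r s b q m * (C * (\<integral>\<^sup>+t\<in>{0..1}. ?N (\<lambda>_. 1) (m(q := lat_step r s q m t)) \<partial>lborel))"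
    unfolding nest.simps by (rule mult_left_mono[OF i]) simp
  also have "\<dots> = C * nest (lat_fac n r s b) (lat_step r s) (q # qs) (\<lambda>_. 1) m"
    unfolding nest.simps by (simp only: mult_ac)
  finally show ?case .
qed

lemma tendsto_divide_ennreal':
  fixes A B :: "nat \<Rightarrow> ennreal"
  assumes "A \<longlonglongrightarrow> a" "B \<longlonglongrightarrow> b" "a \<noteq> \<infinity>" "b \<noteq> 0"
  shows "(\<lambda>k. A k / B k) \<longlonglongrightarrow> a / b"
proof -
  have "continuous_on UNIV (\<lambda>x::ennreal. inverse x)" by (intro continuous_intros)
  then have "isCont (\<lambda>x::ennreal. inverse x) b" by (simp add: continuous_on_eq_continuous_at)
  then have i: "(\<lambda>k. inverse (B k)) \<longlonglongrightarrow> inverse b" by (rule isCont_tendsto_compose[OF _ assms(2)])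
  have "inverse b \<noteq> \<infinity>" using assms(4) by simp
  then show ?thesis unfolding divide_ennreal_def using assms(3) by (intro tendsto_mult_ennreal assms(1) i) auto
qed

definition scaled_array :: "nat \<Rightarrow> real \<Rightarrow> real \<Rightarrow> (nat \<times> nat \<Rightarrow> int) \<Rightarrow> nat \<times> nat \<Rightarrow> real" where
  "scaled_array n a b m = rescale n a b (\<lambda>q\<in>tri n. real_of_int (m q))"

lemma scaled_array_at: "q \<in> tri n \<Longrightarrow> scaled_array n a b m q = (of_int (m q) - a) / b"
  by (simp add: scaled_array_def rescale_def)

lemma scaled_array_PiE: "scaled_array n a b m \<in> tri n \<rightarrow>\<^sub>E UNIV"
  by (simp add: scaled_array_def rescale_def)

lemma integral_rescaled_law:
  fixes f :: "(nat \<times> nat \<Rightarrow> real) \<Rightarrow> real"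
  assumes f: "f \<in> borel_measurable (coord_space (tri n))"
  shows "(\<integral>y. f y \<partial>distr (pattern_law n \<rho>) (coord_space (tri n)) (rescale n a b)) = (\<integral>m. f (scaled_array n a b m) \<partial>measure_pmf \<rho>)"
proof -
  have r: "rescale n a b \<in> coord_space (tri n) \<rightarrow>\<^sub>M coord_space (tri n)"
    unfolding rescale_def[abs_def]
  proof (rule measurable_restrict)
    fix q assume "q \<in> tri n"
    from measurable_coord[OF this] show "(\<lambda>y. 1 / b * (y q - a)) \<in> borel_measurable (coord_space (tri n))" by simp
  qed
  have e: "(\<lambda>m. \<lambda>q\<in>tri n. real_of_int (m q)) \<in> measure_pmf \<rho> \<rightarrow>\<^sub>M coord_space (tri n)"
    by (simp add: space_PiM)
  have r': "rescale n a b \<in> pattern_law n \<rho> \<rightarrow>\<^sub>M coord_space (tri n)" using r by (simp add: pattern_law_def)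
  have "(\<integral>y. f y \<partial>distr (pattern_law n \<rho>) (coord_space (tri n)) (rescale n a b)) = (\<integral>y. f (rescale n a b y) \<partial>pattern_law n \<rho>)"
    by (rule integral_distr[OF r' f])
  also have "\<dots> = (\<integral>m. f (scaled_array n a b m) \<partial>measure_pmf \<rho>)"
    unfolding pattern_law_def scaled_array_def
    by (rule integral_distr[OF e measurable_compose[OF r f]])
  finally show ?thesis .
qed

locale gibbs_limit =
  fixes n :: nat and w :: "nat \<Rightarrow> real" and \<rho> :: "nat \<Rightarrow> (nat \<times> nat \<Rightarrow> int) pmf"
    and a b :: "nat \<Rightarrow> real" and \<mu> :: "(nat \<times> nat \<Rightarrow> real) measure"
  assumes n: "1 \<le> n" and w: "\<And>t. t \<in> {1..6} \<Longrightarrow> w t > 0"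
    and supp: "\<And>k. set_pmf (\<rho> k) \<subseteq> nonneg_patterns n" and gibbs: "\<And>k. six_vertex_gibbs n w (\<rho> k)"
    and b: "filterlim b at_top sequentially"
    and prob: "prob_space \<mu>" and sets_\<mu>: "sets \<mu> = sets (coord_space (tri n))"
    and good: "AE y in \<mu>. good_top n y"
    and weak: "weakly_converges (tri n)
           (\<lambda>k. distr (pattern_law n (\<rho> k)) (coord_space (tri n)) (rescale n (a k) (b k))) \<mu>"
begin

abbreviation "mixture \<equiv> \<mu> \<bind> (\<lambda>y. uniform_kernel n (pat_row n y))"

abbreviation "lat_avg k \<equiv> nest (lat_fac n (left_wt w) (right_wt w) (b k)) (lat_step (left_wt w) (right_wt w)) (tri_list (n - 1))"

lemma space_\<mu>: "space \<mu> = space (coord_space (tri n))"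
  by (rule sets_eq_imp_space_eq[OF sets_\<mu>])

lemma wt_pos: "left_wt w > 0" "right_wt w > 0"
  using w by (auto simp: left_wt_def right_wt_def)

lemma kernel_measurable: "(\<lambda>y. uniform_kernel n (pat_row n y)) \<in> \<mu> \<rightarrow>\<^sub>M subprob_algebra (coord_space (tri n))"
proof -
  have "pat_row n \<in> \<mu> \<rightarrow>\<^sub>M coord_space {1..n}"
    using measurable_pat_row measurable_cong_sets[OF sets_\<mu> refl] by blast
  from measurable_compose[OF this measurable_uniform_kernel[OF n]] show ?thesis .
qed

lemma not_empty_\<mu>: "space \<mu> \<noteq> {}" by (rule prob_space.not_empty[OF prob])

lemma sets_mixture: "sets mixture = sets (coord_space (tri n))"
  by (rule sets_bind[OF _ not_empty_\<mu>]) simp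

lemma prob_mixture: "prob_space mixture"
proof (rule prob_spaceI)
  have "space mixture = space (coord_space (tri n))" by (rule sets_eq_imp_space_eq[OF sets_mixture])
  then have "emeasure mixture (space mixture) = (\<integral>\<^sup>+y. emeasure (uniform_kernel n (pat_row n y)) (space (coord_space (tri n))) \<partial>\<mu>)"
    by (simp only: emeasure_bind[OF not_empty_\<mu> kernel_measurable sets.top])
  also have "\<dots> = (\<integral>\<^sup>+y. 1 \<partial>\<mu>)"
  proof (rule nn_integral_cong_AE)
    show "AE y in \<mu>. emeasure (uniform_kernel n (pat_row n y)) (space (coord_space (tri n))) = 1"
      using good AE_space
    proof eventually_elim
      case (elim y)
      then show ?case using uniform_kernel_mass[OF n, of y] by (simp add: space_\<mu>)
    qed
  qed
  also have "\<dots> = 1" using prob_space.emeasure_space_1[OF prob] by simp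
  finally show "emeasure mixture (space mixture) = 1" .
qed

context
  fixes f :: "(nat \<times> nat \<Rightarrow> real) \<Rightarrow> real"
  assumes fc: "continuous_map (powertop_real (tri n)) euclideanreal f" and f01: "\<And>y. 0 \<le> f y \<and> f y \<le> 1"
begin

text \<open>The truncation at one has no effect where these means are used; it makes the bounds hold for
  every array.\<close>

definition lat_mean :: "nat \<Rightarrow> (nat \<times> nat \<Rightarrow> int) \<Rightarrow> real" where
  "lat_mean k m = min 1 (enn2real (lat_avg k (\<lambda>m. ennreal (f (scaled_array n (a k) (b k) m))) m / lat_avg k (\<lambda>_. 1) m))"

definition gap_mean :: "(nat \<times> nat \<Rightarrow> real) \<Rightarrow> real" where
  "gap_mean y = min 1 (enn2real (gap_avg n (\<lambda>z. ennreal (f (restrict z (tri n)))) y / gap_avg n (\<lambda>_. 1) y))"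

lemma f_measurable: "f \<in> borel_measurable (coord_space (tri n))"
  by (rule continuous_map_coord_measurable[OF fc])

lemma F_measurable: "(\<lambda>z. ennreal (f (restrict z (tri n)))) \<in> borel_measurable (coord_space (tri n))"
proof -
  have "(\<lambda>z. restrict z (tri n)) \<in> coord_space (tri n) \<rightarrow>\<^sub>M coord_space (tri n)"
    by (rule measurable_restrict_subset) simp
  from measurable_compose[OF measurable_compose[OF this f_measurable] measurable_ennreal] show ?thesis .
qed

lemma mean_bounds: "0 \<le> lat_mean k m \<and> lat_mean k m \<le> 1" "0 \<le> gap_mean y \<and> gap_mean y \<le> 1"
  by (simp_all add: lat_mean_def gap_mean_def)

lemma gap_mean_measurable: "gap_mean \<in> borel_measurable \<mu>"
proof -
  have qs: "q \<in> tri n \<and> lpar q \<in> tri n \<and> rpar q \<in> tri n" if "q \<in> set (tri_list (n - 1))" for q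
    using tri_sub that by (simp add: set_tri_list)
  have "(\<lambda>y. gap_avg n (\<lambda>z. ennreal (f (restrict z (tri n)))) y / gap_avg n (\<lambda>_. 1) y) \<in> borel_measurable (coord_space (tri n))"
    by (intro borel_measurable_divide_ennreal nest_measurable[OF _ qs] F_measurable) simp_all
  then have "(\<lambda>y. enn2real (gap_avg n (\<lambda>z. ennreal (f (restrict z (tri n)))) y / gap_avg n (\<lambda>_. 1) y)) \<in> borel_measurable (coord_space (tri n))"
    by (rule borel_measurable_enn2real)
  then have "gap_mean \<in> borel_measurable (coord_space (tri n))" unfolding gap_mean_def[abs_def] by (intro borel_measurable_min) simp_all
  then show ?thesis using measurable_cong_sets[OF sets_\<mu> refl] by blast
qed

lemma integral_lat_mean:
  assumes "b k > 0"
  shows "(\<integral>m. lat_mean k m \<partial>measure_pmf (\<rho> k)) = (\<integral>m. f (scaled_array n (a k) (b k) m) \<partial>measure_pmf (\<rho> k))"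
proof -
  let ?F = "\<lambda>m. ennreal (f (scaled_array n (a k) (b k) m))"
  have e: "ennreal (lat_mean k m) = lat_avg k ?F m / lat_avg k (\<lambda>_. 1) m" for m
  proof -
    have "?F m \<le> 1" for m using f01 by (simp add: ennreal_le_1)
    then have le: "lat_avg k ?F m / lat_avg k (\<lambda>_. 1) m \<le> 1" by (intro ennreal_ratio_le lat_nest_le)
    then have fin: "lat_avg k ?F m / lat_avg k (\<lambda>_. 1) m < \<top>" by (rule le_less_trans) simp
    have "enn2real (lat_avg k ?F m / lat_avg k (\<lambda>_. 1) m) \<le> 1" using enn2real_mono[OF le] by simp
    then show ?thesis unfolding lat_mean_def using fin by (simp add: min_absorb2 ennreal_enn2real)
  qed
  have "(\<integral>\<^sup>+m. ennreal (lat_mean k m) \<partial>measure_pmf (\<rho> k)) = (\<integral>\<^sup>+m. ?F m \<partial>measure_pmf (\<rho> k))"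
    unfolding e by (rule gibbs_average[symmetric, OF n w supp gibbs assms])
  then show ?thesis using mean_bounds(1) f01 by (simp add: integral_eq_nn_integral)
qed

text \<open>The denominator has a positive limit because of the assumption on the limiting top row.\<close>

lemma lat_mean_tendsto:
  assumes \<kappa>: "filterlim \<kappa> at_top sequentially" and lim: "scaled_lim (tri n) (a \<circ> \<kappa>) (b \<circ> \<kappa>) m y"
    and y: "good_top n y" "y \<in> space (coord_space (tri n))"
  shows "(\<lambda>j. lat_mean (\<kappa> j) (m j)) \<longlonglongrightarrow> gap_mean y"
proof -
  have b': "filterlim (\<lambda>j. b (\<kappa> j)) at_top sequentially" by (rule filterlim_compose[OF b \<kappa>])
  have lim': "scaled_lim (tri n) (\<lambda>j. a (\<kappa> j)) (\<lambda>j. b (\<kappa> j)) m y" using lim by (simp add: scaled_lim_def)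
  have par: "lpar q \<in> tri n \<and> rpar q \<in> tri n" if "q \<in> set (tri_list (n - 1))" for q
    using tri_sub that by (simp add: set_tri_list)
  have num: "(\<lambda>j. lat_avg (\<kappa> j) (\<lambda>m. ennreal (f (scaled_array n (a (\<kappa> j)) (b (\<kappa> j)) m))) (m j))
     \<longlonglongrightarrow> gap_avg n (\<lambda>z. ennreal (f (restrict z (tri n)))) y"
  proof (rule nest_tendsto[where F = "\<lambda>j m. ennreal (f (scaled_array n (a (\<kappa> j)) (b (\<kappa> j)) m))"
        and a = "\<lambda>j. a (\<kappa> j)" and b = "\<lambda>j. b (\<kappa> j)" and B = 1, OF wt_pos b' finite_tri _ _ _ par lim'])
    show "ennreal (f (scaled_array n (a (\<kappa> j)) (b (\<kappa> j)) m)) \<le> 1" for j m using f01 by (simp add: ennreal_le_1)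
    fix N m' y'
    assume l: "scaled_lim (tri n) (\<lambda>j. a (\<kappa> (j + N))) (\<lambda>j. b (\<kappa> (j + N))) m' y'"
    have "limitin (powertop_real (tri n)) (\<lambda>j. scaled_array n (a (\<kappa> (j + N))) (b (\<kappa> (j + N))) (m' j)) (restrict y' (tri n)) sequentially"
      unfolding limitin_componentwise
    proof (intro conjI ballI)
      show "\<forall>\<^sub>F j in sequentially. scaled_array n (a (\<kappa> (j + N))) (b (\<kappa> (j + N))) (m' j) \<in> topspace (powertop_real (tri n))"
        using scaled_array_PiE by simp
      fix q assume q: "q \<in> tri n"
      show "limitin euclideanreal (\<lambda>j. scaled_array n (a (\<kappa> (j + N))) (b (\<kappa> (j + N))) (m' j) q) (restrict y' (tri n) q) sequentially"
        using l q by (simp add: scaled_array_at scaled_lim_def)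
    qed simp
    from continuous_map_limit[OF fc this]
    have "(\<lambda>j. f (scaled_array n (a (\<kappa> (j + N))) (b (\<kappa> (j + N))) (m' j))) \<longlonglongrightarrow> f (restrict y' (tri n))"
      by (simp add: o_def)
    then show "(\<lambda>j. ennreal (f (scaled_array n (a (\<kappa> (j + N))) (b (\<kappa> (j + N))) (m' j)))) \<longlonglongrightarrow> ennreal (f (restrict y' (tri n)))"
      by (rule tendsto_ennrealI)
  qed simp
  have den: "(\<lambda>j. lat_avg (\<kappa> j) (\<lambda>_. 1) (m j)) \<longlonglongrightarrow> gap_avg n (\<lambda>_. 1) y"
    by (rule nest_tendsto[where F = "\<lambda>_ _. 1" and a = "\<lambda>j. a (\<kappa> j)" and b = "\<lambda>j. b (\<kappa> j)" and B = 1, OF wt_pos b' finite_tri _ _ _ par lim']) simp_all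
  have "gap_avg n (\<lambda>z. ennreal (f (restrict z (tri n)))) y / gap_avg n (\<lambda>_. 1) y \<le> 1"
  proof -
    have "(\<integral>\<^sup>+z. ennreal (f (restrict z (tri n))) \<partial>uniform_kernel n (pat_row n y)) \<le> (\<integral>\<^sup>+z. 1 \<partial>uniform_kernel n (pat_row n y))"
      using f01 by (intro nn_integral_mono) (simp add: ennreal_le_1)
    also have "\<dots> = 1"
      using uniform_kernel_mass[OF n y(2,1)] sets_eq_imp_space_eq[OF sets_uniform_kernel[of n "pat_row n y"]] by simp
    finally show ?thesis unfolding uniform_kernel_integral[OF n y(2,1) F_measurable] .
  qed
  then have fin: "gap_avg n (\<lambda>z. ennreal (f (restrict z (tri n)))) y / gap_avg n (\<lambda>_. 1) y \<noteq> \<top>"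
    by (rule neq_top_trans[rotated]) simp
  have num_fin: "gap_avg n (\<lambda>z. ennreal (f (restrict z (tri n)))) y \<noteq> \<infinity>"
    using fin gap_avg_finite[of n y] unfolding ennreal_divide_eq_top_iff infinity_ennreal_def by blast
  have "(\<lambda>j. enn2real (lat_avg (\<kappa> j) (\<lambda>m. ennreal (f (scaled_array n (a (\<kappa> j)) (b (\<kappa> j)) m))) (m j) / lat_avg (\<kappa> j) (\<lambda>_. 1) (m j)))
     \<longlonglongrightarrow> enn2real (gap_avg n (\<lambda>z. ennreal (f (restrict z (tri n)))) y / gap_avg n (\<lambda>_. 1) y)"
  proof (rule tendsto_enn2real)
    have "ennreal (enn2real (gap_avg n (\<lambda>z. ennreal (f (restrict z (tri n)))) y / gap_avg n (\<lambda>_. 1) y))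
      = gap_avg n (\<lambda>z. ennreal (f (restrict z (tri n)))) y / gap_avg n (\<lambda>_. 1) y"
      using fin by (intro ennreal_enn2real) (simp only: less_top)
    then show "(\<lambda>j. lat_avg (\<kappa> j) (\<lambda>m. ennreal (f (scaled_array n (a (\<kappa> j)) (b (\<kappa> j)) m))) (m j) / lat_avg (\<kappa> j) (\<lambda>_. 1) (m j))
      \<longlonglongrightarrow> ennreal (enn2real (gap_avg n (\<lambda>z. ennreal (f (restrict z (tri n)))) y / gap_avg n (\<lambda>_. 1) y))"
      using tendsto_divide_ennreal'[OF num den num_fin gap_avg_pos[OF y]] by (simp only:)
  qed (rule enn2real_nonneg)
  then show ?thesis unfolding lat_mean_def gap_mean_def by (intro tendsto_min tendsto_const)
qed

text \<open>Otherwise there would be a sequence of arrays along which the discrete means do not converge to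
  the continuous mean.\<close>

lemma lat_mean_locally_le:
  assumes y: "good_top n y" "y \<in> space (coord_space (tri n))" and eps: "\<epsilon> > 0"
  shows "\<exists>\<delta>>0. \<exists>K. \<forall>k\<ge>K. \<forall>m. coord_dist (tri n) y (scaled_array n (a k) (b k) m) < \<delta> \<longrightarrow> lat_mean k m \<le> gap_mean y + \<epsilon>"
proof (rule ccontr)
  assume "\<not> ?thesis"
  then have "\<exists>k m. j \<le> k \<and> coord_dist (tri n) y (scaled_array n (a k) (b k) m) < 1 / real (Suc j) \<and> \<not> lat_mean k m \<le> gap_mean y + \<epsilon>" for j
    by (meson of_nat_0_less_iff zero_less_Suc zero_less_divide_1_iff)
  then obtain \<kappa> m where \<kappa>: "\<And>j. j \<le> \<kappa> j"
    and near: "\<And>j. coord_dist (tri n) y (scaled_array n (a (\<kappa> j)) (b (\<kappa> j)) (m j)) < 1 / real (Suc j)"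
    and big: "\<And>j. \<not> lat_mean (\<kappa> j) (m j) \<le> gap_mean y + \<epsilon>" by metis
  have \<kappa>_lim: "filterlim \<kappa> at_top sequentially"
    by (rule filterlim_at_top_mono[OF filterlim_ident]) (use \<kappa> in simp)
  have "scaled_lim (tri n) (a \<circ> \<kappa>) (b \<circ> \<kappa>) m y"
    unfolding scaled_lim_def
  proof
    fix p assume p: "p \<in> tri n"
    have "(\<lambda>j. (of_int (m j p) - a (\<kappa> j)) / b (\<kappa> j) - y p) \<longlonglongrightarrow> 0"
    proof (rule Lim_null_comparison[OF always_eventually LIMSEQ_inverse_real_of_nat])
      show "\<forall>j. norm ((of_int (m j p) - a (\<kappa> j)) / b (\<kappa> j) - y p) \<le> inverse (real (Suc j))"
      proof
        fix j
        have "norm ((of_int (m j p) - a (\<kappa> j)) / b (\<kappa> j) - y p) = \<bar>y p - scaled_array n (a (\<kappa> j)) (b (\<kappa> j)) (m j) p\<bar>"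
          unfolding scaled_array_at[OF p] real_norm_def by (rule abs_minus_commute)
        also have "\<dots> \<le> coord_dist (tri n) y (scaled_array n (a (\<kappa> j)) (b (\<kappa> j)) (m j))"
          unfolding coord_dist_def using finite_tri p
          by (intro member_le_sum[where f = "\<lambda>p. \<bar>y p - scaled_array n (a (\<kappa> j)) (b (\<kappa> j)) (m j) p\<bar>"]) simp_all
        also have "\<dots> \<le> inverse (real (Suc j))" using near[of j] by (simp only: inverse_eq_divide less_imp_le)
        finally show "norm ((of_int (m j p) - a (\<kappa> j)) / b (\<kappa> j) - y p) \<le> inverse (real (Suc j))" .
      qed
    qed
    then show "(\<lambda>j. (of_int (m j p) - (a \<circ> \<kappa>) j) / (b \<circ> \<kappa>) j) \<longlonglongrightarrow> y p"
      unfolding o_def by (rule LIM_zero_cancel)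
  qed
  from lat_mean_tendsto[OF \<kappa>_lim this y] have "(\<lambda>j. lat_mean (\<kappa> j) (m j)) \<longlonglongrightarrow> gap_mean y" .
  from order_tendstoD(2)[OF this, of "gap_mean y + \<epsilon>"] eps
  have "\<forall>\<^sub>F j in sequentially. lat_mean (\<kappa> j) (m j) < gap_mean y + \<epsilon>" by simp
  then obtain j where "lat_mean (\<kappa> j) (m j) < gap_mean y + \<epsilon>" by (auto simp: eventually_sequentially)
  with big[of j] show False by simp
qed

lemma weak_scaled:
  assumes "continuous_map (powertop_real (tri n)) euclideanreal g" "bounded (g ` (tri n \<rightarrow>\<^sub>E UNIV))"
  shows "(\<lambda>k. \<integral>m. g (scaled_array n (a k) (b k) m) \<partial>measure_pmf (\<rho> k)) \<longlonglongrightarrow> (\<integral>y. g y \<partial>\<mu>)"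
  using weak[unfolded weakly_converges_def, rule_format, OF conjI[OF assms]]
  unfolding integral_rescaled_law[OF continuous_map_coord_measurable[OF assms(1)]] .

lemma integral_gap_mean: "(\<integral>y. gap_mean y \<partial>\<mu>) = (\<integral>y. f y \<partial>mixture)"
proof -
  have "(\<integral>\<^sup>+y. ennreal (gap_mean y) \<partial>\<mu>) = (\<integral>\<^sup>+y. (\<integral>\<^sup>+z. ennreal (f z) \<partial>uniform_kernel n (pat_row n y)) \<partial>\<mu>)"
  proof (rule nn_integral_cong_AE)
    show "AE y in \<mu>. ennreal (gap_mean y) = (\<integral>\<^sup>+z. ennreal (f z) \<partial>uniform_kernel n (pat_row n y))"
      using good AE_space
    proof eventually_elim
      case (elim y)
      then have y: "y \<in> space (coord_space (tri n))" by (simp add: space_\<mu>)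
      let ?k = "uniform_kernel n (pat_row n y)"
      have sp: "space ?k = space (coord_space (tri n))" by (rule sets_eq_imp_space_eq) simp
      have "(\<integral>\<^sup>+z. ennreal (f z) \<partial>?k) = (\<integral>\<^sup>+z. ennreal (f (restrict z (tri n))) \<partial>?k)"
      proof (rule nn_integral_cong)
        fix z assume "z \<in> space ?k"
        then have "restrict z (tri n) = z" unfolding sp space_PiM by (intro PiE_restrict)
        then show "ennreal (f z) = ennreal (f (restrict z (tri n)))" by simp
      qed
      then have e: "(\<integral>\<^sup>+z. ennreal (f z) \<partial>?k) = gap_avg n (\<lambda>z. ennreal (f (restrict z (tri n)))) y / gap_avg n (\<lambda>_. 1) y"
        unfolding uniform_kernel_integral[OF n y elim(1) F_measurable] .
      have "(\<integral>\<^sup>+z. ennreal (f z) \<partial>?k) \<le> (\<integral>\<^sup>+z. 1 \<partial>?k)" using f01 by (intro nn_integral_mono) (simp add: ennreal_le_1)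
      also have "\<dots> = 1" using uniform_kernel_mass[OF n y elim(1)] sp by simp
      finally have le: "(\<integral>\<^sup>+z. ennreal (f z) \<partial>?k) \<le> 1" .
      then have fin: "(\<integral>\<^sup>+z. ennreal (f z) \<partial>?k) < \<top>" by (rule le_less_trans) simp
      have "enn2real (\<integral>\<^sup>+z. ennreal (f z) \<partial>?k) \<le> 1" using enn2real_mono[OF le] by simp
      then show ?case unfolding gap_mean_def e[symmetric] using fin by (simp add: min_absorb2 ennreal_enn2real)
    qed
  qed
  also have "\<dots> = (\<integral>\<^sup>+y. ennreal (f y) \<partial>mixture)"
    by (rule nn_integral_bind[symmetric, OF measurable_compose[OF f_measurable measurable_ennreal] kernel_measurable])
  finally have "enn2real (\<integral>\<^sup>+y. ennreal (gap_mean y) \<partial>\<mu>) = enn2real (\<integral>\<^sup>+y. ennreal (f y) \<partial>mixture)" by simp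
  moreover have "f \<in> borel_measurable mixture" using f_measurable measurable_cong_sets[OF sets_mixture refl] by blast
  ultimately show ?thesis using gap_mean_measurable mean_bounds(2) f01 by (simp add: integral_eq_nn_integral)
qed

text \<open>The discrete conditional means have the same integrals as \<open>f\<close>, and in the limit they are bounded
  by the conditional means for the uniform kernel.\<close>

lemma integral_le_mixture: "(\<integral>y. f y \<partial>\<mu>) \<le> (\<integral>y. f y \<partial>mixture)"
proof (rule field_le_epsilon)
  fix \<epsilon> :: real assume eps: "\<epsilon> > 0"
  have "\<forall>\<^sub>F k in sequentially. (\<integral>m. lat_mean k m \<partial>measure_pmf (\<rho> k)) \<le> (\<integral>y. gap_mean y \<partial>\<mu>) + \<epsilon>"
  proof (rule extended_mapping_upper[where I = "tri n" and x = "\<lambda>k. scaled_array n (a k) (b k)" and C = 1])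
    show "AE y in \<mu>. \<forall>\<epsilon>>0. \<exists>\<delta>>0. \<exists>K. \<forall>k\<ge>K. \<forall>m. coord_dist (tri n) y (scaled_array n (a k) (b k) m) < \<delta> \<longrightarrow> lat_mean k m \<le> gap_mean y + \<epsilon>"
      using good AE_space
    proof eventually_elim
      case (elim y)
      then show ?case using lat_mean_locally_le[of y] by (simp add: space_\<mu>)
    qed
  qed (fact finite_tri prob sets_\<mu> weak_scaled mean_bounds gap_mean_measurable eps)+
  moreover have "\<forall>\<^sub>F k in sequentially. b k > 0" using b by (simp add: filterlim_at_top_dense)
  ultimately have ev: "\<forall>\<^sub>F k in sequentially. (\<integral>m. f (scaled_array n (a k) (b k) m) \<partial>measure_pmf (\<rho> k)) \<le> (\<integral>y. f y \<partial>mixture) + \<epsilon>"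
    by eventually_elim (simp add: integral_lat_mean integral_gap_mean)
  have lim: "(\<lambda>k. \<integral>m. f (scaled_array n (a k) (b k) m) \<partial>measure_pmf (\<rho> k)) \<longlonglongrightarrow> (\<integral>y. f y \<partial>\<mu>)"
    by (rule weak_scaled[OF fc]) (use f01 in \<open>auto simp: bounded_iff intro!: exI[of _ 1]\<close>)
  show "(\<integral>y. f y \<partial>\<mu>) \<le> (\<integral>y. f y \<partial>mixture) + \<epsilon>"
    by (rule tendsto_upperbound[OF lim ev sequentially_bot])
qed

end

text \<open>The one-sided bound for \<open>f\<close> and for \<open>1 - f\<close> gives equality.\<close>

theorem limit_is_mixture: "\<mu> = mixture"
proof (rule measure_eqI_continuous[OF prob sets_\<mu> prob_mixture sets_mixture])
  fix f :: "(nat \<times> nat \<Rightarrow> real) \<Rightarrow> real"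
  assume fc: "continuous_map (powertop_real (tri n)) euclideanreal f" and f: "\<And>y. 0 \<le> f y \<and> f y \<le> 1"
  have 1: "(\<integral>y. f y \<partial>\<mu>) \<le> (\<integral>y. f y \<partial>mixture)" by (rule integral_le_mixture[OF fc f])
  have c: "continuous_map (powertop_real (tri n)) euclideanreal (\<lambda>y. 1 - f y)" 
    by (intro continuous_map_diff fc) simp
  have 2: "(\<integral>y. 1 - f y \<partial>\<mu>) \<le> (\<integral>y. 1 - f y \<partial>mixture)"
    by (rule integral_le_mixture[OF c]) (use f in simp)
  have e: "(\<integral>y. 1 - f y \<partial>M) = 1 - (\<integral>y. f y \<partial>M)" if "prob_space M" "sets M = sets (coord_space (tri n))" for M
  proof -
    interpret M: prob_space M by fact
    have "f \<in> borel_measurable M"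
      using continuous_map_coord_measurable[OF fc] measurable_cong_sets[OF that(2) refl] by blast
    then have "integrable M f" using f by (intro M.integrable_const_bound[of _ 1] AE_I2) simp_all
    then show ?thesis using M.prob_space by simp
  qed
  show "(\<integral>y. f y \<partial>\<mu>) = (\<integral>y. f y \<partial>mixture)"
    using 1 2 unfolding e[OF prob sets_\<mu>] e[OF prob_mixture sets_mixture] by linarith
qed

end

text \<open>In the cone the top row is weakly increasing, since each of its neighbouring pairs encloses an
  entry of the row below.\<close>

lemma good_top_AE:
  assumes \<mu>: "prob_space \<mu>" "sets \<mu> = sets (coord_space (tri n))" and cone: "AE y in \<mu>. y \<in> GT_cone n"
    and no: "\<P>(y in \<mu>. \<exists>i\<in>{1..n - 2}. y (n, i) = y (n, i + 1) \<and> y (n, i + 1) = y (n, i + 2)) = 0"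
  shows "AE y in \<mu>. good_top n y"
proof -
  interpret prob_space \<mu> by fact
  let ?P = "\<lambda>y i. y (n, i) = y (n, i + 1) \<and> y (n, i + 1) = y (n, i + 2)"
  have sp: "space \<mu> = space (coord_space (tri n))" by (rule sets_eq_imp_space_eq[OF \<mu>(2)])
  have "{y \<in> space (coord_space (tri n)). \<exists>i\<in>{1..n - 2}. ?P y i} \<in> sets (coord_space (tri n))"
  proof (rule sets.sets_Collect_finite_Ex)
    fix i assume i: "i \<in> {1..n - 2}"
    then have "(n, i) \<in> tri n" "(n, i + 1) \<in> tri n" "(n, i + 2) \<in> tri n" by (auto simp: tri_def)
    then have "(\<lambda>y. y (n, i)) \<in> borel_measurable (coord_space (tri n))" "(\<lambda>y. y (n, i + 1)) \<in> borel_measurable (coord_space (tri n))"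
      "(\<lambda>y. y (n, i + 2)) \<in> borel_measurable (coord_space (tri n))" by (blast intro: measurable_coord)+
    then show "{y \<in> space (coord_space (tri n)). ?P y i} \<in> sets (coord_space (tri n))"
      by (intro sets.sets_Collect_conj borel_measurable_eq)
  qed simp
  then have "{y \<in> space \<mu>. \<exists>i\<in>{1..n - 2}. ?P y i} \<in> events" using \<mu>(2) sp by simp
  then have "AE y in \<mu>. \<not> (\<exists>i\<in>{1..n - 2}. ?P y i)"
    using no by (subst (asm) prob_eq_0) simp_all
  with cone show ?thesis
  proof eventually_elim
    case (elim y)
    have "y (n, i) \<le> y (n, Suc i)" if i: "i \<in> {1..<n}" for i
    proof -
      have "(n - 1, i) \<in> tri (n - 1)" using i by (auto simp: tri_def)
      then have "y (lpar (n - 1, i)) \<le> y (rpar (n - 1, i))"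
        using elim(1) by (auto simp: GT_cone_iff_cell cell_def set_tri_list intro: order_trans)
      then show ?thesis using i by (simp add: lpar_def rpar_def)
    qed
    then show ?case unfolding good_top_def using elim(2) by blast
  qed
qed

theorem proposition6p7:
  fixes n :: nat
    and w :: "nat \<Rightarrow> real"
    and \<rho> :: "nat \<Rightarrow> (nat \<times> nat \<Rightarrow> int) pmf"
    and a b :: "nat \<Rightarrow> real"
    and \<mu> :: "(nat \<times> nat \<Rightarrow> real) measure"
  assumes "n \<ge> 1"
    and "\<And>t. t \<in> {1..6} \<Longrightarrow> w t > 0"
    and "\<And>k. set_pmf (\<rho> k) \<subseteq> nonneg_patterns n"
    and "\<And>k. six_vertex_gibbs n w (\<rho> k)"
    and "filterlim b at_top sequentially"
    and "prob_space \<mu>"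
    and "sets \<mu> = sets (coord_space (tri n))"
    and "AE y in \<mu>. y \<in> GT_cone n"
    and "weakly_converges (tri n)
           (\<lambda>k. distr (pattern_law n (\<rho> k)) (coord_space (tri n)) (rescale n (a k) (b k))) \<mu>"
    and "\<P>(y in \<mu>. \<exists>i\<in>{1..n - 2}. y (n, i) = y (n, i + 1) \<and> y (n, i + 1) = y (n, i + 2)) = 0"
  shows "continuous_gibbs n \<mu>"
proof -
  have good: "AE y in \<mu>. good_top n y" by (rule good_top_AE[OF assms(6,7,8,10)])
  interpret gibbs_limit n w \<rho> a b \<mu>
    by (rule gibbs_limit.intro[OF assms(1-7) good assms(9)])
  show ?thesis by (rule continuous_gibbs_if_mixture[OF assms(1,6,7) good limit_is_mixture])
qed

end
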